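(* Let $k,d\ge 0$ be integers and let $W$ be an FI-module with $\deg H_0(W)\le k$ and $\deg H_1(W)\le d$. Then $W$ has regularity $\le k+d-1$; that is, for all $p>0$, $$\deg H_p(W)\le p+k+d-1 .$$
   Context: $\mathrm{FI}$ is the category of finite sets and injections. An FI-module is a functor $W\colon \mathrm{FI}\to \mathbb{Z}\text{-Mod}$; FI-modules form an abelian category $\mathrm{FI}\text{-Mod}$ (natural transformations as morphisms). Write $W_T=W(T)$, $[n]=\{1,\dots,n\}$, $W_n=W_{[n]}$ for $n\in\mathbb{N}=\{0,1,2,\dots\}$, and $f_*\colon W_S\to W_T$ for the map induced by an injection $f\colon S\hookrightarrow T$. Degree: $\deg W=\inf\{k\in\{-\infty\}\cup\mathbb{N}\cup\{\infty\}\mid W_n=0\text{ for all }n\in\mathbb{N}\text{ with }n>k\}$; so $\deg 0=-\infty$. FI-homology: $H_0\colon \mathrm{FI}\text{-Mod}\to\mathrm{FI}\text{-Mod}$ is the right-exact functor $H_0(W)_T=W_T/\operatorname{span}(\operatorname{im} f_*\colon W_S\to W_T\mid f\colon S\hookrightarrow T,\ |S|<|T|)$, and $H_p$ is its $p$-th left-derived functor. *)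

theory Defs
  imports "HOL-Algebra.Algebra" "HOL-Library.Extended_Real" "HOL-Library.Infinite_Typeclass"
begin

section \<open>FI-modules\<close>

text \<open>
  The category FI is represented by its full subcategory on the finite subsets of \<^typ>\<open>nat\<close>,
  which contains every \<open>[n] = {1..n}\<close> and meets every isomorphism class of finite sets.
  Injections are extensional, so that they are equal iff they agree on their source.
  \<open>\<int>\<close>-modules are commutative groups in the (multiplicatively written) sense of \<^locale>\<open>comm_group\<close>.
  Values at infinite sets carry no information.
\<close>

definition FI_hom :: "nat set \<Rightarrow> nat set \<Rightarrow> (nat \<Rightarrow> nat) set" where
  "FI_hom S T = {f \<in> S \<rightarrow>\<^sub>E T. inj_on f S}"

record 'a fi_functor =
  ob :: "nat set \<Rightarrow> 'a monoid"
  mp :: "nat set \<Rightarrow> nat set \<Rightarrow> (nat \<Rightarrow> nat) \<Rightarrow> 'a \<Rightarrow> 'a"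

locale fi_module =
  fixes W :: "'a fi_functor"
  assumes ob_comm_group: "finite T \<Longrightarrow> comm_group (ob W T)"
    and mp_hom: "\<lbrakk>finite S; finite T; f \<in> FI_hom S T\<rbrakk> \<Longrightarrow> mp W S T f \<in> hom (ob W S) (ob W T)"
    and mp_id: "\<lbrakk>finite T; x \<in> carrier (ob W T)\<rbrakk> \<Longrightarrow> mp W T T (\<lambda>i\<in>T. i) x = x"
    and mp_compose: "\<lbrakk>finite S; finite T; finite U; f \<in> FI_hom S T; g \<in> FI_hom T U;
          x \<in> carrier (ob W S)\<rbrakk>
        \<Longrightarrow> mp W S U (compose S g f) x = mp W T U g (mp W S T f x)"

type_synonym ('a, 'b) fi_nat_trans = "nat set \<Rightarrow> 'a \<Rightarrow> 'b"

definition fi_hom :: "'a fi_functor \<Rightarrow> 'b fi_functor \<Rightarrow> ('a, 'b) fi_nat_trans set" where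
  "fi_hom V W = {\<eta>.
     (\<forall>T. finite T \<longrightarrow> \<eta> T \<in> hom (ob V T) (ob W T)) \<and>
     (\<forall>S T f x. finite S \<longrightarrow> finite T \<longrightarrow> f \<in> FI_hom S T \<longrightarrow> x \<in> carrier (ob V S) \<longrightarrow>
        \<eta> T (mp V S T f x) = mp W S T f (\<eta> S x))}"

definition fi_surj :: "'a fi_functor \<Rightarrow> 'b fi_functor \<Rightarrow> ('a, 'b) fi_nat_trans \<Rightarrow> bool" where
  "fi_surj V W \<eta> \<longleftrightarrow> (\<forall>T. finite T \<longrightarrow> \<eta> T ` carrier (ob V T) = carrier (ob W T))"

definition fi_degree :: "'a fi_functor \<Rightarrow> ereal" where
  "fi_degree W = Inf {k. (k = -\<infinity> \<or> k \<in> range (\<lambda>m::nat. ereal (real m)) \<or> k = \<infinity>) \<and>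
     (\<forall>n::nat. ereal (real n) > k \<longrightarrow> trivial_group (ob W {1..n}))}"


section \<open>The functor \<open>H\<^sub>0\<close>\<close>

definition H0_span :: "'a fi_functor \<Rightarrow> nat set \<Rightarrow> 'a set" where
  "H0_span W T = generate (ob W T)
     (\<Union>{mp W S T f ` carrier (ob W S) | S f. finite S \<and> f \<in> FI_hom S T \<and> card S < card T})"

text \<open>
  Elements of a quotient are cosets. A homomorphism \<open>h\<close> carrying a subgroup \<open>M\<close> into a subgroup
  \<open>N\<close> induces on the quotients the map taking a coset \<open>C\<close> of \<open>M\<close> to the product set
  \<open>N <#> h ` C\<close>, which is the coset \<open>N #> h c\<close> for every \<open>c \<in> C\<close>.
\<close>

definition H0 :: "'a fi_functor \<Rightarrow> 'a set fi_functor" where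
  "H0 W = \<lparr>ob = (\<lambda>T. ob W T Mod H0_span W T),
           mp = (\<lambda>S T f C. H0_span W T <#>\<^bsub>ob W T\<^esub> mp W S T f ` C)\<rparr>"

definition H0_map ::
  "'a fi_functor \<Rightarrow> 'a fi_functor \<Rightarrow> ('a, 'a) fi_nat_trans \<Rightarrow> ('a set, 'a set) fi_nat_trans" where
  "H0_map V W \<eta> T C = H0_span W T <#>\<^bsub>ob W T\<^esub> \<eta> T ` C"


section \<open>Left derived functors\<close>

text \<open>
  Everything lives in the category of FI-modules whose values are carried by subsets of a fixed
  infinite type. Such a category contains an isomorphic copy of the free cover
  of each of its objects (lemma \<open>fi_free_cover_exists\<close> below). Hence it has enough projectives,
  and an object is projective in it iff it is a direct summand of a free FI-module,
  iff it is projective among all FI-modules.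
\<close>

definition fi_projective :: "'a::infinite fi_functor \<Rightarrow> bool" where
  "fi_projective P \<longleftrightarrow> fi_module P \<and>
     (\<forall>(E :: 'a fi_functor) (B :: 'a fi_functor) \<pi> \<phi>.
        fi_module E \<longrightarrow> fi_module B \<longrightarrow> \<pi> \<in> fi_hom E B \<longrightarrow> fi_surj E B \<pi> \<longrightarrow> \<phi> \<in> fi_hom P B \<longrightarrow>
        (\<exists>\<psi>\<in>fi_hom P E. \<forall>T. finite T \<longrightarrow> (\<forall>x\<in>carrier (ob P T). \<pi> T (\<psi> T x) = \<phi> T x)))"

text \<open>The differential \<open>\<delta> p\<close> goes from \<open>P (Suc p)\<close> to \<open>P p\<close>, and \<open>\<epsilon>\<close> is the augmentation.\<close>

definition projective_resolution ::
  "'a::infinite fi_functor \<Rightarrow> (nat \<Rightarrow> 'a fi_functor) \<Rightarrow> (nat \<Rightarrow> ('a, 'a) fi_nat_trans) \<Rightarrow>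
     ('a, 'a) fi_nat_trans \<Rightarrow> bool" where
  "projective_resolution W P \<delta> \<epsilon> \<longleftrightarrow>
     (\<forall>p. fi_projective (P p)) \<and>
     (\<forall>p. \<delta> p \<in> fi_hom (P (Suc p)) (P p)) \<and>
     \<epsilon> \<in> fi_hom (P 0) W \<and>
     fi_surj (P 0) W \<epsilon> \<and>
     (\<forall>T. finite T \<longrightarrow>
        \<delta> 0 T ` carrier (ob (P 1) T) = kernel (ob (P 0) T) (ob W T) (\<epsilon> T)) \<and>
     (\<forall>p T. finite T \<longrightarrow>
        \<delta> (Suc p) T ` carrier (ob (P (Suc (Suc p))) T)
          = kernel (ob (P (Suc p)) T) (ob (P p) T) (\<delta> p T))"

text \<open>Homology at \<open>B\<close> of \<open>\<alpha> : A \<rightarrow> B\<close> followed by \<open>\<beta> : B \<rightarrow> C\<close>.\<close>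

definition fi_middle_homology ::
  "'a fi_functor \<Rightarrow> 'b fi_functor \<Rightarrow> 'c fi_functor \<Rightarrow>
     ('a, 'b) fi_nat_trans \<Rightarrow> ('b, 'c) fi_nat_trans \<Rightarrow> 'b set fi_functor" where
  "fi_middle_homology A B C \<alpha> \<beta> =
     \<lparr>ob = (\<lambda>T. (ob B T)\<lparr>carrier := kernel (ob B T) (ob C T) (\<beta> T)\<rparr>
                  Mod (\<alpha> T ` carrier (ob A T))),
      mp = (\<lambda>S T f Z. (\<alpha> T ` carrier (ob A T)) <#>\<^bsub>ob B T\<^esub> mp B S T f ` Z)\<rparr>"

text \<open>
  A functor is given by its action \<open>F\<close> on objects and its action \<open>F'\<close> on morphisms, where source
  and target of the morphism are explicit arguments. In degree 0 the outgoing differential is zero.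
\<close>

definition left_derived ::
  "('a::infinite fi_functor \<Rightarrow> 'b fi_functor) \<Rightarrow>
   ('a fi_functor \<Rightarrow> 'a fi_functor \<Rightarrow> ('a, 'a) fi_nat_trans \<Rightarrow> ('b, 'b) fi_nat_trans) \<Rightarrow>
   nat \<Rightarrow> 'a fi_functor \<Rightarrow> 'b set fi_functor" where
  "left_derived F F' p W =
     (let (P, \<delta>) = (SOME (P, \<delta>). \<exists>\<epsilon>. projective_resolution W P \<delta> \<epsilon>);
          D = (\<lambda>q. F' (P (Suc q)) (P q) (\<delta> q))
      in case p of
           0 \<Rightarrow> fi_middle_homology (F (P 1)) (F (P 0)) (F (P 0)) (D 0)
                  (\<lambda>T x. \<one>\<^bsub>ob (F (P 0)) T\<^esub>)
         | Suc q \<Rightarrow> fi_middle_homology (F (P (Suc (Suc q)))) (F (P (Suc q))) (F (P q))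
                  (D (Suc q)) (D q))"

definition FI_homology :: "nat \<Rightarrow> 'a::infinite fi_functor \<Rightarrow> 'a set set fi_functor" where
  "FI_homology = left_derived H0 H0_map"


section \<open>Existence of projective resolutions\<close>

text \<open>The choice in \<^const>\<open>left_derived\<close> is justified by \<open>projective_resolution_exists\<close>.\<close>

lemma FI_hom_id: "(\<lambda>i\<in>T. i) \<in> FI_hom T T"
  by (auto simp: FI_hom_def inj_on_def)

lemma FI_hom_compose:
  "\<lbrakk>f \<in> FI_hom S T; g \<in> FI_hom T U\<rbrakk> \<Longrightarrow> compose S g f \<in> FI_hom S U"
  by (auto simp: FI_hom_def compose_def inj_on_def PiE_iff)

lemma compose_FI_assoc:
  "f \<in> FI_hom S T \<Longrightarrow> compose S h (compose S g f) = compose S (compose T h g) f"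
  by (auto simp: FI_hom_def compose_def fun_eq_iff PiE_iff)

lemma compose_FI_id: "f \<in> FI_hom S T \<Longrightarrow> compose S (\<lambda>i\<in>T. i) f = f"
  by (auto simp: FI_hom_def compose_def fun_eq_iff PiE_iff extensional_def)

lemma compose_FI_id': "f \<in> FI_hom S T \<Longrightarrow> compose S f (\<lambda>i\<in>S. i) = f"
  by (auto simp: FI_hom_def compose_def fun_eq_iff PiE_iff extensional_def)

lemma fi_hom_comp:
  assumes "\<eta> \<in> fi_hom U V" "\<theta> \<in> fi_hom V W"
  shows "(\<lambda>T x. \<theta> T (\<eta> T x)) \<in> fi_hom U W"
proof -
  have "(\<lambda>x. \<theta> T (\<eta> T x)) \<in> hom (ob U T) (ob W T)" if "finite T" for T
    using assms that by (auto simp: fi_hom_def hom_def Pi_def)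
  moreover have "\<eta> S x \<in> carrier (ob V S)" if "finite S" "x \<in> carrier (ob U S)" for S x
    using assms that by (auto simp: fi_hom_def hom_def)
  ultimately show ?thesis
    using assms by (auto simp: fi_hom_def)
qed

subsection \<open>The free cover\<close>

definition fc_basis :: "'a fi_functor \<Rightarrow> nat set \<Rightarrow> (nat set \<times> 'a \<times> (nat \<Rightarrow> nat)) set" where
  "fc_basis W T = {(S, w, f). finite S \<and> w \<in> carrier (ob W S) \<and> f \<in> FI_hom S T}"

definition fc_push ::
  "(nat \<Rightarrow> nat) \<Rightarrow> nat set \<times> 'a \<times> (nat \<Rightarrow> nat) \<Rightarrow> nat set \<times> 'a \<times> (nat \<Rightarrow> nat)" where
  "fc_push g = (\<lambda>(S, w, f). (S, w, compose S g f))"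

definition free_cover ::
  "'a fi_functor \<Rightarrow> ((nat set \<times> 'a \<times> (nat \<Rightarrow> nat)) \<Rightarrow>\<^sub>0 int) fi_functor" where
  "free_cover W = \<lparr>ob = (\<lambda>T. free_Abelian_group (fc_basis W T)),
                   mp = (\<lambda>S T g. frag_extend (\<lambda>b. frag_of (fc_push g b)))\<rparr>"

lemma fc_push_basis: "\<lbrakk>b \<in> fc_basis W S; g \<in> FI_hom S T\<rbrakk> \<Longrightarrow> fc_push g b \<in> fc_basis W T"
  by (auto simp: fc_basis_def fc_push_def intro: FI_hom_compose)

lemma frag_extend_hom:
  assumes "\<And>b. b \<in> A \<Longrightarrow> h b \<in> B"
  shows "frag_extend (\<lambda>b. frag_of (h b)) \<in> hom (free_Abelian_group A) (free_Abelian_group B)"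
proof (rule homI)
  fix x assume "x \<in> carrier (free_Abelian_group A)"
  then have x: "Poly_Mapping.keys x \<subseteq> A" by simp
  have "Poly_Mapping.keys (frag_extend (\<lambda>b. frag_of (h b)) x) \<subseteq> B"
    using keys_frag_extend[of "\<lambda>b. frag_of (h b)" x] x assms by (force split: if_splits)
  then show "frag_extend (\<lambda>b. frag_of (h b)) x \<in> carrier (free_Abelian_group B)" by simp
qed (simp add: frag_extend_add)

lemma free_hom_eq:
  assumes f: "f \<in> hom (free_Abelian_group A) G" and g: "g \<in> hom (free_Abelian_group A) G"
    and G: "group G" and eq: "\<And>a. a \<in> A \<Longrightarrow> f (frag_of a) = g (frag_of a)"
    and x: "Poly_Mapping.keys x \<subseteq> A"
  shows "f x = g x"
proof -
  interpret F: group_hom "free_Abelian_group A" G f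
    using f G by (auto simp: group_hom_def group_hom_axioms_def)
  interpret K: group_hom "free_Abelian_group A" G g
    using g G by (auto simp: group_hom_def group_hom_axioms_def)
  have diff: "h (x - y) = h x \<otimes>\<^bsub>G\<^esub> inv\<^bsub>G\<^esub> (h y)"
    if h: "group_hom (free_Abelian_group A) G h"
      and xy: "Poly_Mapping.keys x \<subseteq> A" "Poly_Mapping.keys y \<subseteq> A" for h x y
    using group_hom.hom_mult[OF h, of x "- y"] group_hom.hom_inv[OF h, of y] xy
    by simp
  show ?thesis
  proof (rule free_Abelian_group_induct[OF x])
    show "f 0 = g 0" using F.hom_one K.hom_one by simp
    show "f (x - y) = g (x - y)"
      if "Poly_Mapping.keys x \<subseteq> A" "Poly_Mapping.keys y \<subseteq> A" "f x = g x" "f y = g y" for x y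
      using that diff[OF F.group_hom_axioms] diff[OF K.group_hom_axioms] by simp
  qed (rule eq)
qed

lemma fi_module_free_cover: "fi_module (free_cover W)"
proof (rule fi_module.intro)
  fix T :: "nat set"
  show "comm_group (ob (free_cover W) T)"
    by (simp add: free_cover_def abelian_free_Abelian_group)
next
  fix S T f assume "f \<in> FI_hom S T"
  then show "mp (free_cover W) S T f \<in> hom (ob (free_cover W) S) (ob (free_cover W) T)"
    by (simp add: free_cover_def frag_extend_hom fc_push_basis)
next
  fix T x assume x: "x \<in> carrier (ob (free_cover W) T)"
  have "frag_extend (\<lambda>b. frag_of (fc_push (\<lambda>i\<in>T. i) b)) x = id x"
  proof (rule free_hom_eq[where g = id and x = x])
    show "frag_extend (\<lambda>b. frag_of (fc_push (\<lambda>i\<in>T. i) b))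
        \<in> hom (free_Abelian_group (fc_basis W T)) (free_Abelian_group (fc_basis W T))"
      by (rule frag_extend_hom) (auto intro: fc_push_basis FI_hom_id)
    show "id \<in> hom (free_Abelian_group (fc_basis W T)) (free_Abelian_group (fc_basis W T))"
      by (auto simp: hom_def)
    fix a assume "a \<in> fc_basis W T"
    then show "frag_extend (\<lambda>b. frag_of (fc_push (\<lambda>i\<in>T. i) b)) (frag_of a) = id (frag_of a)"
      by (auto simp: fc_basis_def fc_push_def compose_FI_id)
  qed (use x in \<open>auto simp: free_cover_def\<close>)
  then show "mp (free_cover W) T T (\<lambda>i\<in>T. i) x = x"
    by (simp add: free_cover_def)
next
  fix S T U f g x
  assume f: "f \<in> FI_hom S T" and g: "g \<in> FI_hom T U" and x: "x \<in> carrier (ob (free_cover W) S)"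
  let ?e = "\<lambda>h. frag_extend (\<lambda>b. frag_of (fc_push h b))"
  have h: "?e h \<in> hom (free_Abelian_group (fc_basis W A)) (free_Abelian_group (fc_basis W B))"
    if "h \<in> FI_hom A B" for h A B
    by (rule frag_extend_hom) (use that fc_push_basis in blast)
  have "?e (compose S g f) x = (?e g \<circ> ?e f) x"
  proof (rule free_hom_eq[where g = "?e g \<circ> ?e f" and x = x])
    show "?e (compose S g f)
        \<in> hom (free_Abelian_group (fc_basis W S)) (free_Abelian_group (fc_basis W U))"
      by (rule h) (use f g FI_hom_compose in blast)
    show "?e g \<circ> ?e f \<in> hom (free_Abelian_group (fc_basis W S)) (free_Abelian_group (fc_basis W U))"
      by (rule hom_compose[OF h[OF f] h[OF g]])
    show "?e (compose S g f) (frag_of a) = (?e g \<circ> ?e f) (frag_of a)" if "a \<in> fc_basis W S" for a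
      using that by (auto simp: fc_basis_def fc_push_def compose_FI_assoc)
  qed (use x in \<open>auto simp: free_cover_def\<close>)
  then show "mp (free_cover W) S U (compose S g f) x
      = mp (free_cover W) T U g (mp (free_cover W) S T f x)"
    by (simp add: free_cover_def)
qed

text \<open>The universal property: \<open>y S w\<close> is the prescribed image of the generator \<open>(S, w, id)\<close>.\<close>

lemma free_cover_universal:
  assumes E: "fi_module E"
    and y: "\<And>S w. \<lbrakk>finite S; w \<in> carrier (ob W S)\<rbrakk> \<Longrightarrow> y S w \<in> carrier (ob E S)"
  obtains \<psi> where "\<psi> \<in> fi_hom (free_cover W) E"
    and "\<And>T S w f. \<lbrakk>finite T; (S, w, f) \<in> fc_basis W T\<rbrakk>
           \<Longrightarrow> \<psi> T (frag_of (S, w, f)) = mp E S T f (y S w)"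
proof -
  interpret E: fi_module E by (rule E)
  let ?v = "\<lambda>T (S, w, f). mp E S T f (y S w)"
  have v: "?v T ` fc_basis W T \<subseteq> carrier (ob E T)" if "finite T" for T
    using E.mp_hom[OF _ that] y by (fastforce simp: fc_basis_def hom_def Pi_def)
  have "\<exists>h. h \<in> hom (free_Abelian_group (fc_basis W T)) (ob E T) \<and>
            (\<forall>b\<in>fc_basis W T. h (frag_of b) = ?v T b)" if T: "finite T" for T
  proof -
    interpret comm_group "ob E T" by (rule E.ob_comm_group[OF T])
    show ?thesis
      by (rule free_Abelian_group_universal[OF v[OF T]]) blast
  qed
  then have "\<exists>\<psi>. \<forall>T. finite T \<longrightarrow> \<psi> T \<in> hom (free_Abelian_group (fc_basis W T)) (ob E T) \<and>
      (\<forall>b\<in>fc_basis W T. \<psi> T (frag_of b) = ?v T b)"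
    by (intro choice) blast
  then obtain \<psi> where \<psi>: "\<And>T. finite T \<Longrightarrow> \<psi> T \<in> hom (free_Abelian_group (fc_basis W T)) (ob E T)"
    and \<psi>v: "\<And>T b. \<lbrakk>finite T; b \<in> fc_basis W T\<rbrakk> \<Longrightarrow> \<psi> T (frag_of b) = ?v T b"
    by blast
  have nat: "\<psi> T (mp (free_cover W) S T g x) = mp E S T g (\<psi> S x)"
    if S: "finite S" and T: "finite T" and g: "g \<in> FI_hom S T"
      and x: "x \<in> carrier (ob (free_cover W) S)" for S T g x
  proof -
    let ?e = "frag_extend (\<lambda>b. frag_of (fc_push g b))"
    have "(\<psi> T \<circ> ?e) x = (mp E S T g \<circ> \<psi> S) x"
    proof (rule free_hom_eq)
      show "\<psi> T \<circ> ?e \<in> hom (free_Abelian_group (fc_basis W S)) (ob E T)"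
        by (rule hom_compose[OF frag_extend_hom \<psi>[OF T]]) (use g fc_push_basis in blast)
      show "mp E S T g \<circ> \<psi> S \<in> hom (free_Abelian_group (fc_basis W S)) (ob E T)"
        by (rule hom_compose[OF \<psi>[OF S] E.mp_hom[OF S T g]])
      show "group (ob E T)" using E.ob_comm_group[OF T] by (simp add: comm_group_def)
      fix a assume a: "a \<in> fc_basis W S"
      obtain R w f where [simp]: "a = (R, w, f)" by (cases a)
      have R: "finite R" "w \<in> carrier (ob W R)" "f \<in> FI_hom R S"
        using a by (auto simp: fc_basis_def)
      have "\<psi> T (frag_of (fc_push g a)) = mp E R T (compose R g f) (y R w)"
        using \<psi>v[OF T fc_push_basis[OF a g]] by (simp add: fc_push_def)
      also have "\<dots> = mp E S T g (\<psi> S (frag_of a))"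
        using \<psi>v[OF S a] E.mp_compose[OF R(1) S T R(3) g y[OF R(1,2)]] by simp
      finally show "(\<psi> T \<circ> ?e) (frag_of a) = (mp E S T g \<circ> \<psi> S) (frag_of a)" by simp
    qed (use x in \<open>auto simp: free_cover_def\<close>)
    then show ?thesis by (simp add: free_cover_def)
  qed
  show ?thesis
  proof
    show "\<psi> \<in> fi_hom (free_cover W) E"
      using \<psi> nat by (auto simp: fi_hom_def) (simp add: free_cover_def)
  qed (use \<psi>v in auto)
qed

lemma free_cover_counit:
  assumes W: "fi_module W"
  obtains \<epsilon> where "\<epsilon> \<in> fi_hom (free_cover W) W" "fi_surj (free_cover W) W \<epsilon>"
proof -
  interpret W: fi_module W by (rule W)
  obtain \<epsilon> where \<epsilon>: "\<epsilon> \<in> fi_hom (free_cover W) W"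
    and v: "\<And>T S w f. \<lbrakk>finite T; (S, w, f) \<in> fc_basis W T\<rbrakk>
           \<Longrightarrow> \<epsilon> T (frag_of (S, w, f)) = mp W S T f w"
    using free_cover_universal[OF W, of W "\<lambda>S w. w"] by blast
  have "\<epsilon> T ` carrier (ob (free_cover W) T) = carrier (ob W T)" if T: "finite T" for T
  proof
    show "\<epsilon> T ` carrier (ob (free_cover W) T) \<subseteq> carrier (ob W T)"
      using \<epsilon> T by (auto simp: fi_hom_def hom_def)
    show "carrier (ob W T) \<subseteq> \<epsilon> T ` carrier (ob (free_cover W) T)"
    proof
      fix w assume w: "w \<in> carrier (ob W T)"
      have b: "(T, w, \<lambda>i\<in>T. i) \<in> fc_basis W T" using w T FI_hom_id by (simp add: fc_basis_def)
      have "w = \<epsilon> T (frag_of (T, w, \<lambda>i\<in>T. i))" using v[OF T b] W.mp_id[OF T w] by simp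
      moreover have "frag_of (T, w, \<lambda>i\<in>T. i) \<in> carrier (ob (free_cover W) T)"
        using b by (simp add: free_cover_def)
      ultimately show "w \<in> \<epsilon> T ` carrier (ob (free_cover W) T)" by blast
    qed
  qed
  with \<epsilon> that show ?thesis by (auto simp: fi_surj_def)
qed

lemma free_cover_lift:
  assumes E: "fi_module E" and B: "fi_module B" and \<pi>: "\<pi> \<in> fi_hom E B"
    and s: "fi_surj E B \<pi>" and \<phi>: "\<phi> \<in> fi_hom (free_cover W) B"
  obtains \<psi> where "\<psi> \<in> fi_hom (free_cover W) E"
    "\<And>T x. \<lbrakk>finite T; x \<in> carrier (ob (free_cover W) T)\<rbrakk> \<Longrightarrow> \<pi> T (\<psi> T x) = \<phi> T x"
proof -
  interpret E: fi_module E by (rule E)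
  interpret B: fi_module B by (rule B)
  let ?g = "\<lambda>S w. frag_of (S, w, \<lambda>i\<in>S. i)"
  have g: "?g S w \<in> carrier (ob (free_cover W) S)" if "finite S" "w \<in> carrier (ob W S)" for S w
    using that FI_hom_id by (simp add: free_cover_def fc_basis_def)
  have "\<exists>e\<in>carrier (ob E S). \<pi> S e = \<phi> S (?g S w)" if S: "finite S" "w \<in> carrier (ob W S)" for S w
  proof -
    have "\<phi> S (?g S w) \<in> carrier (ob B S)"
      using \<phi> g[OF S] S(1) by (auto simp: fi_hom_def hom_def)
    then show ?thesis using s S(1) unfolding fi_surj_def by (metis imageE)
  qed
  then obtain y where y: "\<And>S w. \<lbrakk>finite S; w \<in> carrier (ob W S)\<rbrakk> \<Longrightarrow> y S w \<in> carrier (ob E S)"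
    and \<pi>y: "\<And>S w. \<lbrakk>finite S; w \<in> carrier (ob W S)\<rbrakk> \<Longrightarrow> \<pi> S (y S w) = \<phi> S (?g S w)"
    by metis
  obtain \<psi> where \<psi>: "\<psi> \<in> fi_hom (free_cover W) E"
    and v: "\<And>T S w f. \<lbrakk>finite T; (S, w, f) \<in> fc_basis W T\<rbrakk>
           \<Longrightarrow> \<psi> T (frag_of (S, w, f)) = mp E S T f (y S w)"
    using free_cover_universal[OF E, of W y] y by blast
  have "\<pi> T (\<psi> T x) = \<phi> T x" if T: "finite T" and x: "x \<in> carrier (ob (free_cover W) T)" for T x
  proof -
    have "(\<pi> T \<circ> \<psi> T) x = \<phi> T x"
    proof (rule free_hom_eq)
      show "\<pi> T \<circ> \<psi> T \<in> hom (free_Abelian_group (fc_basis W T)) (ob B T)"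
        by (rule hom_compose[of _ _ "ob E T"]) (use \<psi> \<pi> T in \<open>auto simp: fi_hom_def free_cover_def\<close>)
      show "\<phi> T \<in> hom (free_Abelian_group (fc_basis W T)) (ob B T)"
        using \<phi> T by (auto simp: fi_hom_def free_cover_def)
      show "group (ob B T)" using B.ob_comm_group[OF T] by (simp add: comm_group_def)
      fix a assume a: "a \<in> fc_basis W T"
      obtain R w f where [simp]: "a = (R, w, f)" by (cases a)
      have R: "finite R" "w \<in> carrier (ob W R)" "f \<in> FI_hom R T"
        using a by (auto simp: fc_basis_def)
      have "\<pi> T (\<psi> T (frag_of a)) = \<pi> T (mp E R T f (y R w))"
        using v[OF T] a by simp
      also have "\<dots> = mp B R T f (\<phi> R (?g R w))"
        using \<pi> R T y \<pi>y by (auto simp: fi_hom_def)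
      also have "\<dots> = \<phi> T (mp (free_cover W) R T f (?g R w))"
        using \<phi> R T g[OF R(1,2)] by (auto simp: fi_hom_def)
      also have "mp (free_cover W) R T f (?g R w) = frag_of a"
        using R(3) by (simp add: free_cover_def fc_push_def compose_FI_id')
      finally show "(\<pi> T \<circ> \<psi> T) (frag_of a) = \<phi> T (frag_of a)" by simp
    qed (use x in \<open>auto simp: free_cover_def\<close>)
    then show ?thesis by simp
  qed
  with \<psi> that show ?thesis by blast
qed

subsection \<open>Transport to the given type\<close>

lemma transport_fi_module:
  fixes V :: "'b fi_functor" and j :: "'b \<Rightarrow> 'a"
  assumes V: "fi_module V" and j: "\<And>T. finite T \<Longrightarrow> carrier (ob V T) \<subseteq> Z" "inj_on j Z"
  obtains V' :: "'a fi_functor" and \<alpha> \<beta> where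
    "fi_module V'" "\<alpha> \<in> fi_hom V V'" "\<beta> \<in> fi_hom V' V"
    "\<And>T x. \<lbrakk>finite T; x \<in> carrier (ob V T)\<rbrakk> \<Longrightarrow> \<beta> T (\<alpha> T x) = x"
    "\<And>T x. \<lbrakk>finite T; x \<in> carrier (ob V' T)\<rbrakk> \<Longrightarrow> \<alpha> T (\<beta> T x) = x"
proof -
  interpret V: fi_module V by (rule V)
  define i where "i = the_inv_into Z j"
  have ij [simp]: "i (j x) = x" if "x \<in> Z" for x
    using that j(2) by (simp add: i_def the_inv_into_f_f)
  have cX: "x \<in> Z" if "finite T" "x \<in> carrier (ob V T)" for x T using that j(1) by blast
  define V' where "V' = \<lparr>ob = (\<lambda>T. \<lparr>carrier = j ` carrier (ob V T),
        monoid.mult = (\<lambda>x y. j (i x \<otimes>\<^bsub>ob V T\<^esub> i y)), one = j \<one>\<^bsub>ob V T\<^esub>\<rparr>),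
      mp = (\<lambda>S T f x. j (mp V S T f (i x)))\<rparr>"
  have cl: "mp V S T f x \<in> carrier (ob V T)"
    if "finite S" "finite T" "f \<in> FI_hom S T" "x \<in> carrier (ob V S)" for S T f x
    using V.mp_hom[OF that(1-3)] that(4) by (auto simp: hom_def)
  have mod: "fi_module V'"
  proof (rule fi_module.intro)
    fix T :: "nat set" assume T: "finite T"
    interpret G: comm_group "ob V T" by (rule V.ob_comm_group[OF T])
    show "comm_group (ob V' T)"
    proof (rule comm_groupI)
      fix x assume "x \<in> carrier (ob V' T)"
      then obtain a where a: "a \<in> carrier (ob V T)" "x = j a" by (auto simp: V'_def)
      show "\<exists>y\<in>carrier (ob V' T). y \<otimes>\<^bsub>ob V' T\<^esub> x = \<one>\<^bsub>ob V' T\<^esub>"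
        using a cX[OF T] by (auto simp: V'_def intro!: bexI[of _ "inv\<^bsub>ob V T\<^esub> a"])
    qed (use cX[OF T] in \<open>auto simp: V'_def G.m_ac\<close>)
  next
    fix S T f assume a: "finite S" "finite T" "f \<in> FI_hom S T"
    interpret G: comm_group "ob V S" by (rule V.ob_comm_group[OF a(1)])
    show "mp V' S T f \<in> hom (ob V' S) (ob V' T)"
      using V.mp_hom[OF a] cl[OF a] cX[OF a(1)] cX[OF a(2)]
      by (auto simp: V'_def hom_def)
  next
    fix T x assume "finite T" "x \<in> carrier (ob V' T)"
    then show "mp V' T T (\<lambda>i\<in>T. i) x = x"
      using cX V.mp_id by (auto simp: V'_def)
  next
    fix S T U f g x
    assume "finite S" "finite T" "finite U" "f \<in> FI_hom S T" "g \<in> FI_hom T U"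
      "x \<in> carrier (ob V' S)"
    then show "mp V' S U (compose S g f) x = mp V' T U g (mp V' S T f x)"
      using cX cl V.mp_compose by (auto simp: V'_def)
  qed
  have 1: "(\<lambda>T. j) \<in> fi_hom V V'"
    using cX cl by (auto simp: fi_hom_def hom_def V'_def)
  have 2: "(\<lambda>T. i) \<in> fi_hom V' V"
  proof -
    have "i \<in> hom (ob V' T) (ob V T)" if T: "finite T" for T
    proof -
      interpret G: comm_group "ob V T" by (rule V.ob_comm_group[OF T])
      show ?thesis using cX[OF T] by (auto simp: hom_def V'_def)
    qed
    then show ?thesis using cX cl by (auto simp: fi_hom_def V'_def)
  qed
  have 3: "i (j x) = x" if "finite T" "x \<in> carrier (ob V T)" for T x
    using cX[OF that] by simp
  have 4: "j (i x) = x" if "finite T" "x \<in> carrier (ob V' T)" for T x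
    using cX[OF that(1)] that(2) by (auto simp: V'_def)
  show ?thesis
    by (rule that[OF mod 1 2 3 4])
qed

lemma free_cover_embeds:
  fixes W :: "'a::infinite fi_functor"
  obtains Z and j :: "((nat set \<times> 'a \<times> (nat \<Rightarrow> nat)) \<Rightarrow>\<^sub>0 int) \<Rightarrow> 'a"
  where "\<And>T. finite T \<Longrightarrow> carrier (ob (free_cover W) T) \<subseteq> Z" "inj_on j Z"
proof -
  define C where "C = (\<Union>S\<in>{S. finite S}. \<Union>T\<in>{T. finite T}. FI_hom S T)"
  define BB where "BB = {S :: nat set. finite S} \<times> (UNIV :: 'a set) \<times> C"
  have fin: "finite (FI_hom S T)" if "finite S" "finite T" for S T
    by (rule finite_subset[OF _ finite_PiE[OF that(1), of "\<lambda>_. T"]])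
      (use that in \<open>auto simp: FI_hom_def\<close>)
  have cf: "countable {S :: nat set. finite S}" by (rule countable_Collect_finite)
  have C: "countable C"
    unfolding C_def by (intro countable_UN cf) (auto intro!: countable_finite fin)
  have C0: "(\<lambda>i\<in>{}. i) \<in> C"
    unfolding C_def using FI_hom_id[of "{}"] by blast
  have inf: "infinite (UNIV :: 'a set)" by (rule infinite_UNIV)
  have cle: "|A| \<le>o |UNIV :: 'a set|" if "countable A" for A :: "'c set"
    using that inf by (meson card_of_ordLeq countableE_bij countable_lepoll
        infinite_iff_card_of_countable infinite_countable_subset countable_def infinite_le_lepoll
        lepoll_def lepoll_trans subset_UNIV)
  have "|BB| \<le>o |UNIV :: 'a set|"
    unfolding BB_def
    by (intro card_of_Times_ordLeq_infinite[OF inf] cle cf C ordLeq_refl card_of_Card_order)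
  then have BB: "BB \<lesssim> (UNIV :: 'a set)"
    unfolding lepoll_def card_of_ordLeq .
  have "inj_on (\<lambda>a::'a. ({} :: nat set, a, \<lambda>i\<in>{}. i :: nat)) UNIV" by (auto simp: inj_on_def)
  moreover have "range (\<lambda>a::'a. ({} :: nat set, a, \<lambda>i\<in>{}. i :: nat)) \<subseteq> BB"
    using C0 by (auto simp: BB_def)
  ultimately have "infinite BB"
    using inf by (meson finite_subset finite_imageD)
  then have "carrier (free_Abelian_group BB) \<lesssim> (UNIV :: 'a set)"
    using eqpoll_free_Abelian_group_infinite BB lepoll_trans1 by blast
  then obtain j where j: "inj_on j (carrier (free_Abelian_group BB))"
    and "j ` carrier (free_Abelian_group BB) \<subseteq> (UNIV :: 'a set)"
    by (auto simp: lepoll_def)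
  have "fc_basis W T \<subseteq> BB" if "finite T" for T
    using that by (auto simp: fc_basis_def BB_def C_def)
  then have "carrier (ob (free_cover W) T) \<subseteq> carrier (free_Abelian_group BB)" if "finite T" for T
    using that by (fastforce simp: free_cover_def)
  with j that show ?thesis by blast
qed

lemma fi_free_cover_exists:
  fixes W :: "'a::infinite fi_functor"
  assumes W: "fi_module W"
  obtains P \<epsilon> \<alpha> \<beta> where "fi_module (P :: 'a fi_functor)"
    "\<epsilon> \<in> fi_hom P W" "fi_surj P W \<epsilon>"
    "\<alpha> \<in> fi_hom (free_cover W) P" "\<beta> \<in> fi_hom P (free_cover W)"
    "\<And>T x. \<lbrakk>finite T; x \<in> carrier (ob (free_cover W) T)\<rbrakk> \<Longrightarrow> \<beta> T (\<alpha> T x) = x"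
    "\<And>T x. \<lbrakk>finite T; x \<in> carrier (ob P T)\<rbrakk> \<Longrightarrow> \<alpha> T (\<beta> T x) = x"
proof -
  obtain Z and j :: "((nat set \<times> 'a \<times> (nat \<Rightarrow> nat)) \<Rightarrow>\<^sub>0 int) \<Rightarrow> 'a"
    where Z: "\<And>T. finite T \<Longrightarrow> carrier (ob (free_cover W) T) \<subseteq> Z" "inj_on j Z"
    using free_cover_embeds[of W] by blast
  obtain P :: "'a fi_functor" and \<alpha> \<beta> where P: "fi_module P"
    and \<alpha>: "\<alpha> \<in> fi_hom (free_cover W) P" and \<beta>: "\<beta> \<in> fi_hom P (free_cover W)"
    and \<beta>\<alpha>: "\<And>T x. \<lbrakk>finite T; x \<in> carrier (ob (free_cover W) T)\<rbrakk> \<Longrightarrow> \<beta> T (\<alpha> T x) = x"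
    and \<alpha>\<beta>: "\<And>T x. \<lbrakk>finite T; x \<in> carrier (ob P T)\<rbrakk> \<Longrightarrow> \<alpha> T (\<beta> T x) = x"
    using transport_fi_module[OF fi_module_free_cover[of W] Z] by metis
  obtain e where e: "e \<in> fi_hom (free_cover W) W" "fi_surj (free_cover W) W e"
    using free_cover_counit[OF W] by blast
  let ?\<epsilon> = "\<lambda>T x. e T (\<beta> T x)"
  have "?\<epsilon> T ` carrier (ob P T) = carrier (ob W T)" if T: "finite T" for T
  proof -
    have "\<beta> T x \<in> carrier (ob (free_cover W) T)" if "x \<in> carrier (ob P T)" for x
      using \<beta> T that by (auto simp: fi_hom_def hom_def)
    moreover have "\<alpha> T x \<in> carrier (ob P T)" if "x \<in> carrier (ob (free_cover W) T)" for x
      using \<alpha> T that by (auto simp: fi_hom_def hom_def)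
    ultimately have "\<beta> T ` carrier (ob P T) = carrier (ob (free_cover W) T)"
      using \<beta>\<alpha>[OF T] by (metis (no_types, lifting) imageI image_subsetI subsetI subset_antisym)
    then have "?\<epsilon> T ` carrier (ob P T) = e T ` carrier (ob (free_cover W) T)"
      by (metis image_image)
    then show ?thesis using e(2) T by (simp add: fi_surj_def)
  qed
  then have "fi_surj P W ?\<epsilon>" by (simp add: fi_surj_def)
  from that[OF P fi_hom_comp[OF \<beta> e(1)] this \<alpha> \<beta> \<beta>\<alpha> \<alpha>\<beta>] show ?thesis .
qed

lemma enough_projectives:
  fixes W :: "'a::infinite fi_functor"
  assumes W: "fi_module W"
  obtains P \<epsilon> where "fi_projective (P :: 'a fi_functor)" "\<epsilon> \<in> fi_hom P W" "fi_surj P W \<epsilon>"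
proof -
  obtain P \<epsilon> \<alpha> \<beta> where P: "fi_module (P :: 'a fi_functor)"
    "\<epsilon> \<in> fi_hom P W" "fi_surj P W \<epsilon>"
    and \<alpha>: "\<alpha> \<in> fi_hom (free_cover W) P" and \<beta>: "\<beta> \<in> fi_hom P (free_cover W)"
    and \<alpha>\<beta>: "\<And>T x. \<lbrakk>finite T; x \<in> carrier (ob P T)\<rbrakk> \<Longrightarrow> \<alpha> T (\<beta> T x) = x"
    using fi_free_cover_exists[OF W] by metis
  have "fi_projective P"
    unfolding fi_projective_def
  proof (intro conjI allI impI)
    fix E B :: "'a fi_functor" and \<pi> \<phi>
    assume E: "fi_module E" "fi_module B" "\<pi> \<in> fi_hom E B" "fi_surj E B \<pi>" and \<phi>: "\<phi> \<in> fi_hom P B"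
    obtain \<psi> where \<psi>: "\<psi> \<in> fi_hom (free_cover W) E"
      "\<And>T x. \<lbrakk>finite T; x \<in> carrier (ob (free_cover W) T)\<rbrakk> \<Longrightarrow> \<pi> T (\<psi> T x) = \<phi> T (\<alpha> T x)"
      using free_cover_lift[OF E fi_hom_comp[OF \<alpha> \<phi>]] by metis
    have "\<beta> T x \<in> carrier (ob (free_cover W) T)" if "finite T" "x \<in> carrier (ob P T)" for T x
      using \<beta> that by (auto simp: fi_hom_def hom_def)
    then show "\<exists>\<psi>\<in>fi_hom P E. \<forall>T. finite T \<longrightarrow> (\<forall>x\<in>carrier (ob P T). \<pi> T (\<psi> T x) = \<phi> T x)"
      using fi_hom_comp[OF \<beta> \<psi>(1)] \<psi>(2) \<alpha>\<beta>
      by (intro bexI[of _ "\<lambda>T x. \<psi> T (\<beta> T x)"]) auto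
  qed (rule P)
  with P that show ?thesis by blast
qed

subsection \<open>Iteration\<close>

definition fi_kernel :: "'a fi_functor \<Rightarrow> 'b fi_functor \<Rightarrow> ('a, 'b) fi_nat_trans \<Rightarrow> 'a fi_functor" where
  "fi_kernel V W \<eta> =
     \<lparr>ob = (\<lambda>T. (ob V T)\<lparr>carrier := kernel (ob V T) (ob W T) (\<eta> T)\<rparr>), mp = mp V\<rparr>"

lemma carrier_fi_kernel [simp]:
  "carrier (ob (fi_kernel V W \<eta>) T) = kernel (ob V T) (ob W T) (\<eta> T)"
  by (simp add: fi_kernel_def)

lemma fi_module_kernel:
  assumes V: "fi_module V" and W: "fi_module W" and \<eta>: "\<eta> \<in> fi_hom V W"
  shows "fi_module (fi_kernel V W \<eta>)"
proof -
  interpret V: fi_module V by (rule V)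
  interpret W: fi_module W by (rule W)
  have gh: "group_hom (ob V T) (ob W T) (\<eta> T)" if "finite T" for T
    using V.ob_comm_group[OF that] W.ob_comm_group[OF that] \<eta> that
    by (auto simp: group_hom_def group_hom_axioms_def comm_group_def fi_hom_def)
  have cl: "mp V S T f x \<in> kernel (ob V T) (ob W T) (\<eta> T)"
    if a: "finite S" "finite T" "f \<in> FI_hom S T" "x \<in> kernel (ob V S) (ob W S) (\<eta> S)" for S T f x
  proof -
    have x: "x \<in> carrier (ob V S)" "\<eta> S x = \<one>\<^bsub>ob W S\<^esub>" using a(4) by (auto simp: kernel_def)
    have "\<eta> T (mp V S T f x) = mp W S T f (\<eta> S x)"
      using \<eta> a x by (auto simp: fi_hom_def)
    also have "\<dots> = \<one>\<^bsub>ob W T\<^esub>"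
      using x hom_one[OF W.mp_hom[OF a(1-3)]] W.ob_comm_group a(1,2)
      by (simp add: comm_group_def)
    finally show ?thesis
      using V.mp_hom[OF a(1-3)] x by (auto simp: kernel_def hom_def)
  qed
  show ?thesis
  proof (rule fi_module.intro)
    fix T :: "nat set" assume T: "finite T"
    interpret G: comm_group "ob V T" by (rule V.ob_comm_group[OF T])
    have "group (ob (fi_kernel V W \<eta>) T)"
      using G.subgroup_imp_group[OF group_hom.subgroup_kernel[OF gh[OF T]]]
      by (simp add: fi_kernel_def)
    then show "comm_group (ob (fi_kernel V W \<eta>) T)"
      by (rule group.group_comm_groupI) (auto simp: fi_kernel_def kernel_def G.m_comm)
  next
    fix S T f assume a: "finite S" "finite T" "f \<in> FI_hom S T"
    show "mp (fi_kernel V W \<eta>) S T f \<in> hom (ob (fi_kernel V W \<eta>) S) (ob (fi_kernel V W \<eta>) T)"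
      using V.mp_hom[OF a] cl[OF a] by (auto simp: fi_kernel_def hom_def kernel_def)
  next
    fix T x assume "finite T" "x \<in> carrier (ob (fi_kernel V W \<eta>) T)"
    then show "mp (fi_kernel V W \<eta>) T T (\<lambda>i\<in>T. i) x = x"
      using V.mp_id by (auto simp: fi_kernel_def kernel_def)
  next
    fix S T U f g x
    assume "finite S" "finite T" "finite U" "f \<in> FI_hom S T" "g \<in> FI_hom T U"
      "x \<in> carrier (ob (fi_kernel V W \<eta>) S)"
    then show "mp (fi_kernel V W \<eta>) S U (compose S g f) x
        = mp (fi_kernel V W \<eta>) T U g (mp (fi_kernel V W \<eta>) S T f x)"
      using V.mp_compose by (auto simp: fi_kernel_def kernel_def)
  qed
qed

lemma fi_kernel_incl: "\<theta> \<in> fi_hom U (fi_kernel V W \<eta>) \<Longrightarrow> \<theta> \<in> fi_hom U V"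
  by (auto simp: fi_hom_def fi_kernel_def hom_def kernel_def Pi_def)

theorem projective_resolution_exists:
  fixes W :: "'a::infinite fi_functor"
  assumes W: "fi_module W"
  shows "\<exists>P \<delta> \<epsilon>. projective_resolution W P \<delta> \<epsilon>"
proof -
  have "\<exists>(P :: 'a fi_functor) \<epsilon>. fi_projective P \<and> \<epsilon> \<in> fi_hom P V \<and> fi_surj P V \<epsilon>"
    if "fi_module V" for V :: "'a fi_functor"
    using enough_projectives[OF that] by blast
  then obtain p :: "'a fi_functor \<Rightarrow> 'a fi_functor"
    and e :: "'a fi_functor \<Rightarrow> ('a, 'a) fi_nat_trans" where pe: "\<And>V :: 'a fi_functor. fi_module V \<Longrightarrow>
      fi_projective (p V) \<and> e V \<in> fi_hom (p V) V \<and> fi_surj (p V) V (e V)"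
    by metis
  define K where "K = rec_nat W (\<lambda>_ V. fi_kernel (p V) V (e V))"
  have K0: "K 0 = W" and KS: "K (Suc n) = fi_kernel (p (K n)) (K n) (e (K n))" for n
    by (simp_all add: K_def)
  have KM: "fi_module (K n)" for n
  proof (induction n)
    case 0
    show ?case using W by (simp add: K0)
  next
    case (Suc n)
    have "fi_module (p (K n))" "e (K n) \<in> fi_hom (p (K n)) (K n)"
      using pe[OF Suc] by (auto simp: fi_projective_def)
    then show ?case using fi_module_kernel Suc by (simp add: KS)
  qed
  have proj: "fi_projective (p (K n))" and ehom: "e (K n) \<in> fi_hom (p (K n)) (K n)"
    and surj: "fi_surj (p (K n)) (K n) (e (K n))" for n
    using pe[OF KM[of n]] by auto
  have ker: "kernel (ob (p (K (Suc n))) T) (ob (p (K n)) T) (e (K (Suc n)) T)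
      = kernel (ob (p (K (Suc n))) T) (ob (K (Suc n)) T) (e (K (Suc n)) T)" for n T
    by (simp add: KS fi_kernel_def kernel_def)
  have im: "e (K (Suc n)) T ` carrier (ob (p (K (Suc n))) T)
      = kernel (ob (p (K n)) T) (ob (K n) T) (e (K n) T)" if "finite T" for n T
    using surj[of "Suc n"] that by (simp add: fi_surj_def KS)
  have "projective_resolution W (\<lambda>n. p (K n)) (\<lambda>n. e (K (Suc n))) (e (K 0))"
    unfolding projective_resolution_def
  proof (intro conjI allI impI)
    show "fi_projective (p (K n))" for n by (rule proj)
    show "e (K (Suc n)) \<in> fi_hom (p (K (Suc n))) (p (K n))" for n
      using ehom[of "Suc n"] fi_kernel_incl by (metis KS)
    show "e (K 0) \<in> fi_hom (p (K 0)) W" using ehom[of 0] by (simp add: K0)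
    show "fi_surj (p (K 0)) W (e (K 0))" using surj[of 0] by (simp add: K0)
    show "e (K (Suc 0)) T ` carrier (ob (p (K 1)) T)
        = kernel (ob (p (K 0)) T) (ob W T) (e (K 0) T)" if "finite T" for T
      using im[OF that, of 0] by (simp add: K0)
    show "e (K (Suc (Suc n))) T ` carrier (ob (p (K (Suc (Suc n)))) T)
        = kernel (ob (p (K (Suc n))) T) (ob (p (K n)) T) (e (K (Suc n)) T)" if "finite T" for n T
      using im[OF that, of "Suc n"] ker by simp
  qed
  then show ?thesis by blast
qed

end

theory Submission
  imports Defs
begin

text \<open>
  Write \<open>V(T) = F(T)/R(T)\<close> with monotone families of subgroups \<open>R(T) \<subseteq> F(T)\<close> of one abelian group,
  the structure maps of inclusions being induced by the identity; the free cover of an FI-module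
  yields such a presentation. FI-homology is computed at \<open>T\<close> by the Koszul complex
  \<open>\<Oplus>\<^bsub>U \<subseteq> T, |U| = p\<^esub> V(T - U)\<close>, which is exact in \<open>V\<close> and is acyclic in positive degrees for
  projective \<open>V\<close>.

  Adding a point gives a map from \<open>V\<close> to its shift \<open>SV\<close> with kernel \<open>K\<close> and cokernel \<open>D\<close>, and
  splitting the Koszul complex at the new point gives an exact sequence
  \<open>H\<^bsub>p-1\<^esub>(K) \<rightarrow> S H\<^bsub>p\<^esub>(V) \<rightarrow> H\<^bsub>p\<^esub>(D) \<rightarrow> H\<^bsub>p-2\<^esub>(K) \<rightarrow> S H\<^bsub>p-1\<^esub>(V)\<close>.
  Thus \<open>D\<close> satisfies the hypotheses with \<open>k - 1\<close> and \<open>d - 1\<close>, and by induction on \<open>k\<close> the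
  degree of \<open>H\<^sub>2(D)\<close> is at most \<open>k + d - 1\<close>. Hence so is that of \<open>H\<^sub>0(K)\<close>, which equals \<open>K\<close>
  because noninvertible injections act by zero on \<open>K\<close>. The homology of \<open>K\<close> in degree \<open>p\<close> is then bounded
  by \<open>p + k + d - 1\<close>, and the exact sequence gives the bound for \<open>V\<close>.
\<close>

section \<open>Koszul complexes of families of subgroups\<close>

text \<open>With all values inside one group \<open>'g\<close>, inclusions act as the identity, so
  shift, kernel and cokernel are again families of subgroups of the same type, and the induction
  never has to form quotients of quotients. The price is that such a family forgets the action of
  permutations. Only the renaming of a single point is kept, as the maps \<open>\<pi>\<close> of
  \<open>sym_fam\<close>; it is what shows that an element killed by one added point is killed by
  every other.

  The derived functors are not identified with Koszul homology in all degrees. Because projectives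
  are Koszul acyclic, Koszul homology of W in degree \<open>Suc m\<close> shifts to degree 1 of the
  m-th syzygy. There its vanishing amounts to injectivity of H_0 of the next syzygy into H_0 of the
  projective, and this is also what the derived functor in degree \<open>Suc m\<close> measures.
  Both directions of the degree 1 comparison occur: one turns the hypothesis on H_1(W) into Koszul
  vanishing, the other yields the conclusion.\<close>

definition is_subgrp :: "'g::ab_group_add set \<Rightarrow> bool" where
  "is_subgrp A \<longleftrightarrow> 0 \<in> A \<and> (\<forall>x\<in>A. \<forall>y\<in>A. x - y \<in> A)"

text \<open>The sign of \<open>u\<close> in the simplex \<open>insert u U\<close>, counting the
  vertices below \<open>u\<close>. It is a conditional negation because \<open>'g\<close> carries no
  multiplication.\<close>

definition osgn :: "nat \<Rightarrow> nat set \<Rightarrow> 'g::ab_group_add \<Rightarrow> 'g" where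
  "osgn u U x = (if odd (card {v \<in> U. v < u}) then - x else x)"

text \<open>The structure map from \<open>F (T - insert u U)\<close> to \<open>F (T - U)\<close> is
  an inclusion, so it leaves no trace in the formula; only the signs remain.\<close>

definition bd :: "nat set \<Rightarrow> (nat set \<Rightarrow> 'g::ab_group_add) \<Rightarrow> nat set \<Rightarrow> 'g" where
  "bd T c U = (\<Sum>u\<in>T - U. osgn u U (c (insert u U)))"

definition chain :: "(nat set \<Rightarrow> 'g set) \<Rightarrow> nat \<Rightarrow> nat set \<Rightarrow> (nat set \<Rightarrow> 'g) \<Rightarrow> bool" where
  "chain F p T c \<longleftrightarrow> (\<forall>U. U \<subseteq> T \<longrightarrow> card U = p \<longrightarrow> c U \<in> F (T - U))"

text \<open>The Koszul complex of \<open>T \<mapsto> F T / R T\<close> at \<open>T\<close>, on representatives: a \<open>p\<close>-chain has a component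
  \<open>c U \<in> F (T - U)\<close> for every \<open>p\<close>-element subset \<open>U\<close> of \<open>T\<close>, and is zero if it is a chain of \<open>R\<close>.
  Values of \<open>c\<close> at other sets are junk. \<open>koszul_van F R p T\<close> says that the \<open>p\<close>-th homology vanishes.\<close>

definition koszul_van :: "(nat set \<Rightarrow> 'g::ab_group_add set) \<Rightarrow> (nat set \<Rightarrow> 'g set) \<Rightarrow> nat \<Rightarrow> nat set \<Rightarrow> bool"
  where "koszul_van F R p T \<longleftrightarrow>
    (\<forall>c. chain F p T c \<longrightarrow> (\<forall>q. p = Suc q \<longrightarrow> chain R q T (bd T c)) \<longrightarrow>
       (\<exists>e. chain F (Suc p) T e \<and> chain R p T (\<lambda>U. c U - bd T e U)))"

section \<open>Subgroups and the sign calculus of the boundary\<close>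

lemma is_subgrpD:
  assumes "is_subgrp A"
  shows is_subgrp_zero: "0 \<in> A"
    and is_subgrp_diff: "x \<in> A \<Longrightarrow> y \<in> A \<Longrightarrow> x - y \<in> A"
    and is_subgrp_minus: "x \<in> A \<Longrightarrow> - x \<in> A"
    and is_subgrp_add: "x \<in> A \<Longrightarrow> y \<in> A \<Longrightarrow> x + y \<in> A"
proof -
  show 0: "0 \<in> A" and d: "x \<in> A \<Longrightarrow> y \<in> A \<Longrightarrow> x - y \<in> A" for x y
    using assms by (auto simp: is_subgrp_def)
  show m: "- x \<in> A" if "x \<in> A" for x using d[OF 0 that] by simp
  show "x + y \<in> A" if "x \<in> A" "y \<in> A" using d[OF that(1) m[OF that(2)]] by simp
qed

lemma is_subgrp_sum: "is_subgrp A \<Longrightarrow> (\<And>i. i \<in> I \<Longrightarrow> f i \<in> A) \<Longrightarrow> sum f I \<in> A"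
  by (induction I rule: infinite_finite_induct) (auto intro: is_subgrp_zero is_subgrp_add)

lemma is_subgrp_osgn: "is_subgrp A \<Longrightarrow> x \<in> A \<Longrightarrow> osgn u U x \<in> A"
  by (auto simp: osgn_def is_subgrp_minus)

lemma osgn_osgn [simp]: "osgn u U (osgn u U x) = x"
  by (simp add: osgn_def)

lemma osgn_commute: "osgn u U (osgn t V x) = osgn t V (osgn u U x)"
  by (simp add: osgn_def)

lemma osgn_minus: "osgn u U (- x) = - osgn u U x"
  by (simp add: osgn_def)

lemma osgn_add: "osgn u U (x + y) = osgn u U x + osgn u U y"
  by (simp add: osgn_def)

lemma osgn_diff: "osgn u U (x - y) = osgn u U x - osgn u U y"
  by (simp add: osgn_def)

lemma osgn_zero [simp]: "osgn u U 0 = 0"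
  by (simp add: osgn_def)

lemma osgn_empty [simp]: "osgn u {} x = x"
  by (simp add: osgn_def)

lemma osgn_sum: "osgn u U (sum f I) = (\<Sum>i\<in>I. osgn u U (f i))"
  by (simp add: osgn_def sum_negf)

lemma osgn_insert:
  assumes "finite U" "t \<notin> U"
  shows "osgn u (insert t U) x = (if t < u then - osgn u U x else osgn u U x)"
proof -
  have "{v \<in> insert t U. v < u} = (if t < u then insert t {v \<in> U. v < u} else {v \<in> U. v < u})"
    by auto
  then show ?thesis using assms by (simp add: osgn_def)
qed

text \<open>Exactly one of two distinct points precedes the other, so exactly one of the two sides
  picks up an extra sign from the enlarged set. This is the cancellation behind
  \<open>bd_bd\<close>.\<close>

lemma osgn_swap:
  assumes "finite U" "u \<noteq> t" "u \<notin> U" "t \<notin> U"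
  shows "osgn u U (osgn t (insert u U) x) = - osgn t U (osgn u (insert t U) x)"
  using assms by (auto simp: osgn_insert osgn_minus osgn_commute)

lemma bd_add: "bd T (\<lambda>U. c U + d U) U = bd T c U + bd T d U"
  by (simp add: bd_def osgn_add sum.distrib)

lemma bd_diff: "bd T (\<lambda>U. c U - d U) U = bd T c U - bd T d U"
  by (simp add: bd_def osgn_diff sum_subtractf)

lemma bd_zero [simp]: "bd T (\<lambda>U. 0) U = 0"
  by (simp add: bd_def)

lemma bd_cong:
  assumes "finite T" "U \<subseteq> T" "\<And>V. V \<subseteq> T \<Longrightarrow> card V = Suc (card U) \<Longrightarrow> c V = d V"
  shows "bd T c U = bd T d U"
  unfolding bd_def
proof (rule sum.cong)
  fix u assume "u \<in> T - U"
  then show "osgn u U (c (insert u U)) = osgn u U (d (insert u U))"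
    using assms finite_subset[of U T] by auto
qed simp

lemma bd_bd:
  assumes "finite T" "U \<subseteq> T"
  shows "bd T (bd T c) U = 0"
proof -
  have fU: "finite U" and fI: "finite (T - U)" using assms by (auto intro: finite_subset)
  define s where "s = (\<lambda>u t. osgn u U (osgn t (insert u U) (c (insert t (insert u U)))))"
  define L where "L = {(u, t). u \<in> T - U \<and> t \<in> T - U \<and> u < t}"
  define G where "G = {(u, t). u \<in> T - U \<and> t \<in> T - U \<and> t < u}"
  have fLG: "finite L" "finite G"
    by (rule finite_subset[of _ "(T - U) \<times> (T - U)"]; use fI in \<open>auto simp: L_def G_def\<close>)+
  have anti: "s t u = - s u t" if "(u, t) \<in> L" for u t
    using osgn_swap[OF fU, of t u] that by (auto simp: s_def L_def insert_commute)
  have "bd T (bd T c) U = (\<Sum>u\<in>T - U. \<Sum>t\<in>T - insert u U. s u t)"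
    by (simp add: bd_def s_def osgn_sum)
  also have "\<dots> = (\<Sum>(u, t)\<in>(SIGMA u:T - U. T - insert u U). s u t)"
    by (rule sum.Sigma) (use assms in auto)
  also have "(SIGMA u:T - U. T - insert u U) = L \<union> G"
    by (auto simp: L_def G_def)
  also have "(\<Sum>(u, t)\<in>L \<union> G. s u t) = (\<Sum>(u, t)\<in>L. s u t) + (\<Sum>(u, t)\<in>G. s u t)"
    by (rule sum.union_disjoint[OF fLG]) (auto simp: L_def G_def)
  also have "(\<Sum>(u, t)\<in>G. s u t) = (\<Sum>(u, t)\<in>L. s t u)"
    by (rule sum.reindex_bij_witness[of _ "\<lambda>(u, t). (t, u)" "\<lambda>(u, t). (t, u)"])
      (auto simp: L_def G_def)
  also have "\<dots> = - (\<Sum>(u, t)\<in>L. s u t)"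
    by (simp add: sum_negf[symmetric] case_prod_unfold anti cong: sum.cong)
  finally show ?thesis by simp
qed

text \<open>A chain on \<open>insert m T\<close> is a pair of an m-free part and a part at
  \<open>m\<close>, and the boundary is that of a mapping cone. Since \<open>m\<close> exceeds every
  point of \<open>T\<close>, it never counts towards the sign of another point, and its own sign is
  the parity of \<open>card U\<close>.\<close>

lemma bd_insert:
  assumes T: "T \<subseteq> {..<m}" and U: "U \<subseteq> T"
  shows "bd (insert m T) c U = bd T c U + osgn m U (c (insert m U) :: 'a::ab_group_add)"
    and "bd (insert m T) c (insert m U) = bd T (\<lambda>V. c (insert m V)) U"
proof -
  have fin: "finite T" "finite U" and m: "m \<notin> T" "m \<notin> U"
    using T U by (auto intro: finite_subset)
  have "insert m T - U = insert m (T - U)" using m by auto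
  then show "bd (insert m T) c U = bd T c U + osgn m U (c (insert m U))"
    using fin m by (simp add: bd_def add.commute)
  have "insert m T - insert m U = T - U" using m by auto
  moreover have "osgn u (insert m U) x = osgn u U x" if "u \<in> T" for u and x :: 'a
  proof -
    have "\<not> m < u" using that T by auto
    then show ?thesis by (simp add: osgn_insert[OF fin(2) m(2)])
  qed
  ultimately show "bd (insert m T) c (insert m U) = bd T (\<lambda>V. c (insert m V)) U"
    unfolding bd_def insert_commute[of _ m] by simp
qed

text \<open>On sets below \<open>m\<close> the sign \<open>osgn m\<close> is the parity of the
  cardinality, which \<open>bd\<close> lowers by one; hence it anticommutes with
  \<open>bd\<close>.\<close>

lemma bd_osgn:
  assumes T: "T \<subseteq> {..<m}" and U: "U \<subseteq> T"
  shows "bd T (\<lambda>V. osgn m V (f V :: 'a::ab_group_add)) U = - osgn m U (bd T f U)"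
proof -
  have fin: "finite T" "finite U" using T U by (auto intro: finite_subset)
  have "osgn u U (osgn m (insert u U) x) = - osgn m U (osgn u U x)" if "u \<in> T - U" for u and x :: 'a
  proof -
    have "u < m" "u \<notin> U" using that T by auto
    then have "osgn m (insert u U) x = - osgn m U x" by (simp add: osgn_insert[OF fin(2)])
    then show ?thesis by (simp add: osgn_minus osgn_commute[of u])
  qed
  then have "bd T (\<lambda>V. osgn m V (f V)) U = (\<Sum>u\<in>T - U. - osgn m U (osgn u U (f (insert u U))))"
    unfolding bd_def by (intro sum.cong) auto
  then show ?thesis by (simp add: bd_def osgn_sum sum_negf)
qed

lemma chainD: "chain F p T c \<Longrightarrow> U \<subseteq> T \<Longrightarrow> card U = p \<Longrightarrow> c U \<in> F (T - U)"
  by (simp add: chain_def)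

lemma chain_mono:
  "chain F p T c \<Longrightarrow> (\<And>U. U \<subseteq> T \<Longrightarrow> F U \<subseteq> R U) \<Longrightarrow> chain R p T c"
  by (simp add: chain_def subset_iff)

text \<open>Bounding the index sets lets \<open>N\<close> drop to \<open>m\<close> when
  \<open>m\<close> is split off, which keeps \<open>m\<close> above all remaining points, as the
  signs in \<open>bd_insert\<close> require.\<close>

locale filt =
  fixes N :: nat and F :: "nat set \<Rightarrow> 'g::ab_group_add set"
  assumes sub: "T \<subseteq> {..<N} \<Longrightarrow> is_subgrp (F T)"
    and mono: "S \<subseteq> T \<Longrightarrow> T \<subseteq> {..<N} \<Longrightarrow> F S \<subseteq> F T"
begin

lemma chain_bd:
  assumes T: "T \<subseteq> {..<N}" and e: "chain F (Suc p) T e"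
  shows "chain F p T (bd T e)"
  unfolding chain_def bd_def
proof (intro allI impI)
  fix U assume U: "U \<subseteq> T" "card U = p"
  have fU: "finite U" using U T by (meson finite_lessThan finite_subset)
  show "(\<Sum>u\<in>T - U. osgn u U (e (insert u U))) \<in> F (T - U)"
  proof (rule is_subgrp_sum)
    show "is_subgrp (F (T - U))" by (rule sub) (use T in auto)
    fix u assume u: "u \<in> T - U"
    have "e (insert u U) \<in> F (T - insert u U)"
      using e u U fU by (auto simp: chain_def)
    also have "\<dots> \<subseteq> F (T - U)" by (rule mono) (use T in auto)
    finally show "osgn u U (e (insert u U)) \<in> F (T - U)"
      by (rule is_subgrp_osgn[OF sub, rotated]) (use T in auto)
  qed
qed

lemma chain_add:
  "T \<subseteq> {..<N} \<Longrightarrow> chain F p T c \<Longrightarrow> chain F p T d \<Longrightarrow> chain F p T (\<lambda>U. c U + d U)"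
  using is_subgrp_add[OF sub] by (simp add: chain_def subset_iff)

lemma chain_diff:
  "T \<subseteq> {..<N} \<Longrightarrow> chain F p T c \<Longrightarrow> chain F p T d \<Longrightarrow> chain F p T (\<lambda>U. c U - d U)"
  using is_subgrp_diff[OF sub] by (simp add: chain_def subset_iff)

end

text \<open>Sets avoiding \<open>m\<close> see the family shifted by \<open>m\<close>; sets
  containing \<open>m\<close> lose it in the complement and so see \<open>F\<close> itself, one
  degree lower. In degree 0 there is no second component.\<close>

lemma chain_insert:
  assumes T: "T \<subseteq> {..<m}"
  shows "chain F p (insert m T) c \<longleftrightarrow>
    chain (\<lambda>S. F (insert m S)) p T c \<and> (\<forall>q. p = Suc q \<longrightarrow> chain F q T (\<lambda>U. c (insert m U)))"
proof -
  have m: "m \<notin> T" and fT: "finite T" using T by (auto intro: finite_subset)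
  have fU: "finite U" if "U \<subseteq> T" for U using fT that by (rule rev_finite_subset)
  show ?thesis
  proof (intro iffI conjI allI impI)
    assume c: "chain F p (insert m T) c"
    show "chain (\<lambda>S. F (insert m S)) p T c"
      unfolding chain_def
    proof (intro allI impI)
      fix U assume U: "U \<subseteq> T" "card U = p"
      moreover have "insert m T - U = insert m (T - U)" using U m by auto
      ultimately show "c U \<in> F (insert m (T - U))"
        using chainD[OF c, of U] by auto
    qed
    show "chain F q T (\<lambda>U. c (insert m U))" if "p = Suc q" for q
      unfolding chain_def
    proof (intro allI impI)
      fix U assume U: "U \<subseteq> T" "card U = q"
      moreover have "insert m T - insert m U = T - U" using U m by auto
      moreover have "card (insert m U) = p" using U m fU that by (simp add: subset_iff) (metis card_insert_disjoint subset_iff)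
      ultimately show "c (insert m U) \<in> F (T - U)"
        using chainD[OF c, of "insert m U"] by auto
    qed
  next
    assume a: "chain (\<lambda>S. F (insert m S)) p T c \<and>
      (\<forall>q. p = Suc q \<longrightarrow> chain F q T (\<lambda>U. c (insert m U)))"
    show "chain F p (insert m T) c"
      unfolding chain_def
    proof (intro allI impI)
      fix V assume V: "V \<subseteq> insert m T" "card V = p"
      show "c V \<in> F (insert m T - V)"
      proof (cases "m \<in> V")
        case False
        then have "V \<subseteq> T" "insert m T - V = insert m (T - V)" using V by auto
        then show ?thesis using a V by (auto simp: chain_def)
      next
        case True
        define U where "U = V - {m}"
        have U: "U \<subseteq> T" "V = insert m U" "m \<notin> U" "insert m T - V = T - U"
          using True V m by (auto simp: U_def)
        have "p = Suc (card U)" using V U fU by auto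
        then show ?thesis using a U by (auto simp: chain_def)
      qed
    qed
  qed
qed

lemma chain_insertD:
  assumes "T \<subseteq> {..<m}" "chain F p (insert m T) c" "U \<subseteq> T"
  shows "card U = p \<Longrightarrow> c U \<in> F (insert m (T - U))"
    and "p = Suc (card U) \<Longrightarrow> c (insert m U) \<in> F (T - U)"
  using assms(2,3) unfolding chain_insert[OF assms(1)] by (blast dest: chainD)+

locale fam = F: filt N F + R: filt N R
  for N and F R :: "nat set \<Rightarrow> 'g::ab_group_add set" +
  assumes le: "T \<subseteq> {..<N} \<Longrightarrow> R T \<subseteq> F T"

text \<open>The cokernel \<open>D = Dtop / Dbot\<close> and the kernel \<open>K = Ktop / R\<close> of the map from \<open>F / R\<close> to its shift
  by the point \<open>m\<close>. They are families on \<open>{..<m}\<close>; as \<open>m\<close> exceeds all elements, splitting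
  the Koszul complex at \<open>m\<close> leaves the signs of the other points unchanged.\<close>

definition Dtop :: "nat \<Rightarrow> (nat set \<Rightarrow> 'g set) \<Rightarrow> nat set \<Rightarrow> 'g set" where
  "Dtop m F = (\<lambda>T. F (insert m T))"

definition Dbot :: "nat \<Rightarrow> (nat set \<Rightarrow> 'g::ab_group_add set) \<Rightarrow> (nat set \<Rightarrow> 'g set) \<Rightarrow> nat set \<Rightarrow> 'g set" where
  "Dbot m F R T = {x + y |x y. x \<in> R (insert m T) \<and> y \<in> F T}"

definition Ktop :: "nat \<Rightarrow> (nat set \<Rightarrow> 'g set) \<Rightarrow> (nat set \<Rightarrow> 'g set) \<Rightarrow> nat set \<Rightarrow> 'g set" where
  "Ktop m F R T = F T \<inter> R (insert m T)"

section \<open>The Koszul homology sequence of kernel, shift and cokernel\<close>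

context fam
begin

lemma insert_le: "m < N \<Longrightarrow> T \<subseteq> {..<m} \<Longrightarrow> insert m T \<subseteq> {..<N}"
  by auto

lemma filt_Dtop: assumes "m < N" shows "filt m (Dtop m F)"
proof
  show "is_subgrp (Dtop m F T)" if "T \<subseteq> {..<m}" for T
    unfolding Dtop_def by (rule F.sub[OF insert_le[OF assms that]])
  show "Dtop m F S \<subseteq> Dtop m F T" if "S \<subseteq> T" "T \<subseteq> {..<m}" for S T
    unfolding Dtop_def by (rule F.mono[OF insert_mono[OF that(1)] insert_le[OF assms that(2)]])
qed

lemma filt_Rtop: assumes "m < N" shows "filt m (Dtop m R)"
proof
  show "is_subgrp (Dtop m R T)" if "T \<subseteq> {..<m}" for T
    unfolding Dtop_def by (rule R.sub[OF insert_le[OF assms that]])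
  show "Dtop m R S \<subseteq> Dtop m R T" if "S \<subseteq> T" "T \<subseteq> {..<m}" for S T
    unfolding Dtop_def by (rule R.mono[OF insert_mono[OF that(1)] insert_le[OF assms that(2)]])
qed

lemma fam_D: assumes m: "m < N" shows "fam m (Dtop m F) (Dbot m F R)"
proof (intro fam.intro filt_Dtop[OF m] fam_axioms.intro)
  have le_N: "T \<subseteq> {..<N}" if "T \<subseteq> {..<m}" for T using that m by auto
  show "filt m (Dbot m F R)"
  proof
    fix T assume T: "T \<subseteq> {..<m}"
    note R = R.sub[OF insert_le[OF m T]] and F = F.sub[OF le_N[OF T]]
    show "is_subgrp (Dbot m F R T)"
      unfolding is_subgrp_def
    proof (intro conjI ballI)
      show "0 \<in> Dbot m F R T"
        using is_subgrp_zero[OF R] is_subgrp_zero[OF F] by (force simp: Dbot_def)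
      fix x y assume "x \<in> Dbot m F R T" "y \<in> Dbot m F R T"
      then obtain a b a' b' where "x = a + b" "y = a' + b'" "a \<in> R (insert m T)"
        "a' \<in> R (insert m T)" "b \<in> F T" "b' \<in> F T" by (auto simp: Dbot_def)
      then have "x - y = (a - a') + (b - b')" "a - a' \<in> R (insert m T)" "b - b' \<in> F T"
        using is_subgrp_diff[OF R] is_subgrp_diff[OF F] by auto
      then show "x - y \<in> Dbot m F R T" by (auto simp: Dbot_def)
    qed
  next
    fix S T assume ST: "S \<subseteq> T" "T \<subseteq> {..<m}"
    show "Dbot m F R S \<subseteq> Dbot m F R T"
      using R.mono[OF insert_mono[OF ST(1)] insert_le[OF m ST(2)]] F.mono[OF ST(1) le_N[OF ST(2)]]
      by (fastforce simp: Dbot_def)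
  qed
  fix T assume T: "T \<subseteq> {..<m}"
  show "Dbot m F R T \<subseteq> Dtop m F T"
    using le[OF insert_le[OF m T]] F.mono[OF subset_insertI insert_le[OF m T]]
      is_subgrp_add[OF F.sub[OF insert_le[OF m T]]]
    by (fastforce simp: Dbot_def Dtop_def)
qed

lemma fam_K: assumes m: "m < N" shows "fam m (Ktop m F R) R"
proof (intro fam.intro fam_axioms.intro)
  have le_N: "T \<subseteq> {..<N}" if "T \<subseteq> {..<m}" for T using that m by auto
  show "filt m R" by (rule filt.intro) (use R.sub R.mono le_N in auto)
  show "filt m (Ktop m F R)"
  proof
    fix T assume T: "T \<subseteq> {..<m}"
    note R = R.sub[OF insert_le[OF m T]] and F = F.sub[OF le_N[OF T]]
    show "is_subgrp (Ktop m F R T)" using R F by (auto simp: is_subgrp_def Ktop_def)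
  next
    fix S T assume ST: "S \<subseteq> T" "T \<subseteq> {..<m}"
    show "Ktop m F R S \<subseteq> Ktop m F R T"
      using R.mono[OF insert_mono[OF ST(1)] insert_le[OF m ST(2)]] F.mono[OF ST(1) le_N[OF ST(2)]]
      by (auto simp: Ktop_def)
  qed
  show "R T \<subseteq> Ktop m F R T" if "T \<subseteq> {..<m}" for T
    using le[OF le_N[OF that]] R.mono[OF subset_insertI insert_le[OF m that]] by (auto simp: Ktop_def)
qed

text \<open>The term following H_p(D) is H_{p-2}(K), which is zero for p at most 1, so H_p(D) is a
  quotient of the shift of H_p(V). Concretely, a cycle \<open>a\<close> of \<open>D\<close> is
  completed by a part \<open>b\<close> at \<open>m\<close> to a cycle on
  \<open>insert m T\<close>.\<close>

lemma koszul_van_D_low: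
  assumes m: "m < N" and T: "T \<subseteq> {..<m}" and p: "p \<le> 1" and V: "koszul_van F R p (insert m T)"
  shows "koszul_van (Dtop m F) (Dbot m F R) p T"
  unfolding koszul_van_def
proof (intro allI impI)
  fix a assume a: "chain (Dtop m F) p T a"
    and cyc: "\<forall>q. p = Suc q \<longrightarrow> chain (Dbot m F R) q T (bd T a)"
  have fT: "finite T" and mT: "m \<notin> T" using T by (auto intro: finite_subset)
  have TN: "T \<subseteq> {..<N}" using T m by auto
  \<comment> \<open>The boundary of \<open>a\<close> lies in \<open>Dbot\<close>; its component in
    \<open>F\<close> is to be cancelled by the part at \<open>m\<close>.\<close>
  have "\<forall>U. \<exists>f. U \<subseteq> T \<and> Suc (card U) = p \<longrightarrow>
      f \<in> F (T - U) \<and> bd T a U + osgn m U f \<in> R (insert m (T - U))"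
  proof
    fix U
    show "\<exists>f. U \<subseteq> T \<and> Suc (card U) = p \<longrightarrow>
      f \<in> F (T - U) \<and> bd T a U + osgn m U f \<in> R (insert m (T - U))"
    proof (cases "U \<subseteq> T \<and> Suc (card U) = p")
      case True
      then have "bd T a U \<in> Dbot m F R (T - U)" using cyc by (auto simp: chain_def)
      then obtain x y where xy: "bd T a U = x + y" "x \<in> R (insert m (T - U))" "y \<in> F (T - U)"
        by (auto simp: Dbot_def)
      have sg: "is_subgrp (F (T - U))" by (rule F.sub) (use TN in auto)
      show ?thesis
        by (rule exI[of _ "osgn m U (- y)"])
          (use xy sg in \<open>simp add: is_subgrp_osgn is_subgrp_minus\<close>)
    qed auto
  qed
  then obtain b where b: "\<And>U. U \<subseteq> T \<Longrightarrow> Suc (card U) = p \<Longrightarrow>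
      b U \<in> F (T - U) \<and> bd T a U + osgn m U (b U) \<in> R (insert m (T - U))" by metis
  define c where "c = (\<lambda>V. if m \<in> V then b (V - {m}) else a V)"
  have c1: "c U = a U" if "U \<subseteq> T" for U using that mT by (auto simp: c_def)
  have c2: "c (insert m U) = b U" if "U \<subseteq> T" for U
  proof -
    have "insert m U - {m} = U" using that mT by auto
    then show ?thesis by (simp add: c_def)
  qed
  have "chain F p (insert m T) c"
    unfolding chain_insert[OF T] using a b c1 c2 by (auto simp: chain_def Dtop_def)
  moreover have "chain R q (insert m T) (bd (insert m T) c)" if q: "p = Suc q" for q
    unfolding chain_insert[OF T]
  proof (intro conjI allI impI)
    show "chain (\<lambda>S. R (insert m S)) q T (bd (insert m T) c)"
      unfolding chain_def
    proof (intro allI impI)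
      fix U assume U: "U \<subseteq> T" "card U = q"
      have "bd T c U = bd T a U" by (rule bd_cong[OF fT U(1)]) (rule c1)
      then show "bd (insert m T) c U \<in> R (insert m (T - U))"
        using b[OF U(1)] U q by (simp add: bd_insert(1)[OF T U(1)] c2)
    qed
    \<comment> \<open>The part \<open>b\<close> has degree at most 0, so no condition on its
      boundary arises; this is where \<open>p \<le> 1\<close> enters.\<close>
    show "chain R r T (\<lambda>U. bd (insert m T) c (insert m U))" if "q = Suc r" for r
      using p q that by simp
  qed
  ultimately obtain e where e: "chain F (Suc p) (insert m T) e"
    "chain R p (insert m T) (\<lambda>U. c U - bd (insert m T) e U)"
    using V by (auto simp: koszul_van_def)
  have e1: "chain (Dtop m F) (Suc p) T e" and e2: "chain F p T (\<lambda>U. e (insert m U))"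
    using e(1) by (auto simp: chain_insert[OF T] Dtop_def)
  have "chain (Dbot m F R) p T (\<lambda>U. a U - bd T e U)"
    unfolding chain_def
  proof (intro allI impI)
    fix U assume U: "U \<subseteq> T" "card U = p"
    let ?y = "osgn m U (e (insert m U))"
    have "a U - (bd T e U + ?y) \<in> R (insert m (T - U))"
      using chain_insertD(1)[OF T e(2) U] c1[OF U(1)] bd_insert(1)[OF T U(1), of e] by simp
    moreover have "?y \<in> F (T - U)"
      by (rule is_subgrp_osgn[OF F.sub]) (use TN e2 U in \<open>auto simp: chain_def\<close>)
    moreover have "a U - bd T e U = (a U - (bd T e U + ?y)) + ?y" by simp
    ultimately show "a U - bd T e U \<in> Dbot m F R (T - U)" unfolding Dbot_def by blast
  qed
  with e1 show "\<exists>e. chain (Dtop m F) (Suc p) T e \<and> chain (Dbot m F R) p T (\<lambda>U. a U - bd T e U)"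
    by blast
qed

text \<open>Vanishing makes the cycle a boundary modulo \<open>Dbot\<close>, whose elements have a
  part in the shifted \<open>R\<close> and a part in \<open>F\<close>. The parts are returned
  separately because \<open>r\<close> is zero in the shift while \<open>f\<close> has to be
  compensated at the point \<open>m\<close>.\<close>

lemma koszul_van_D_split:
  assumes V: "koszul_van (Dtop m F) (Dbot m F R) (Suc q) T" and a: "chain (Dtop m F) (Suc q) T a"
    and cyc: "chain (Dbot m F R) q T (bd T a)"
  obtains h r f where "chain (Dtop m F) (Suc (Suc q)) T h" "chain (Dtop m R) (Suc q) T r"
    "chain F (Suc q) T f"
    "\<And>U. U \<subseteq> T \<Longrightarrow> card U = Suc q \<Longrightarrow> a U = bd T h U + r U + f U"
proof -
  obtain h where h: "chain (Dtop m F) (Suc (Suc q)) T h"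
    "chain (Dbot m F R) (Suc q) T (\<lambda>U. a U - bd T h U)"
    using V a cyc by (auto simp: koszul_van_def)
  have "\<forall>U. \<exists>r f. U \<subseteq> T \<and> card U = Suc q \<longrightarrow>
      r \<in> R (insert m (T - U)) \<and> f \<in> F (T - U) \<and> a U = bd T h U + r + f"
  proof
    fix U
    show "\<exists>r f. U \<subseteq> T \<and> card U = Suc q \<longrightarrow>
      r \<in> R (insert m (T - U)) \<and> f \<in> F (T - U) \<and> a U = bd T h U + r + f"
    proof (cases "U \<subseteq> T \<and> card U = Suc q")
      case True
      then have "a U - bd T h U \<in> Dbot m F R (T - U)" using h(2) by (auto simp: chain_def)
      then obtain r f where rf: "a U - bd T h U = r + f" "r \<in> R (insert m (T - U))" "f \<in> F (T - U)"
        by (auto simp: Dbot_def)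
      moreover have "a U = bd T h U + r + f" using rf(1) by (simp add: algebra_simps)
      ultimately show ?thesis by blast
    qed auto
  qed
  then obtain r f where "\<And>U. U \<subseteq> T \<and> card U = Suc q \<Longrightarrow>
      r U \<in> R (insert m (T - U)) \<and> f U \<in> F (T - U) \<and> a U = bd T h U + r U + f U" by metis
  with h(1) that[of h r f] show thesis by (auto simp: chain_def Dtop_def)
qed

text \<open>Exactness of H_2(D) -> H_0(K) -> S H_1(V) in the middle. An element \<open>x\<close> of
  \<open>K\<close> placed at the vertex \<open>m\<close> is a 1-cycle on \<open>insert m T\<close>.
  If \<open>e\<close> bounds it, the m-free part of \<open>e\<close> is a 2-cycle of
  \<open>D\<close>, and bounding that cycle moves the part of \<open>e\<close> at \<open>m\<close>
  into \<open>K\<close>.\<close>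

lemma koszul_van_K_0:
  assumes m: "m < N" and T: "T \<subseteq> {..<m}"
    and V: "koszul_van F R 1 (insert m T)" and D: "koszul_van (Dtop m F) (Dbot m F R) 2 T"
  shows "koszul_van (Ktop m F R) R 0 T"
  unfolding koszul_van_def
proof (intro allI impI)
  fix x0 assume "chain (Ktop m F R) 0 T x0"
  define x where "x = x0 {}"
  have x: "x \<in> F T" "x \<in> R (insert m T)"
    using \<open>chain _ 0 T x0\<close> by (auto simp: x_def chain_def Ktop_def)
  have fT: "finite T" and mT: "m \<notin> T" using T by (auto intro: finite_subset)
  have TN: "T \<subseteq> {..<N}" using T m by auto
  have sF: "is_subgrp (F (T - U))" for U by (rule F.sub) (use TN in auto)
  have sR: "is_subgrp (R (insert m (T - U)))" for U
    by (rule R.sub, rule insert_le[OF m]) (use T in auto)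
  interpret RT: filt m "Dtop m R" by (rule filt_Rtop[OF m])
  define c where "c = (\<lambda>V. if V = {m} then x else 0)"
  have c0: "c U = 0" if "U \<subseteq> T" for U using that mT by (auto simp: c_def)
  have card0: "U = {}" if "U \<subseteq> T" "card U = 0" for U
    using that fT by (metis card_0_eq finite_subset)
  have F0: "0 \<in> F (insert m (T - U))" for U
    by (rule is_subgrp_zero[OF F.sub], rule insert_le[OF m]) (use T in auto)
  have "chain F 1 (insert m T) c"
    unfolding chain_insert[OF T] using x(1) F0 c0 by (auto simp: chain_def c_def dest!: card0)
  moreover have "chain R 0 (insert m T) (bd (insert m T) c)"
  proof -
    have "bd T c {} = bd T (\<lambda>_. 0) {}" by (rule bd_cong[OF fT]) (auto simp: c0)
    then have "bd (insert m T) c {} = x" by (simp add: bd_insert(1)[OF T] c_def)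
    then show ?thesis unfolding chain_insert[OF T] using x(2) by (auto simp: chain_def dest!: card0)
  qed
  ultimately obtain e where e: "chain F 2 (insert m T) e"
    "chain R 1 (insert m T) (\<lambda>U. c U - bd (insert m T) e U)"
    using V by (force simp: koszul_van_def numeral_2_eq_2)
  define b where "b = (\<lambda>U. e (insert m U))"
  have e1: "chain (Dtop m F) 2 T e" and b: "chain F 1 T b"
    using e(1) by (auto simp: chain_insert[OF T] Dtop_def b_def)
  have eq1: "bd T e U + osgn m U (b U) \<in> R (insert m (T - U))" if U: "U \<subseteq> T" "card U = 1" for U
  proof -
    have "- (bd T e U + osgn m U (b U)) \<in> R (insert m (T - U))"
      using chain_insertD(1)[OF T e(2) U] bd_insert(1)[OF T U(1), of e] c0[OF U(1)]
      by (simp add: b_def)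
    from is_subgrp_minus[OF sR this] show ?thesis by (simp only: minus_minus)
  qed
  have eq2: "x - bd T b {} \<in> R T"
  proof -
    have "c {m} - bd (insert m T) e {m} \<in> R T"
      using chain_insertD(2)[OF T e(2), of "{}"] by simp
    moreover have "bd (insert m T) e {m} = bd T b {}"
      unfolding b_def by (rule bd_insert(2)[OF T, of "{}" e]) simp
    ultimately show ?thesis by (simp add: c_def)
  qed
  have cyc: "chain (Dbot m F R) 1 T (bd T e)"
    unfolding chain_def
  proof (intro allI impI)
    fix U assume U: "U \<subseteq> T" "card U = 1"
    have "- osgn m U (b U) \<in> F (T - U)"
      using b U by (auto simp: chain_def intro!: is_subgrp_minus is_subgrp_osgn sF)
    then show "bd T e U \<in> Dbot m F R (T - U)"
      using eq1[OF U] unfolding Dbot_def by force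
  qed
  have two: "2 = Suc 1" by simp
  obtain h r f where h: "chain (Dtop m F) (Suc (Suc 1)) T h" and r: "chain (Dtop m R) (Suc 1) T r"
    and f: "chain F (Suc 1) T f"
    and hrf: "\<And>U. U \<subseteq> T \<Longrightarrow> card U = Suc 1 \<Longrightarrow> e U = bd T h U + r U + f U"
    using koszul_van_D_split[OF D[unfolded two] e1[unfolded two] cyc] by blast
  \<comment> \<open>Removing the boundary of \<open>r\<close> from \<open>eq1\<close> leaves the
    boundary of \<open>f\<close> plus \<open>b\<close> up to sign, so this correction puts
    \<open>k\<close> into \<open>K\<close>. It does not affect \<open>bd T b {}\<close>, being
    itself a boundary up to sign.\<close>
  define k where "k = (\<lambda>U. b U + osgn m U (bd T f U))"
  have k: "chain (Ktop m F R) 1 T k"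
    unfolding chain_def
  proof (intro allI impI)
    fix U assume U: "U \<subseteq> T" "card U = 1"
    have "bd T f U \<in> F (T - U)"
      by (rule chainD[OF F.chain_bd[OF TN f] U])
    then have 1: "k U \<in> F (T - U)"
      using b U by (auto simp: k_def chain_def intro!: is_subgrp_add is_subgrp_osgn sF)
    have "bd T e U = bd T (\<lambda>V. bd T h V + r V + f V) U"
      by (rule bd_cong[OF fT U(1)]) (use hrf U in auto)
    also have "\<dots> = bd T r U + bd T f U" by (simp add: bd_add bd_bd[OF fT U(1)])
    finally have "osgn m U (bd T r U + bd T f U + osgn m U (b U)) \<in> R (insert m (T - U))"
      using eq1[OF U] by (auto intro!: is_subgrp_osgn sR)
    moreover have "osgn m U (bd T r U) \<in> R (insert m (T - U))"
      using chainD[OF RT.chain_bd[OF T r] U] by (auto simp: Dtop_def intro!: is_subgrp_osgn sR)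
    ultimately have "osgn m U (bd T r U + bd T f U + osgn m U (b U)) - osgn m U (bd T r U)
        \<in> R (insert m (T - U))" by (rule is_subgrp_diff[OF sR])
    then have "k U \<in> R (insert m (T - U))" by (simp add: k_def osgn_add algebra_simps)
    with 1 show "k U \<in> Ktop m F R (T - U)" by (simp add: Ktop_def)
  qed
  have "bd T k {} = bd T b {}"
    by (simp add: k_def bd_add bd_osgn[OF T] bd_bd[OF fT])
  with eq2 have "chain R 0 T (\<lambda>U. x0 U - bd T k U)"
    by (auto simp: chain_def x_def dest!: card0)
  with k show "\<exists>e. chain (Ktop m F R) (Suc 0) T e \<and> chain R 0 T (\<lambda>U. x0 U - bd T e U)"
    by (intro exI[of _ k]) simp
qed

text \<open>Exactness of H_q(K) -> S H_{q+1}(V) -> H_{q+1}(D) in the middle: the m-free part of a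
  cycle is a cycle of \<open>D\<close>; once it is bounded, a cycle of \<open>K\<close> is left at
  \<open>m\<close>, and bounding that as well bounds the whole.\<close>

lemma koszul_van_step:
  assumes m: "m < N" and T: "T \<subseteq> {..<m}"
    and D: "koszul_van (Dtop m F) (Dbot m F R) (Suc q) T" and K: "koszul_van (Ktop m F R) R q T"
  shows "koszul_van F R (Suc q) (insert m T)"
  unfolding koszul_van_def
proof (intro allI impI)
  fix c assume c: "chain F (Suc q) (insert m T) c"
    and cyc: "\<forall>q'. Suc q = Suc q' \<longrightarrow> chain R q' (insert m T) (bd (insert m T) c)"
  have fT: "finite T" and mT: "m \<notin> T" using T by (auto intro: finite_subset)
  have TN: "T \<subseteq> {..<N}" using T m by auto
  have sF: "is_subgrp (F (T - U))" for U by (rule F.sub) (use TN in auto)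
  have sR: "is_subgrp (R (insert m (T - U)))" for U
    by (rule R.sub, rule insert_le[OF m]) (use T in auto)
  interpret RT: filt m "Dtop m R" by (rule filt_Rtop[OF m])
  define b where "b = (\<lambda>U. c (insert m U))"
  have c1: "chain (Dtop m F) (Suc q) T c" and b: "chain F q T b"
    using c by (auto simp: chain_insert[OF T] Dtop_def b_def)
  have eq1: "bd T c U + osgn m U (b U) \<in> R (insert m (T - U))" if U: "U \<subseteq> T" "card U = q" for U
    using cyc chain_insertD(1)[OF T _ U, of R "bd (insert m T) c"] bd_insert(1)[OF T U(1), of c]
    by (simp add: b_def)
  have eq2: "chain R q' T (bd T b)" if "q = Suc q'" for q'
    unfolding chain_def
  proof (intro allI impI)
    fix U assume U: "U \<subseteq> T" "card U = q'"
    show "bd T b U \<in> R (T - U)"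
      using cyc chain_insertD(2)[OF T _ U(1), of R q "bd (insert m T) c"] bd_insert(2)[OF T U(1), of c]
        U that by (simp add: b_def[abs_def])
  qed
  have cyc': "chain (Dbot m F R) q T (bd T c)"
    unfolding chain_def
  proof (intro allI impI)
    fix U assume U: "U \<subseteq> T" "card U = q"
    have "- osgn m U (b U) \<in> F (T - U)"
      using b U by (auto simp: chain_def intro!: is_subgrp_minus is_subgrp_osgn sF)
    then show "bd T c U \<in> Dbot m F R (T - U)"
      using eq1[OF U] unfolding Dbot_def by force
  qed
  obtain h r f where h: "chain (Dtop m F) (Suc (Suc q)) T h" and r: "chain (Dtop m R) (Suc q) T r"
    and f: "chain F (Suc q) T f"
    and hrf: "\<And>U. U \<subseteq> T \<Longrightarrow> card U = Suc q \<Longrightarrow> c U = bd T h U + r U + f U"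
    using koszul_van_D_split[OF D c1 cyc'] by blast
  \<comment> \<open>The sign is chosen so that \<open>g\<close>, placed at the point
    \<open>m\<close>, contributes exactly \<open>f\<close> to the m-free part of the
    boundary.\<close>
  define g where "g = (\<lambda>U. osgn m U (f U))"
  have g: "chain F (Suc q) T g"
    using f by (auto simp: chain_def g_def intro!: is_subgrp_osgn sF)
  have bdg: "bd T g U = - osgn m U (bd T f U)" if "U \<subseteq> T" for U
    unfolding g_def by (rule bd_osgn[OF T that])
  define k where "k = (\<lambda>U. b U - bd T g U)"
  have k: "chain (Ktop m F R) q T k"
    unfolding chain_def
  proof (intro allI impI)
    fix U assume U: "U \<subseteq> T" "card U = q"
    have "bd T g U \<in> F (T - U)"
      by (rule chainD[OF F.chain_bd[OF TN g] U])
    then have 1: "k U \<in> F (T - U)"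
      using b U by (auto simp: k_def chain_def intro!: is_subgrp_diff sF)
    have "bd T c U = bd T (\<lambda>V. bd T h V + r V + f V) U"
      by (rule bd_cong[OF fT U(1)]) (use hrf U in auto)
    also have "\<dots> = bd T r U + bd T f U" by (simp add: bd_add bd_bd[OF fT U(1)])
    finally have "osgn m U (bd T r U + bd T f U + osgn m U (b U)) \<in> R (insert m (T - U))"
      using eq1[OF U] by (auto intro!: is_subgrp_osgn sR)
    moreover have "osgn m U (bd T r U) \<in> R (insert m (T - U))"
      using chainD[OF RT.chain_bd[OF T r] U] by (auto simp: Dtop_def intro!: is_subgrp_osgn sR)
    ultimately have "osgn m U (bd T r U + bd T f U + osgn m U (b U)) - osgn m U (bd T r U)
        \<in> R (insert m (T - U))" by (rule is_subgrp_diff[OF sR])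
    then have "k U \<in> R (insert m (T - U))" by (simp add: k_def osgn_add bdg[OF U(1)] algebra_simps)
    with 1 show "k U \<in> Ktop m F R (T - U)" by (simp add: Ktop_def)
  qed
  moreover have "chain R q' T (bd T k)" if q': "q = Suc q'" for q'
    unfolding chain_def
  proof (intro allI impI)
    fix U assume U: "U \<subseteq> T" "card U = q'"
    have "bd T k U = bd T b U" by (simp add: k_def bd_diff bd_bd[OF fT U(1)])
    then show "bd T k U \<in> R (T - U)" using eq2[OF q'] U by (simp add: chain_def)
  qed
  ultimately obtain l where l: "chain (Ktop m F R) (Suc q) T l" "chain R q T (\<lambda>U. k U - bd T l U)"
    using K by (auto simp: koszul_van_def)
  \<comment> \<open>At the point \<open>m\<close>, \<open>g\<close> accounts for \<open>f\<close>
    and \<open>l\<close> bounds \<open>k\<close>. The error that \<open>l\<close> causes in the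
    m-free part lies in the shifted \<open>R\<close>, because \<open>l\<close> is a chain of
    \<open>K\<close>.\<close>
  define e where "e = (\<lambda>V. if m \<in> V then g (V - {m}) + l (V - {m}) else h V)"
  have e1: "e U = h U" if "U \<subseteq> T" for U using that mT by (auto simp: e_def)
  have e2: "e (insert m U) = g U + l U" if "U \<subseteq> T" for U
  proof -
    have "insert m U - {m} = U" using that mT by auto
    then show ?thesis by (simp add: e_def)
  qed
  have "chain F (Suc (Suc q)) (insert m T) e"
    unfolding chain_insert[OF T]
    using h e1 e2 g l(1) by (auto simp: chain_def Dtop_def Ktop_def intro!: is_subgrp_add sF)
  moreover have "chain R (Suc q) (insert m T) (\<lambda>U. c U - bd (insert m T) e U)"
    unfolding chain_insert[OF T]
  proof (intro conjI allI impI)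
    show "chain (\<lambda>S. R (insert m S)) (Suc q) T (\<lambda>U. c U - bd (insert m T) e U)"
      unfolding chain_def
    proof (intro allI impI)
      fix U assume U: "U \<subseteq> T" "card U = Suc q"
      have "bd T e U = bd T h U" by (rule bd_cong[OF fT U(1)]) (rule e1)
      then have "c U - bd (insert m T) e U = r U - osgn m U (l U)"
        using hrf[OF U] by (simp add: bd_insert(1)[OF T U(1)] e2[OF U(1)] osgn_add g_def)
      also have "\<dots> \<in> R (insert m (T - U))"
        using r l(1) U by (auto simp: chain_def Dtop_def Ktop_def intro!: is_subgrp_diff is_subgrp_osgn sR)
      finally show "c U - bd (insert m T) e U \<in> R (insert m (T - U))" .
    qed
    fix q' assume "Suc q = Suc q'"
    then have [simp]: "q' = q" by simp
    show "chain R q' T (\<lambda>U. c (insert m U) - bd (insert m T) e (insert m U))"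
      unfolding chain_def
    proof (intro allI impI)
      fix U assume U: "U \<subseteq> T" "card U = q'"
      have "bd T (\<lambda>V. e (insert m V)) U = bd T (\<lambda>V. g V + l V) U"
        by (rule bd_cong[OF fT U(1)]) (rule e2)
      then have "c (insert m U) - bd (insert m T) e (insert m U) = k U - bd T l U"
        by (simp add: bd_insert(2)[OF T U(1)] bd_add k_def b_def)
      then show "c (insert m U) - bd (insert m T) e (insert m U) \<in> R (T - U)"
        using l(2) U by (simp add: chain_def)
    qed
  qed
  ultimately show "\<exists>e. chain F (Suc (Suc q)) (insert m T) e \<and>
      chain R (Suc q) (insert m T) (\<lambda>U. c U - bd (insert m T) e U)" by blast
qed

lemma koszul_van_trivial:
  assumes T: "T \<subseteq> {..<N}" and triv: "\<And>U. U \<subseteq> T \<Longrightarrow> card U = p \<Longrightarrow> F (T - U) \<subseteq> R (T - U)"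
  shows "koszul_van F R p T"
  unfolding koszul_van_def
proof (intro allI impI exI conjI)
  show "chain F (Suc p) T (\<lambda>_. 0)"
    using is_subgrp_zero[OF F.sub] T by (simp add: chain_def subset_iff)
  fix c assume "chain F p T c"
  then show "chain R p T (\<lambda>U. c U - bd T (\<lambda>_. 0) U)"
    using triv by (auto simp: chain_def)
qed

text \<open>If every map from \<open>T - {t}\<close> is zero, nothing is divided out in H_0 at
  \<open>T\<close>, so its vanishing forces the value at \<open>T\<close> to vanish. This serves
  both the kernel \<open>K\<close> and the start of the induction, where the smaller values vanish
  already.\<close>

lemma koszul_van_0:
  assumes T: "T \<subseteq> {..<N}" and V: "koszul_van F R 0 T" and le: "\<And>t. t \<in> T \<Longrightarrow> F (T - {t}) \<subseteq> R T"
  shows "F T \<subseteq> R T"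
proof
  fix x assume x: "x \<in> F T"
  have fT: "finite T" using T by (meson finite_lessThan finite_subset)
  have "chain F 0 T (\<lambda>_. x)" using x fT by (auto simp: chain_def card_eq_0_iff dest: finite_subset)
  then obtain e where e: "chain F 1 T e" "x - bd T e {} \<in> R T"
  proof -
    have "\<exists>e. chain F (Suc 0) T e \<and> chain R 0 T (\<lambda>U. x - bd T e U)"
      using V \<open>chain F 0 T (\<lambda>_. x)\<close> by (simp add: koszul_van_def)
    then show thesis using that chainD[of R 0 T _ "{}"] by force
  qed
  have "bd T e {} \<in> R T"
    unfolding bd_def
  proof (rule is_subgrp_sum[OF R.sub[OF T]])
    fix t assume "t \<in> T - {}"
    then show "osgn t {} (e (insert t {})) \<in> R T"
      using le[of t] chainD[OF e(1), of "{t}"] by auto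
  qed
  from is_subgrp_add[OF R.sub[OF T] e(2) this] show "x \<in> R T" by simp
qed

end

section \<open>Renaming symmetry and the regularity bound\<close>

locale sym_fam = fam N F R
  for N and F R :: "nat set \<Rightarrow> 'g::ab_group_add set" +
  fixes \<pi> :: "nat \<Rightarrow> nat \<Rightarrow> 'g \<Rightarrow> 'g"
  assumes \<pi>_add: "\<pi> i j (x + y) = \<pi> i j x + \<pi> i j y"
    and \<pi>_F: "\<lbrakk>i < N; j < N; T \<subseteq> {..<N}; i \<notin> T; j \<notin> T; x \<in> F (insert i T)\<rbrakk> \<Longrightarrow> \<pi> i j x \<in> F (insert j T)"
    and \<pi>_R: "\<lbrakk>i < N; j < N; T \<subseteq> {..<N}; i \<notin> T; j \<notin> T; x \<in> R (insert i T)\<rbrakk> \<Longrightarrow> \<pi> i j x \<in> R (insert j T)"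
    and \<pi>_id: "\<lbrakk>i < N; j < N; T \<subseteq> {..<N}; i \<notin> T; j \<notin> T; x \<in> F T\<rbrakk> \<Longrightarrow> \<pi> i j x = x"
begin

text \<open>Renaming points below \<open>m\<close> leaves \<open>m\<close> alone, so the same
  \<open>\<pi>\<close> serves for \<open>D\<close> and the symmetry persists through the
  induction.\<close>

lemma sym_fam_D:
  assumes m: "m < N"
  shows "sym_fam m (Dtop m F) (Dbot m F R) \<pi>"
proof (intro sym_fam.intro fam_D[OF m] sym_fam_axioms.intro)
  fix i j x y T assume a: "i < m" "j < m" "T \<subseteq> {..<m}" "i \<notin> T" "j \<notin> T"
  then have b: "i < N" "j < N" "insert m T \<subseteq> {..<N}" "T \<subseteq> {..<N}" "i \<notin> insert m T" "j \<notin> insert m T"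
    using m by auto
  show "\<pi> i j x \<in> Dtop m F (insert j T)" if "x \<in> Dtop m F (insert i T)"
    using \<pi>_F[OF b(1-3,5,6)] that by (simp add: Dtop_def insert_commute)
  show "\<pi> i j x \<in> Dbot m F R (insert j T)" if "x \<in> Dbot m F R (insert i T)"
  proof -
    obtain u v where uv: "x = u + v" "u \<in> R (insert m (insert i T))" "v \<in> F (insert i T)"
      using \<open>x \<in> Dbot m F R (insert i T)\<close> by (auto simp: Dbot_def)
    have "\<pi> i j u \<in> R (insert m (insert j T))"
      using \<pi>_R[OF b(1-3,5,6), of u] uv(2) by (simp add: insert_commute)
    moreover have "\<pi> i j v \<in> F (insert j T)" by (rule \<pi>_F[OF b(1,2,4) a(4,5) uv(3)])
    ultimately show ?thesis unfolding uv(1) \<pi>_add Dbot_def by blast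
  qed
  show "\<pi> i j x = x" if "x \<in> Dtop m F T"
    using \<pi>_id[OF b(1-3,5,6)] that by (simp add: Dtop_def)
qed (rule \<pi>_add)

text \<open>An element killed by adding one point is killed by adding any other point, so all
  non-invertible structure maps of the kernel \<open>K\<close> vanish and \<open>K = H\<^sub>0(K)\<close>.\<close>

lemma Ktop_trivial:
  assumes m: "m < N" and T: "T \<subseteq> {..<m}" and V: "koszul_van (Ktop m F R) R 0 T"
  shows "Ktop m F R T \<subseteq> R T"
proof -
  interpret K: fam m "Ktop m F R" R by (rule fam_K[OF m])
  show ?thesis
  proof (rule K.koszul_van_0[OF T V], rule subsetI)
    fix t x assume t: "t \<in> T" and x: "x \<in> Ktop m F R (T - {t})"
    have a: "m < N" "t < N" "T - {t} \<subseteq> {..<N}" "m \<notin> T - {t}" "t \<notin> T - {t}"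
      using m T t by auto
    have "\<pi> m t x \<in> R (insert t (T - {t}))"
      by (rule \<pi>_R[OF a]) (use x in \<open>simp add: Ktop_def\<close>)
    moreover have "\<pi> m t x = x" by (rule \<pi>_id[OF a]) (use x in \<open>simp add: Ktop_def\<close>)
    ultimately show "x \<in> R T" using t by (simp add: insert_absorb)
  qed
qed

end

text \<open>Here \<open>k\<close> is one more than the degree bound on H_0, so that the induction
  starts at the zero module; \<open>p + k + d - 2\<close> is the regularity bound for
  \<open>k - 1\<close>. The number \<open>d\<close> is an integer because it falls together with
  \<open>k\<close> and may become negative.\<close>

theorem koszul_van_regularity:
  fixes d :: int
  assumes "sym_fam N F R \<pi>"
    and "\<And>T. T \<subseteq> {..<N} \<Longrightarrow> k \<le> card T \<Longrightarrow> koszul_van F R 0 T"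
    and "\<And>T. T \<subseteq> {..<N} \<Longrightarrow> d < int (card T) \<Longrightarrow> koszul_van F R 1 T"
    and "0 < p" "T \<subseteq> {..<N}" "int p + int k + d - 2 < int (card T)"
  shows "koszul_van F R p T"
  using assms
proof (induction k arbitrary: N F R d p T)
  case 0
  interpret sym_fam N F R \<pi> by fact
  \<comment> \<open>With H_0 zero everywhere, all values vanish by induction on the size of
    \<open>T\<close>, as in Nakayama's lemma.\<close>
  have "F T \<subseteq> R T" if "T \<subseteq> {..<N}" for T
    using that
  proof (induction "card T" arbitrary: T rule: less_induct)
    case less
    show ?case
    proof (rule koszul_van_0[OF less.prems])
      show "koszul_van F R 0 T" using 0 less.prems by simp
      fix t assume t: "t \<in> T"
      have fT: "finite T" using less.prems by (meson finite_lessThan finite_subset)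
      have "F (T - {t}) \<subseteq> R (T - {t})"
        using less t card_Diff1_less[OF fT t] by blast
      also have "\<dots> \<subseteq> R T" by (rule R.mono) (use less.prems in auto)
      finally show "F (T - {t}) \<subseteq> R T" .
    qed
  qed
  note triv = this
  show ?case
  proof (rule koszul_van_trivial[OF 0(5)])
    fix U assume "U \<subseteq> T"
    show "F (T - U) \<subseteq> R (T - U)" by (rule triv) (use 0(5) in auto)
  qed
next
  case (Suc k)
  interpret sym_fam N F R \<pi> by fact
  have fT: "finite T" using Suc.prems(5) by (meson finite_lessThan finite_subset)
  show ?case
  proof (cases "T = {}")
    case True
    then show ?thesis using Suc.prems(4) by (intro koszul_van_trivial[OF Suc.prems(5)]) auto
  next
    case False
    define m where "m = Max T"
    define S where "S = T - {m}"
    have mT: "m \<in> T" using False fT by (simp add: m_def)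
    have m: "m < N" using mT Suc.prems(5) by auto
    have S: "S \<subseteq> {..<m}" using fT by (auto simp: S_def m_def) (metis Max_ge le_neq_implies_less)
    have TS: "T = insert m S" using mT by (auto simp: S_def)
    have ins: "insert m T' \<subseteq> {..<N}" "card (insert m T') = Suc (card T')" if T': "T' \<subseteq> {..<m}" for T'
    proof -
      have "finite T'" "m \<notin> T'" using T' by (auto intro: finite_subset)
      then show "card (insert m T') = Suc (card T')" by simp
    qed (use T' m in auto)
    have cS: "card T = Suc (card S)" using ins(2)[OF S] TS by simp
    interpret K: fam m "Ktop m F R" R by (rule fam_K[OF m])
    have D: "koszul_van (Dtop m F) (Dbot m F R) p' T'"
      if "0 < p'" "T' \<subseteq> {..<m}" "int p' + int k + (d - 1) - 2 < int (card T')" for p' T'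
    proof (rule Suc.IH[OF sym_fam_D[OF m] _ _ that(1,2,3)])
      fix A assume A: "A \<subseteq> {..<m}"
      show "koszul_van (Dtop m F) (Dbot m F R) 0 A" if "k \<le> card A"
        by (rule koszul_van_D_low[OF m A]) (use ins[OF A] that Suc.prems(2) in auto)
      show "koszul_van (Dtop m F) (Dbot m F R) 1 A" if "d - 1 < int (card A)"
        by (rule koszul_van_D_low[OF m A]) (use ins[OF A] that Suc.prems(3) in auto)
    qed
    \<comment> \<open>The induction hypothesis at \<open>p' = 2\<close> asks for sizes above
      \<open>2 + k + (d - 1) - 2\<close>, which is the bound \<open>k + d - 1\<close> obtained for
      \<open>K\<close>.\<close>
    have K: "Ktop m F R A \<subseteq> R A" if A: "A \<subseteq> {..<m}" "int k + d - 1 < int (card A)" for A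
    proof (rule Ktop_trivial[OF m A(1)], rule koszul_van_K_0[OF m A(1)])
      show "koszul_van F R 1 (insert m A)" using Suc.prems(3) ins[OF A(1)] A(2) by simp
      show "koszul_van (Dtop m F) (Dbot m F R) 2 A" using D[of 2 A] A by simp
    qed
    obtain q where q: "p = Suc q" using Suc.prems(4) by (cases p) auto
    have "koszul_van F R (Suc q) (insert m S)"
    proof (rule koszul_van_step[OF m S])
      show "koszul_van (Dtop m F) (Dbot m F R) (Suc q) S"
        by (rule D) (use S Suc.prems(6) q cS in auto)
      show "koszul_van (Ktop m F R) R q S"
      proof (rule K.koszul_van_trivial[OF S], rule K)
        fix U assume U: "U \<subseteq> S" "card U = q"
        show "S - U \<subseteq> {..<m}" using S by auto
        \<comment> \<open>Each of the \<open>q\<close> removed points costs one in the bound for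
          \<open>K\<close>; this is the origin of the summand \<open>p\<close> in the regularity
          bound.\<close>
        have "card (S - U) = card S - q" "card U \<le> card S"
          using U S by (auto intro!: card_Diff_subset card_mono elim!: rev_finite_subset[rotated])
        then show "int k + d - 1 < int (card (S - U))"
          using Suc.prems(6) q cS U by simp
      qed
    qed
    then show ?thesis using TS q by simp
  qed
qed

section \<open>Low degrees, dimension shifting and invariance\<close>

definition decomposables :: "(nat set \<Rightarrow> 'g::ab_group_add set) \<Rightarrow> nat set \<Rightarrow> 'g set" where
  "decomposables F T = {\<Sum>t\<in>T. c t |c. \<forall>t\<in>T. c t \<in> F (T - {t})}"

text \<open>\<open>F T / zdec R F T\<close> is H_0 of \<open>F / R\<close> at \<open>T\<close>.
  Working with the subgroup turns statements on maps between H_0 into inclusions.\<close>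

definition zdec :: "(nat set \<Rightarrow> 'g::ab_group_add set) \<Rightarrow> (nat set \<Rightarrow> 'g set) \<Rightarrow> nat set \<Rightarrow> 'g set" where
  "zdec R F T = {x + y |x y. x \<in> R T \<and> y \<in> decomposables F T}"

lemma decI: "(\<And>t. t \<in> T \<Longrightarrow> c t \<in> F (T - {t})) \<Longrightarrow> (\<Sum>t\<in>T. c t) \<in> decomposables F T"
  by (auto simp: decomposables_def)

lemma decE:
  assumes "x \<in> decomposables F T"
  obtains c where "\<And>t. t \<in> T \<Longrightarrow> c t \<in> F (T - {t})" "x = (\<Sum>t\<in>T. c t)"
  using assms by (auto simp: decomposables_def)

lemma zdecI: "x \<in> R T \<Longrightarrow> y \<in> decomposables F T \<Longrightarrow> x + y \<in> zdec R F T"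
  unfolding zdec_def by blast

lemma zdecE:
  assumes "z \<in> zdec R F T"
  obtains x c where "x \<in> R T" "\<And>t. t \<in> T \<Longrightarrow> c t \<in> F (T - {t})" "z = x + (\<Sum>t\<in>T. c t)"
  using assms by (auto simp: zdec_def elim!: decE)

lemma bd_singletons: "bd T (\<lambda>U. c (the_elem U)) {} = (\<Sum>t\<in>T. c t)"
  by (simp add: bd_def)

lemma chain_singletons: "(\<And>t. t \<in> T \<Longrightarrow> c t \<in> F (T - {t})) \<Longrightarrow> chain F 1 T (\<lambda>U. c (the_elem U))"
  by (auto simp: chain_def card_1_singleton_iff)

lemma dec_chain:
  assumes "chain F 1 T c"
  shows "bd T c {} \<in> decomposables F T"
proof -
  have "(\<Sum>t\<in>T. c {t}) \<in> decomposables F T" by (rule decI) (use chainD[OF assms] in auto)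
  then show ?thesis by (simp add: bd_def)
qed

lemma chain_0_iff: "finite T \<Longrightarrow> chain F 0 T c \<longleftrightarrow> c {} \<in> F T"
  by (auto simp: chain_def card_eq_0_iff dest: finite_subset)

lemma (in filt) finite_sub: "T \<subseteq> {..<N} \<Longrightarrow> finite T"
  by (meson finite_lessThan finite_subset)

lemma (in filt) dec_mem:
  assumes T: "T \<subseteq> {..<N}" and x: "x \<in> F (T - {t})" and t: "t \<in> T"
  shows "x \<in> decomposables F T"
proof -
  have "(\<Sum>s\<in>T. if s = t then x else 0) \<in> decomposables F T"
  proof (rule decI)
    fix s assume "s \<in> T"
    have "0 \<in> F (T - {s})" by (rule is_subgrp_zero[OF sub]) (use T in auto)
    then show "(if s = t then x else 0) \<in> F (T - {s})" using x by auto
  qed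
  then show ?thesis using finite_sub[OF T] t by simp
qed

lemma (in filt) is_subgrp_dec:
  assumes T: "T \<subseteq> {..<N}"
  shows "is_subgrp (decomposables F T)"
  unfolding is_subgrp_def
proof (intro conjI ballI)
  have s: "is_subgrp (F (T - {t}))" for t by (rule sub) (use T in auto)
  have "(\<Sum>t\<in>T. 0) \<in> decomposables F T" by (rule decI) (rule is_subgrp_zero[OF s])
  then show "0 \<in> decomposables F T" by simp
  fix x y assume "x \<in> decomposables F T" "y \<in> decomposables F T"
  then obtain c d where c: "\<And>t. t \<in> T \<Longrightarrow> c t \<in> F (T - {t})" "x = (\<Sum>t\<in>T. c t)"
    and d: "\<And>t. t \<in> T \<Longrightarrow> d t \<in> F (T - {t})" "y = (\<Sum>t\<in>T. d t)"
    by (elim decE) blast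
  have "(\<Sum>t\<in>T. c t - d t) \<in> decomposables F T" by (rule decI) (auto intro: is_subgrp_diff[OF s] c d)
  then show "x - y \<in> decomposables F T" by (simp add: c d sum_subtractf)
qed

lemma (in filt) dec_subset:
  assumes T: "T \<subseteq> {..<N}"
  shows "decomposables F T \<subseteq> F T"
proof
  fix x assume "x \<in> decomposables F T"
  then obtain c where c: "\<And>t. t \<in> T \<Longrightarrow> c t \<in> F (T - {t})" "x = (\<Sum>t\<in>T. c t)"
    by (elim decE) blast
  have "F (T - {t}) \<subseteq> F T" for t by (rule mono) (use T in auto)
  then show "x \<in> F T" unfolding c(2) by (intro is_subgrp_sum[OF sub[OF T]]) (use c(1) in auto)
qed

lemma (in fam) koszul_van_0_iff:
  assumes T: "T \<subseteq> {..<N}"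
  shows "koszul_van F R 0 T \<longleftrightarrow> F T \<subseteq> zdec R F T"
proof
  note fT = F.finite_sub[OF T]
  show "F T \<subseteq> zdec R F T" if V: "koszul_van F R 0 T"
  proof
    fix x assume "x \<in> F T"
    then have "\<exists>e. chain F (Suc 0) T e \<and> chain R 0 T (\<lambda>U. x - bd T e U)"
      using V chain_0_iff[OF fT, of F "\<lambda>_. x"] unfolding koszul_van_def by blast
    then obtain e where e: "chain F 1 T e" "x - bd T e {} \<in> R T"
      by (auto simp: chain_0_iff[OF fT])
    show "x \<in> zdec R F T" using zdecI[of _ R T, OF e(2) dec_chain[OF e(1)]] by simp
  qed
  show "koszul_van F R 0 T" if le: "F T \<subseteq> zdec R F T"
    unfolding koszul_van_def
  proof (intro allI impI)
    fix c assume "chain F 0 T c"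
    then have "c {} \<in> zdec R F T" using le by (auto simp: chain_0_iff[OF fT])
    then obtain x d where d: "x \<in> R T" "\<And>t. t \<in> T \<Longrightarrow> d t \<in> F (T - {t})"
      "c {} = x + (\<Sum>t\<in>T. d t)" by (elim zdecE) blast
    then show "\<exists>e. chain F (Suc 0) T e \<and> chain R 0 T (\<lambda>U. c U - bd T e U)"
      using chain_singletons[of T d F]
      by (intro exI[of _ "\<lambda>U. d (the_elem U)"]) (simp add: chain_0_iff[OF fT] bd_singletons)
  qed
qed

text \<open>In the next three lemmas \<open>R \<le> Z \<le> A\<close> presents a short exact sequence
  \<open>0 \<rightarrow> Z/R \<rightarrow> A/R \<rightarrow> A/Z \<rightarrow> 0\<close>, and \<open>Z T \<inter> zdec R A T \<subseteq> zdec R Z T\<close>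
  says that \<open>H\<^sub>0(Z/R) \<rightarrow> H\<^sub>0(A/R)\<close> is injective at \<open>T\<close>.\<close>

lemma koszul_van_1_if:
  assumes AR: "fam N A R" and AZ: "fam N A Z" and ZR: "fam N Z R" and T: "T \<subseteq> {..<N}"
    and koszul_van: "koszul_van A R 1 T" and inj: "Z T \<inter> zdec R A T \<subseteq> zdec R Z T"
  shows "koszul_van A Z 1 T"
proof -
  interpret AR: fam N A R by fact
  interpret AZ: fam N A Z by fact
  interpret ZR: fam N Z R by fact
  note fT = AR.F.finite_sub[OF T]
  have RT: "is_subgrp (R T)" by (rule AR.R.sub[OF T])
  show ?thesis
    unfolding koszul_van_def
  proof (intro allI impI)
    fix c assume c: "chain A 1 T c" and cyc: "\<forall>q. 1 = Suc q \<longrightarrow> chain Z q T (bd T c)"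
    have "bd T c {} \<in> Z T" using cyc by (simp add: chain_0_iff[OF fT])
    moreover have "0 + bd T c {} \<in> zdec R A T"
      by (rule zdecI[of _ R T, OF is_subgrp_zero[OF RT] dec_chain[OF c]])
    ultimately have "bd T c {} \<in> zdec R Z T" using inj by auto
    then obtain x d where d: "x \<in> R T" "\<And>t. t \<in> T \<Longrightarrow> d t \<in> Z (T - {t})"
      "bd T c {} = x + (\<Sum>t\<in>T. d t)" by (elim zdecE) blast
    define d' where "d' = (\<lambda>U. d (the_elem U))"
    have d': "chain Z 1 T d'" unfolding d'_def by (rule chain_singletons) (rule d(2))
    have "chain A 1 T d'" by (rule chain_mono[OF d']) (use AZ.le T in auto)
    then have "chain A 1 T (\<lambda>U. c U - d' U)" by (rule AR.F.chain_diff[OF T c])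
    moreover have "chain R 0 T (bd T (\<lambda>U. c U - d' U))"
      using d by (simp add: chain_0_iff[OF fT] bd_diff bd_singletons d'_def)
    ultimately obtain e where e: "chain A (Suc 1) T e" "chain R 1 T (\<lambda>U. c U - d' U - bd T e U)"
      using koszul_van by (auto simp: koszul_van_def)
    have "chain Z 1 T (\<lambda>U. c U - d' U - bd T e U)" by (rule chain_mono[OF e(2)]) (use ZR.le T in auto)
    from AZ.R.chain_add[OF T d' this] have "chain Z 1 T (\<lambda>U. c U - bd T e U)"
      by (simp add: algebra_simps)
    with e(1) show "\<exists>e. chain A (Suc 1) T e \<and> chain Z 1 T (\<lambda>U. c U - bd T e U)" by blast
  qed
qed

lemma koszul_van_1_only_if:
  assumes AR: "fam N A R" and AZ: "fam N A Z" and ZR: "fam N Z R" and T: "T \<subseteq> {..<N}"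
    and koszul_van: "koszul_van A Z 1 T"
  shows "Z T \<inter> zdec R A T \<subseteq> zdec R Z T"
proof
  interpret AR: fam N A R by fact
  interpret AZ: fam N A Z by fact
  interpret ZR: fam N Z R by fact
  note fT = AR.F.finite_sub[OF T]
  fix y assume "y \<in> Z T \<inter> zdec R A T"
  then obtain x c where y: "y \<in> Z T" and x: "x \<in> R T"
    and c: "\<And>t. t \<in> T \<Longrightarrow> c t \<in> A (T - {t})" "y = x + (\<Sum>t\<in>T. c t)" by (auto elim!: zdecE)
  define c' where "c' = (\<lambda>U. c (the_elem U))"
  have bc: "bd T c' {} = (\<Sum>t\<in>T. c t)" by (simp add: c'_def bd_singletons)
  have "y - x \<in> Z T" using is_subgrp_diff[OF AZ.R.sub[OF T] y] ZR.le[OF T] x by auto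
  then have "chain Z 0 T (bd T c')" by (simp add: chain_0_iff[OF fT] bc c(2))
  moreover have "chain A 1 T c'" unfolding c'_def by (rule chain_singletons) (rule c(1))
  ultimately obtain e where e: "chain A (Suc 1) T e" "chain Z 1 T (\<lambda>U. c' U - bd T e U)"
    using koszul_van by (auto simp: koszul_van_def)
  have "x + bd T (\<lambda>U. c' U - bd T e U) {} \<in> zdec R Z T" by (rule zdecI[of _ R T, OF x dec_chain[OF e(2)]])
  then show "y \<in> zdec R Z T" by (simp add: bd_diff bd_bd[OF fT] bc c(2))
qed

lemma koszul_van_shift:
  assumes AR: "fam N A R" and AZ: "fam N A Z" and ZR: "fam N Z R" and T: "T \<subseteq> {..<N}"
    and koszul_van: "koszul_van A R (Suc q) T" and koszul_van': "koszul_van A Z (Suc (Suc q)) T"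
  shows "koszul_van Z R (Suc q) T"
  unfolding koszul_van_def
proof (intro allI impI)
  interpret AR: fam N A R by fact
  interpret AZ: fam N A Z by fact
  interpret ZR: fam N Z R by fact
  note fT = AR.F.finite_sub[OF T]
  fix c assume c: "chain Z (Suc q) T c" and cyc: "\<forall>q'. Suc q = Suc q' \<longrightarrow> chain R q' T (bd T c)"
  have "chain A (Suc q) T c" by (rule chain_mono[OF c]) (use AZ.le T in auto)
  then obtain e where e: "chain A (Suc (Suc q)) T e" "chain R (Suc q) T (\<lambda>U. c U - bd T e U)"
    using koszul_van cyc by (auto simp: koszul_van_def)
  have "chain Z (Suc q) T (\<lambda>U. c U - bd T e U)" by (rule chain_mono[OF e(2)]) (use ZR.le T in auto)
  from AZ.R.chain_diff[OF T c this] have "chain Z (Suc q) T (bd T e)" by simp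
  then obtain f where f: "chain A (Suc (Suc (Suc q))) T f"
    "chain Z (Suc (Suc q)) T (\<lambda>U. e U - bd T f U)"
    using koszul_van' e(1) by (auto simp: koszul_van_def)
  have "chain R (Suc q) T (\<lambda>U. c U - bd T (\<lambda>V. e V - bd T f V) U)"
    unfolding chain_def
  proof (intro allI impI)
    fix U assume U: "U \<subseteq> T" "card U = Suc q"
    show "c U - bd T (\<lambda>V. e V - bd T f V) U \<in> R (T - U)"
      using chainD[OF e(2) U] by (simp add: bd_diff bd_bd[OF fT U(1)])
  qed
  with f(2) show "\<exists>e. chain Z (Suc (Suc q)) T e \<and> chain R (Suc q) T (\<lambda>U. c U - bd T e U)" by blast
qed

section \<open>Isomorphisms, direct summands and free families\<close>

text \<open>\<open>\<phi>\<close> induces an isomorphism from \<open>F' / R'\<close> to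
  \<open>F / R\<close>: hypothesis \<open>R\<close> gives injectivity and \<open>surj\<close>
  surjectivity. Being one additive map for all \<open>S\<close>, it commutes with inclusions and
  hence with \<open>bd\<close>.\<close>

lemma koszul_van_pullback:
  assumes 1: "fam N F R" and 2: "fam N F' R'" and T: "T \<subseteq> {..<N}"
    and add: "\<And>x y. \<phi> (x + y) = \<phi> x + \<phi> y"
    and F: "\<And>S x. S \<subseteq> T \<Longrightarrow> x \<in> F' S \<Longrightarrow> \<phi> x \<in> F S"
    and R: "\<And>S x. S \<subseteq> T \<Longrightarrow> x \<in> F' S \<Longrightarrow> x \<in> R' S \<longleftrightarrow> \<phi> x \<in> R S"
    and surj: "\<And>S y. S \<subseteq> T \<Longrightarrow> y \<in> F S \<Longrightarrow> \<exists>x\<in>F' S. y - \<phi> x \<in> R S"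
    and koszul_van: "koszul_van F R p T"
  shows "koszul_van F' R' p T"
  unfolding koszul_van_def
proof (intro allI impI)
  interpret X: fam N F R by fact
  interpret Y: fam N F' R' by fact
  note fT = X.F.finite_sub[OF T]
  have zero: "\<phi> 0 = 0" using add[of 0 0] by simp
  have minus: "\<phi> (- x) = - \<phi> x" for x
    using add[of x "- x"] zero by (simp add: eq_neg_iff_add_eq_0 add.commute)
  have diff: "\<phi> (x - y) = \<phi> x - \<phi> y" for x y using add[of x "- y"] minus by simp
  have bd\<phi>: "\<phi> (bd T c U) = bd T (\<lambda>V. \<phi> (c V)) U" for c U
  proof -
    have "\<phi> (sum f I) = (\<Sum>i\<in>I. \<phi> (f i))" for f and I :: "nat set"
      by (induction I rule: infinite_finite_induct) (auto simp: zero add)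
    moreover have "\<phi> (osgn u V x) = osgn u V (\<phi> x)" for u V x by (simp add: osgn_def minus)
    ultimately show ?thesis by (simp add: bd_def)
  qed
  fix c assume c: "chain F' p T c" and cyc: "\<forall>q. p = Suc q \<longrightarrow> chain R' q T (bd T c)"
  have "chain F p T (\<lambda>U. \<phi> (c U))"
    unfolding chain_def by (intro allI impI F) (use chainD[OF c] in auto)
  moreover have "chain R q T (bd T (\<lambda>U. \<phi> (c U)))" if q: "p = Suc q" for q
    unfolding chain_def
  proof (intro allI impI)
    fix U assume U: "U \<subseteq> T" "card U = q"
    have "bd T c U \<in> F' (T - U)" by (rule chainD[OF Y.F.chain_bd[OF T c[unfolded q]] U])
    moreover have "bd T c U \<in> R' (T - U)" using cyc q chainD[OF _ U] by blast
    ultimately have "\<phi> (bd T c U) \<in> R (T - U)" using R[of "T - U" "bd T c U"] by auto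
    then show "bd T (\<lambda>V. \<phi> (c V)) U \<in> R (T - U)" by (simp add: bd\<phi>)
  qed
  ultimately obtain e where e: "chain F (Suc p) T e" "chain R p T (\<lambda>U. \<phi> (c U) - bd T e U)"
    using koszul_van by (auto simp: koszul_van_def)
  have "\<forall>U. \<exists>x. U \<subseteq> T \<and> card U = Suc p \<longrightarrow> x \<in> F' (T - U) \<and> e U - \<phi> x \<in> R (T - U)"
    using chainD[OF e(1)] surj[of "T - _" "e _"] by (metis Diff_subset)
  then obtain g where g: "\<And>U. U \<subseteq> T \<Longrightarrow> card U = Suc p \<Longrightarrow> g U \<in> F' (T - U) \<and> e U - \<phi> (g U) \<in> R (T - U)"
    by metis
  then have g1: "chain F' (Suc p) T g" and g2: "chain R (Suc p) T (\<lambda>U. e U - \<phi> (g U))"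
    by (auto simp: chain_def)
  have "chain R' p T (\<lambda>U. c U - bd T g U)"
    unfolding chain_def
  proof (intro allI impI)
    fix U assume U: "U \<subseteq> T" "card U = p"
    have TU: "T - U \<subseteq> T" "T - U \<subseteq> {..<N}" using T by auto
    have mem: "c U - bd T g U \<in> F' (T - U)"
      by (rule is_subgrp_diff[OF Y.F.sub[OF TU(2)] chainD[OF c U] chainD[OF Y.F.chain_bd[OF T g1] U]])
    have "\<phi> (c U - bd T g U) = (\<phi> (c U) - bd T e U) + bd T (\<lambda>V. e V - \<phi> (g V)) U"
      by (simp add: diff bd\<phi> bd_diff)
    also have "\<dots> \<in> R (T - U)"
      by (rule is_subgrp_add[OF X.R.sub[OF TU(2)] chainD[OF e(2) U] chainD[OF X.R.chain_bd[OF T g2] U]])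
    finally show "c U - bd T g U \<in> R' (T - U)" using R[OF TU(1) mem] by simp
  qed
  with g1 show "\<exists>e. chain F' (Suc p) T e \<and> chain R' p T (\<lambda>U. c U - bd T e U)" by blast
qed

text \<open>The maps \<open>\<sigma>\<close> kill \<open>R\<close> and are the identity modulo
  \<open>R\<close>, so they exhibit \<open>F / R\<close> as a direct summand of \<open>F\<close>.
  They turn a cycle modulo \<open>R\<close> into an honest cycle of \<open>F\<close> in the same
  class.\<close>

lemma koszul_van_retract:
  assumes 1: "fam N F R" and T: "T \<subseteq> {..<N}"
    and F: "\<And>S x. S \<subseteq> T \<Longrightarrow> x \<in> F S \<Longrightarrow> \<sigma> S x \<in> F S"
    and add: "\<And>S x y. S \<subseteq> T \<Longrightarrow> x \<in> F S \<Longrightarrow> y \<in> F S \<Longrightarrow> \<sigma> S (x + y) = \<sigma> S x + \<sigma> S y"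
    and nat: "\<And>S S' x. S' \<subseteq> S \<Longrightarrow> S \<subseteq> T \<Longrightarrow> x \<in> F S' \<Longrightarrow> \<sigma> S x = \<sigma> S' x"
    and R: "\<And>S x. S \<subseteq> T \<Longrightarrow> x \<in> R S \<Longrightarrow> \<sigma> S x = 0"
    and id: "\<And>S x. S \<subseteq> T \<Longrightarrow> x \<in> F S \<Longrightarrow> x - \<sigma> S x \<in> R S"
    and koszul_van: "koszul_van F (\<lambda>_. {0}) p T"
  shows "koszul_van F R p T"
  unfolding koszul_van_def
proof (intro allI impI)
  interpret fam N F R by fact
  note fT = F.finite_sub[OF T]
  have TU: "T - U \<subseteq> {..<N}" for U using T by auto
  have zero: "\<sigma> S 0 = 0" if "S \<subseteq> T" for S
    using R[OF that is_subgrp_zero[OF R.sub]] that T by blast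
  have minus: "\<sigma> S (- x) = - \<sigma> S x" if "S \<subseteq> T" "x \<in> F S" for S x
  proof -
    have "- x \<in> F S" using is_subgrp_minus[OF F.sub that(2)] that(1) T by auto
    from add[OF that this] zero[OF that(1)] show ?thesis
      by (simp add: eq_neg_iff_add_eq_0 add.commute)
  qed
  have osgn: "\<sigma> S (osgn u V x) = osgn u V (\<sigma> S x)" if "S \<subseteq> T" "x \<in> F S" for S x u V
    using minus[OF that] by (simp add: osgn_def)
  have sum: "\<sigma> S (sum f I) = (\<Sum>i\<in>I. \<sigma> S (f i))"
    if S: "S \<subseteq> T" and f: "\<And>i. i \<in> I \<Longrightarrow> f i \<in> F S" for S f and I :: "nat set"
    using f
  proof (induction I rule: infinite_finite_induct)
    case (insert i I)
    have "is_subgrp (F S)" by (rule F.sub) (use S T in auto)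
    then have "sum f I \<in> F S" by (rule is_subgrp_sum) (use insert.prems in auto)
    then show ?case using insert add[OF S] by simp
  qed (simp_all add: zero[OF S])
  fix c assume c: "chain F p T c" and cyc: "\<forall>q. p = Suc q \<longrightarrow> chain R q T (bd T c)"
  define c' where "c' = (\<lambda>U. \<sigma> (T - U) (c U))"
  have "chain F p T c'"
    unfolding chain_def c'_def by (intro allI impI F) (use chainD[OF c] in auto)
  moreover have "chain (\<lambda>_. {0}) q T (bd T c')" if q: "p = Suc q" for q
    unfolding chain_def
  proof (intro allI impI)
    fix U assume U: "U \<subseteq> T" "card U = q"
    have fU: "finite U" using U fT by (meson finite_subset)
    have mem: "c (insert u U) \<in> F (T - insert u U)" if "u \<in> T - U" for u
      by (rule chainD[OF c]) (use that U fU q in auto)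
    have mem': "c (insert u U) \<in> F (T - U)" if "u \<in> T - U" for u
      using mem[OF that] F.mono[of "T - insert u U" "T - U"] TU by blast
    have "bd T c' U = (\<Sum>u\<in>T - U. osgn u U (\<sigma> (T - U) (c (insert u U))))"
      unfolding bd_def c'_def
    proof (rule sum.cong)
      fix u assume "u \<in> T - U"
      then show "osgn u U (\<sigma> (T - insert u U) (c (insert u U)))
          = osgn u U (\<sigma> (T - U) (c (insert u U)))"
        using nat[of "T - insert u U" "T - U" "c (insert u U)", OF _ _ mem[of u]]
        by (simp add: subset_insertI Diff_mono)
    qed simp
    also have "\<dots> = \<sigma> (T - U) (bd T c U)"
    proof -
      have "\<sigma> (T - U) (\<Sum>u\<in>T - U. osgn u U (c (insert u U)))
          = (\<Sum>u\<in>T - U. \<sigma> (T - U) (osgn u U (c (insert u U))))"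
        by (rule sum) (use is_subgrp_osgn[OF F.sub[OF TU]] mem' in auto)
      also have "\<dots> = (\<Sum>u\<in>T - U. osgn u U (\<sigma> (T - U) (c (insert u U))))"
        by (rule sum.cong) (simp_all add: osgn mem')
      finally show ?thesis by (simp add: bd_def)
    qed
    also have "\<dots> = 0" using R[of "T - U"] cyc q chainD[OF _ U] by blast
    finally show "bd T c' U \<in> {0}" by simp
  qed
  ultimately obtain e where e: "chain F (Suc p) T e" "chain (\<lambda>_. {0}) p T (\<lambda>U. c' U - bd T e U)"
    using koszul_van by (auto simp: koszul_van_def)
  have "chain R p T (\<lambda>U. c U - bd T e U)"
    unfolding chain_def
  proof (intro allI impI)
    fix U assume U: "U \<subseteq> T" "card U = p"
    have "c U - c' U \<in> R (T - U)" unfolding c'_def by (rule id[OF _ chainD[OF c U]]) auto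
    moreover have "c' U = bd T e U" using chainD[OF e(2) U] by simp
    ultimately show "c U - bd T e U \<in> R (T - U)" by simp
  qed
  with e(1) show "\<exists>e. chain F (Suc p) T e \<and> chain R p T (\<lambda>U. c U - bd T e U)" by blast
qed

text \<open>On the part of a free family supported at a fixed basis element, the Koszul complex is
  that of a simplex, and coning off a vertex outside the support contracts it.\<close>

lemma bd_cone:
  assumes T: "finite T" "t \<in> T" and U: "U \<subseteq> T"
    and cyc: "t \<in> U \<Longrightarrow> bd T c (U - {t}) = 0"
  shows "bd T (\<lambda>U. if t \<in> U then osgn t (U - {t}) (c (U - {t})) else 0) U = c U"
proof -
  have fU: "finite U" using T U by (meson finite_subset)
  show ?thesis
  proof (cases "t \<in> U")
    case False
    have "bd T (\<lambda>U. if t \<in> U then osgn t (U - {t}) (c (U - {t})) else 0) U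
        = (\<Sum>u\<in>T - U. if u = t then c U else 0)"
      unfolding bd_def by (rule sum.cong) (use False in auto)
    also have "\<dots> = c U" using T False by simp
    finally show ?thesis .
  next
    case True
    define V where "V = U - {t}"
    have V: "finite V" "t \<notin> V" "insert t V = U" "T - V = insert t (T - U)"
      using fU True T by (auto simp: V_def)
    have "osgn u U (osgn t (insert u U - {t}) (c (insert u U - {t})))
        = - osgn t V (osgn u V (c (insert u V)))" if "u \<in> T - U" for u
    proof -
      have u: "u \<noteq> t" "u \<notin> V" using that True by (auto simp: V_def)
      have "insert u U - {t} = insert u V" using u by (auto simp: V_def)
      moreover have "osgn u U (osgn t (insert u V) (c (insert u V)))
          = - osgn t V (osgn u V (c (insert u V)))"
        using u(1)
        by (cases "t < u") (simp_all add: osgn_insert[OF V(1,2), of u, unfolded V(3)]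
            osgn_insert[OF V(1) u(2), of t] osgn_minus osgn_commute[of u V t V])
      ultimately show ?thesis by simp
    qed
    then have "bd T (\<lambda>U. if t \<in> U then osgn t (U - {t}) (c (U - {t})) else 0) U
        = (\<Sum>u\<in>T - U. - osgn t V (osgn u V (c (insert u V))))"
      unfolding bd_def by (intro sum.cong) (use True in auto)
    also have "\<dots> = - osgn t V (\<Sum>u\<in>T - U. osgn u V (c (insert u V)))"
      by (simp add: osgn_sum sum_negf)
    also have "(\<Sum>u\<in>T - U. osgn u V (c (insert u V))) = bd T c V - osgn t V (c U)"
      using T True by (simp add: bd_def V)
    also have "bd T c V = 0" using cyc[OF True] by (simp add: V_def)
    finally show ?thesis by (simp add: osgn_minus)
  qed
qed

text \<open>The coefficients of a chain at a basis element \<open>b\<close> live on the subsets of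
  \<open>T - supp b\<close>, and the cone is taken from the least vertex \<open>v b\<close> of that
  set. In positive degree a nonzero coefficient forces the set to be nonempty.\<close>

lemma koszul_van_free:
  fixes supp :: "'b \<Rightarrow> nat set"
  assumes T: "finite T" and p: "0 < p"
  shows "koszul_van (\<lambda>T. {x. Poly_Mapping.keys x \<subseteq> {b \<in> B. supp b \<subseteq> T}}) (\<lambda>_. {0 :: 'b \<Rightarrow>\<^sub>0 int}) p T"
    (is "koszul_van ?F ?R p T")
  unfolding koszul_van_def
proof (intro allI impI)
  fix c assume c: "chain ?F p T c" and cyc: "\<forall>q. p = Suc q \<longrightarrow> chain ?R q T (bd T c)"
  obtain q where q: "p = Suc q" using p by (cases p) auto
  define v where "v b = Min (T - supp b)" for b
  define part :: "nat \<Rightarrow> ('b \<Rightarrow>\<^sub>0 int) \<Rightarrow> ('b \<Rightarrow>\<^sub>0 int)"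
    where "part t x = Poly_Mapping.mapp (\<lambda>b i. if v b = t then i else 0) x" for t x
  have lookup_part: "poly_mapping.lookup (part t x) b = (if v b = t then poly_mapping.lookup x b else 0)" for t x b
    by (auto simp: part_def lookup_mapp in_keys_iff when_def)
  \<comment> \<open>The apex depends on \<open>b\<close>, so the cone is assembled as a finite sum
    over the possible apexes, which keeps the support finite.\<close>
  define e where "e = (\<lambda>U. \<Sum>t\<in>U. osgn t (U - {t}) (part t (c (U - {t}))))"
  have lookup_osgn: "poly_mapping.lookup (osgn u U x) b = osgn u U (poly_mapping.lookup x b)"
    for u U b and x :: "'b \<Rightarrow>\<^sub>0 int" by (simp add: osgn_def)
  have lookup_bd: "poly_mapping.lookup (bd T c U) b = bd T (\<lambda>U. poly_mapping.lookup (c U) b) U"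
    for U b and c :: "nat set \<Rightarrow> 'b \<Rightarrow>\<^sub>0 int" by (simp add: bd_def lookup_sum lookup_osgn)
  have lookup_e: "poly_mapping.lookup (e U) b = (if v b \<in> U
      then osgn (v b) (U - {v b}) (poly_mapping.lookup (c (U - {v b})) b) else 0)"
    if "finite U" for U b
  proof -
    have "poly_mapping.lookup (e U) b = (\<Sum>t\<in>U. if t = v b
        then osgn t (U - {t}) (poly_mapping.lookup (c (U - {t})) b) else 0)"
      unfolding e_def lookup_sum by (rule sum.cong) (auto simp: lookup_osgn lookup_part)
    then show ?thesis using that by simp
  qed
  have fin: "finite U" if "U \<subseteq> T" for U using T that by (rule rev_finite_subset)
  have supp: "b \<in> B \<and> supp b \<subseteq> T - U" if "U \<subseteq> T" "card U = p" "poly_mapping.lookup (c U) b \<noteq> 0" for U b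
    using chainD[OF c that(1,2)] that(3) by (auto simp: in_keys_iff)
  have vb: "v b \<in> T - supp b" if "supp b \<subseteq> T - U" "U \<subseteq> T" "card U = p" for U b
  proof -
    have "U \<noteq> {}" using that(3) p by auto
    then have "T - supp b \<noteq> {}" using that(1,2) by auto
    from Min_in[OF _ this] show ?thesis using T by (simp add: v_def)
  qed
  have "chain ?F (Suc p) T e"
    unfolding chain_def
  proof (intro allI impI CollectI subsetI)
    fix U b assume U: "U \<subseteq> T" "card U = Suc p" and b: "b \<in> Poly_Mapping.keys (e U)"
    have "v b \<in> U" "poly_mapping.lookup (c (U - {v b})) b \<noteq> 0"
    proof -
      have "poly_mapping.lookup (e U) b \<noteq> 0" using b by (simp add: in_keys_iff)
      then show "v b \<in> U" "poly_mapping.lookup (c (U - {v b})) b \<noteq> 0"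
        by (auto simp: lookup_e[OF fin[OF U(1)]] simp del: lookup_not_eq_zero_eq_in_keys split: if_split_asm)
    qed
    moreover from this have "card (U - {v b}) = p" using U fin[OF U(1)] by simp
    ultimately have "b \<in> B" "supp b \<subseteq> T - (U - {v b})" "v b \<notin> supp b"
      using supp[of "U - {v b}" b] vb[of b "U - {v b}"] U(1) by auto
    then show "b \<in> B \<and> supp b \<subseteq> T - U" by auto
  qed
  moreover have "chain ?R p T (\<lambda>U. c U - bd T e U)"
    unfolding chain_def
  proof (intro allI impI)
    fix U assume U: "U \<subseteq> T" "card U = p"
    have "bd T e U = c U"
    proof (rule poly_mapping_eqI)
      fix b
      define \<gamma> where "\<gamma> = (\<lambda>V. poly_mapping.lookup (c V) b)"
      define \<eta> where "\<eta> = (\<lambda>V. if v b \<in> V then osgn (v b) (V - {v b}) (\<gamma> (V - {v b})) else 0)"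
      have "poly_mapping.lookup (bd T e U) b = bd T \<eta> U"
        unfolding lookup_bd by (rule bd_cong[OF T U(1)]) (simp add: lookup_e fin \<eta>_def \<gamma>_def)
      also have "\<dots> = \<gamma> U"
      \<comment> \<open>If all coefficients at \<open>b\<close> are zero, \<open>v b\<close> may be
        the minimum of the empty set, so this case is treated apart; both sides are then
        zero.\<close>
      proof (cases "\<exists>V. V \<subseteq> T \<and> card V = p \<and> \<gamma> V \<noteq> 0")
        case True
        then obtain V where "V \<subseteq> T" "card V = p" "\<gamma> V \<noteq> 0" by blast
        then have t: "v b \<in> T" using supp[of V b] vb[of b V] by (simp add: \<gamma>_def)
        show ?thesis
          unfolding \<eta>_def
        proof (rule bd_cone[OF T t U(1)])
          assume "v b \<in> U"
          then have "card (U - {v b}) = q" using U q fin[OF U(1)] by simp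
          moreover have "chain ?R q T (bd T c)" "U - {v b} \<subseteq> T" using cyc q U(1) by auto
          ultimately have "bd T c (U - {v b}) = 0" using chainD by blast
          then show "bd T \<gamma> (U - {v b}) = 0" unfolding \<gamma>_def by (simp flip: lookup_bd)
        qed
      next
        case False
        have "bd T \<eta> U = bd T (\<lambda>_. 0) U"
        proof (rule bd_cong[OF T U(1)])
          fix V assume V: "V \<subseteq> T" "card V = Suc (card U)"
          show "\<eta> V = 0"
          proof (cases "v b \<in> V")
            case True
            then have "V - {v b} \<subseteq> T" "card (V - {v b}) = p" using V U fin[OF V(1)] by auto
            then have "\<gamma> (V - {v b}) = 0" using False by blast
            then show ?thesis by (simp add: \<eta>_def)
          qed (simp add: \<eta>_def)
        qed
        then show ?thesis using False U by auto
      qed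
      finally show "poly_mapping.lookup (bd T e U) b = poly_mapping.lookup (c U) b" by (simp add: \<gamma>_def)
    qed
    then show "c U - bd T e U \<in> ?R (T - U)" by simp
  qed
  ultimately show "\<exists>e. chain ?F (Suc p) T e \<and> chain ?R p T (\<lambda>U. c U - bd T e U)" by blast
qed

section \<open>Presentations of FI-modules by free covers\<close>

definition fc :: "'a fi_functor \<Rightarrow> nat set \<Rightarrow> ((nat set \<times> 'a \<times> (nat \<Rightarrow> nat)) \<Rightarrow>\<^sub>0 int) set" where
  "fc V T = {x. Poly_Mapping.keys x \<subseteq> fc_basis V T}"

text \<open>The map \<open>push h\<close> realizes all structure maps of the free cover that are restrictions of \<open>h\<close>;
  it is the identity when \<open>h\<close> restricts to an inclusion, so that inclusions of finite sets act
  on the free cover as inclusions of subgroups of one fixed group.\<close>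

definition push :: "(nat \<Rightarrow> nat) \<Rightarrow> ((nat set \<times> 'a \<times> (nat \<Rightarrow> nat)) \<Rightarrow>\<^sub>0 int)
    \<Rightarrow> ((nat set \<times> 'a \<times> (nat \<Rightarrow> nat)) \<Rightarrow>\<^sub>0 int)" where
  "push h = frag_extend (\<lambda>b. frag_of (fc_push h b))"

text \<open>The target of \<open>\<theta>\<close> may differ from the covered module:
  \<open>fc V\<close> modulo this kernel presents the image of \<open>\<theta>\<close>, which yields
  modules and images of differentials alike.\<close>

definition fker :: "'a fi_functor \<Rightarrow> 'b fi_functor
    \<Rightarrow> ((nat set \<times> 'a \<times> (nat \<Rightarrow> nat)) \<Rightarrow>\<^sub>0 int, 'b) fi_nat_trans
    \<Rightarrow> nat set \<Rightarrow> ((nat set \<times> 'a \<times> (nat \<Rightarrow> nat)) \<Rightarrow>\<^sub>0 int) set" where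
  "fker V W \<theta> T = {x \<in> fc V T. \<theta> T x = \<one>\<^bsub>ob W T\<^esub>}"

lemma fc_carrier: "fc V T = carrier (ob (free_cover V) T)"
  by (auto simp: fc_def free_cover_def)

lemma mp_free_cover: "mp (free_cover V) S T g = push g"
  by (simp add: push_def free_cover_def)

text \<open>Extensional injections do not record their codomain, so the bases at all
  \<open>T\<close> lie in one set and are cut out by a support condition; this is the form that
  \<open>koszul_van_free\<close> asks for.\<close>

lemma fc_basis_supp:
  "fc_basis V T = {b \<in> fc_basis V UNIV. snd (snd b) ` fst b \<subseteq> T}"
  by (auto simp: fc_basis_def FI_hom_def PiE_iff)

lemma fc_mono: "S \<subseteq> T \<Longrightarrow> fc V S \<subseteq> fc V T"
  unfolding fc_def fc_basis_supp[of V S] fc_basis_supp[of V T] by blast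

lemma is_subgrp_fc: "is_subgrp (fc V T)"
  using keys_diff by (fastforce simp: is_subgrp_def fc_def)

lemma filt_fc: "filt N (fc V)"
  by unfold_locales (use is_subgrp_fc fc_mono in blast)+

lemma fc_frag_of [simp]: "frag_of b \<in> fc V T \<longleftrightarrow> b \<in> fc_basis V T"
  by (simp add: fc_def)

lemma fc_induct [consumes 1, case_names zero one diff]:
  assumes "x \<in> fc V T" and "P 0" and "\<And>b. b \<in> fc_basis V T \<Longrightarrow> P (frag_of b)"
    and "\<And>x y. x \<in> fc V T \<Longrightarrow> y \<in> fc V T \<Longrightarrow> P x \<Longrightarrow> P y \<Longrightarrow> P (x - y)"
  shows "P x"
proof -
  have "x \<in> fc V T \<and> P x"
    using assms(1)[unfolded fc_def mem_Collect_eq]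
    by (induction x rule: frag_induction)
      (auto intro: assms is_subgrp_zero[OF is_subgrp_fc] is_subgrp_diff[OF is_subgrp_fc])
  then show ?thesis ..
qed

lemma push_zero [simp]: "push h 0 = 0"
  by (simp add: push_def)

lemma push_add: "push h (x + y) = push h x + push h y"
  by (simp add: push_def frag_extend_add)

lemma push_diff: "push h (x - y) = push h x - push h y"
  by (simp add: push_def frag_extend_diff)

lemma push_sum: "push h (sum f I) = (\<Sum>i\<in>I. push h (f i))"
  by (induction I rule: infinite_finite_induct) (auto simp: push_add)

lemma push_frag_of [simp]: "push h (frag_of b) = frag_of (fc_push h b)"
  by (simp add: push_def)

lemma fc_push_cong:
  assumes "b \<in> fc_basis V T" "\<And>i. i \<in> T \<Longrightarrow> g i = h i"
  shows "fc_push g b = fc_push h b"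
  using assms by (auto simp: fc_basis_def fc_push_def FI_hom_def compose_def PiE_iff fun_eq_iff)

lemma fc_push_id:
  assumes "b \<in> fc_basis V T" "\<And>i. i \<in> T \<Longrightarrow> h i = i"
  shows "fc_push h b = b"
  using assms by (auto simp: fc_basis_def fc_push_def FI_hom_def compose_def PiE_iff extensional_def fun_eq_iff)

lemma push_cong:
  assumes "x \<in> fc V T" "\<And>i. i \<in> T \<Longrightarrow> g i = h i"
  shows "push g x = push h x"
  using assms(1)
  by (induction x rule: fc_induct) (simp_all add: push_diff fc_push_cong[OF _ assms(2)])

lemma push_id:
  assumes "x \<in> fc V T" "\<And>i. i \<in> T \<Longrightarrow> h i = i"
  shows "push h x = x"
  using assms(1)
  by (induction x rule: fc_induct) (simp_all add: push_diff fc_push_id[OF _ assms(2)])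

lemma push_inverse:
  assumes "x \<in> fc V T" "\<And>i. i \<in> T \<Longrightarrow> g (h i) = i"
  shows "push g (push h x) = x"
  using assms(1)
proof (induction x rule: fc_induct)
  case (one b)
  have "fc_push g (fc_push h b) = b"
    using one assms(2)
    by (auto simp: fc_basis_def fc_push_def FI_hom_def compose_def PiE_iff extensional_def fun_eq_iff)
  then show ?case by simp
qed (simp_all add: push_diff)

lemma restrict_FI_hom: "inj_on h T \<Longrightarrow> restrict h T \<in> FI_hom T (h ` T)"
  by (auto simp: FI_hom_def inj_on_def)

lemma push_FI: "\<lbrakk>x \<in> fc V S; g \<in> FI_hom S T\<rbrakk> \<Longrightarrow> push g x \<in> fc V T"
  by (induction x rule: fc_induct)
    (auto simp: push_diff fc_push_basis intro: is_subgrp_zero[OF is_subgrp_fc] is_subgrp_diff[OF is_subgrp_fc])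

lemma push_fc: "\<lbrakk>x \<in> fc V T; inj_on h T\<rbrakk> \<Longrightarrow> push h x \<in> fc V (h ` T)"
  using push_FI[OF _ restrict_FI_hom] push_cong[of x V T h "restrict h T"] by fastforce

section \<open>Kernels of maps out of a free cover\<close>

locale fi_map =
  fixes V :: "'a fi_functor" and W :: "'b fi_functor" and \<theta>
  assumes W: "fi_module W" and \<theta>: "\<theta> \<in> fi_hom (free_cover V) W"
begin

lemma grp: "finite T \<Longrightarrow> comm_group (ob W T)"
  by (rule fi_module.ob_comm_group[OF W])

lemma \<theta>_hom: "finite T \<Longrightarrow> group_hom (free_Abelian_group (fc_basis V T)) (ob W T) (\<theta> T)"
  using \<theta> grp[of T]
  by (auto simp: group_hom_def group_hom_axioms_def fi_hom_def free_cover_def comm_group_def)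

lemma \<theta>_closed: "finite T \<Longrightarrow> x \<in> fc V T \<Longrightarrow> \<theta> T x \<in> carrier (ob W T)"
  using group_hom.hom_closed[OF \<theta>_hom] by (simp add: fc_def)

lemma \<theta>_zero: "finite T \<Longrightarrow> \<theta> T 0 = \<one>\<^bsub>ob W T\<^esub>"
  using group_hom.hom_one[OF \<theta>_hom] by simp

lemma \<theta>_add: "\<lbrakk>finite T; x \<in> fc V T; y \<in> fc V T\<rbrakk> \<Longrightarrow> \<theta> T (x + y) = \<theta> T x \<otimes>\<^bsub>ob W T\<^esub> \<theta> T y"
  using group_hom.hom_mult[OF \<theta>_hom] by (simp add: fc_def)

lemma \<theta>_diff:
  assumes T: "finite T" and x: "x \<in> fc V T" and y: "y \<in> fc V T"
  shows "\<theta> T (x - y) = \<theta> T x \<otimes>\<^bsub>ob W T\<^esub> inv\<^bsub>ob W T\<^esub> \<theta> T y"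
proof -
  have "- y \<in> fc V T" by (rule is_subgrp_minus[OF is_subgrp_fc y])
  moreover have "\<theta> T (- y) = inv\<^bsub>ob W T\<^esub> \<theta> T y"
    using group_hom.hom_inv[OF \<theta>_hom[OF T], of y] y by (simp add: fc_def)
  ultimately show ?thesis using \<theta>_add[OF T x, of "- y"] by simp
qed

lemma \<theta>_eq_iff:
  assumes T: "finite T" and x: "x \<in> fc V T" and y: "y \<in> fc V T"
  shows "\<theta> T x = \<theta> T y \<longleftrightarrow> x - y \<in> fker V W \<theta> T"
proof -
  interpret G: comm_group "ob W T" by (rule grp[OF T])
  have "x - y \<in> fc V T" by (rule is_subgrp_diff[OF is_subgrp_fc x y])
  then show ?thesis
    using \<theta>_diff[OF T x y] \<theta>_closed[OF T x] \<theta>_closed[OF T y] G.inv_equality[of "\<theta> T x" "inv\<^bsub>ob W T\<^esub> \<theta> T y"]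
    by (auto simp: fker_def)
qed

lemma \<theta>_mp:
  "\<lbrakk>finite S; finite T; g \<in> FI_hom S T; x \<in> fc V S\<rbrakk> \<Longrightarrow> \<theta> T (push g x) = mp W S T g (\<theta> S x)"
  using \<theta> unfolding fi_hom_def mp_free_cover fc_carrier by blast

lemma incl_FI_hom: "S \<subseteq> T \<Longrightarrow> (\<lambda>i\<in>S. i) \<in> FI_hom S T"
  by (auto simp: FI_hom_def inj_on_def)

lemma \<theta>_incl:
  assumes "finite T" "S \<subseteq> T" "x \<in> fc V S"
  shows "\<theta> T x = mp W S T (\<lambda>i\<in>S. i) (\<theta> S x)"
  using \<theta>_mp[OF finite_subset[OF assms(2,1)] assms(1) incl_FI_hom[OF assms(2)] assms(3)]
    push_id[OF assms(3), of "\<lambda>i\<in>S. i"] by simp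

lemma mp_one:
  assumes "finite S" "finite T" "g \<in> FI_hom S T"
  shows "mp W S T g \<one>\<^bsub>ob W S\<^esub> = \<one>\<^bsub>ob W T\<^esub>"
  using hom_one[OF fi_module.mp_hom[OF W assms]] grp[OF assms(1)] grp[OF assms(2)]
  by (simp add: comm_group_def)

lemma fker_push:
  assumes T: "finite T" and h: "inj_on h T" and x: "x \<in> fker V W \<theta> T"
  shows "push h x \<in> fker V W \<theta> (h ` T)"
proof -
  have x': "x \<in> fc V T" "\<theta> T x = \<one>\<^bsub>ob W T\<^esub>" using x by (auto simp: fker_def)
  have "push (restrict h T) x = push h x" by (rule push_cong[OF x'(1)]) simp
  then have "\<theta> (h ` T) (push h x) = \<one>\<^bsub>ob W (h ` T)\<^esub>"
    using \<theta>_mp[OF T finite_imageI[OF T] restrict_FI_hom[OF h] x'(1)]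
      mp_one[OF T finite_imageI[OF T] restrict_FI_hom[OF h]] x'(2) by simp
  then show ?thesis using push_fc[OF x'(1) h] by (simp add: fker_def)
qed

lemma fker_mono:
  assumes "S \<subseteq> T" "finite T"
  shows "fker V W \<theta> S \<subseteq> fker V W \<theta> T"
proof
  fix x assume "x \<in> fker V W \<theta> S"
  then have x: "x \<in> fc V S" "\<theta> S x = \<one>\<^bsub>ob W S\<^esub>" by (auto simp: fker_def)
  have "\<theta> T x = \<one>\<^bsub>ob W T\<^esub>"
    using \<theta>_incl[OF assms(2,1) x(1)] x(2)
      mp_one[OF finite_subset[OF assms] assms(2) incl_FI_hom[OF assms(1)]] by simp
  then show "x \<in> fker V W \<theta> T" using fc_mono[OF assms(1)] x(1) by (auto simp: fker_def)
qed

lemma is_subgrp_fker: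
  assumes T: "finite T"
  shows "is_subgrp (fker V W \<theta> T)"
  unfolding is_subgrp_def
proof (intro conjI ballI)
  interpret G: comm_group "ob W T" by (rule grp[OF T])
  show "0 \<in> fker V W \<theta> T"
    using \<theta>_zero[OF T] is_subgrp_zero[OF is_subgrp_fc] by (simp add: fker_def)
  fix x y assume "x \<in> fker V W \<theta> T" "y \<in> fker V W \<theta> T"
  then show "x - y \<in> fker V W \<theta> T"
    using \<theta>_diff[OF T] is_subgrp_diff[OF is_subgrp_fc] by (auto simp: fker_def)
qed

lemma filt_fker: "filt N (fker V W \<theta>)"
proof
  fix S T :: "nat set" assume T: "T \<subseteq> {..<N}"
  then have "finite T" by (meson finite_lessThan finite_subset)
  then show "is_subgrp (fker V W \<theta> T)" "S \<subseteq> T \<Longrightarrow> fker V W \<theta> S \<subseteq> fker V W \<theta> T"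
    using is_subgrp_fker fker_mono by auto
qed

lemma fam_fker: "fam N (fc V) (fker V W \<theta>)"
  by (intro fam.intro filt_fc filt_fker fam_axioms.intro) (auto simp: fker_def)

text \<open>\<open>id(i := j)\<close> is injective on \<open>insert i T\<close> because
  \<open>j\<close> is not in \<open>T\<close>, and it is the identity on \<open>T\<close> because
  \<open>i\<close> is not.\<close>

lemma sym_fam_fker: "sym_fam N (fc V) (fker V W \<theta>) (\<lambda>i j. push (id(i := j)))"
proof (intro sym_fam.intro fam_fker sym_fam_axioms.intro)
  fix i j :: nat and x :: "(nat set \<times> 'a \<times> (nat \<Rightarrow> nat)) \<Rightarrow>\<^sub>0 int" and T
  assume T: "T \<subseteq> {..<N}" and ij: "i \<notin> T" "j \<notin> T"
  have fT: "finite (insert i T)" using T by (meson finite_insert finite_lessThan finite_subset)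
  have inj: "inj_on (id(i := j)) (insert i T)" using ij by (auto simp: inj_on_def)
  have im: "id(i := j) ` insert i T = insert j T" using ij by auto
  show "push (id(i := j)) x \<in> fc V (insert j T)" if "x \<in> fc V (insert i T)"
    using push_fc[OF that inj] unfolding im .
  show "push (id(i := j)) x \<in> fker V W \<theta> (insert j T)" if "x \<in> fker V W \<theta> (insert i T)"
    using fker_push[OF fT inj that] unfolding im .
  show "push (id(i := j)) x = x" if "x \<in> fc V T"
    by (rule push_id[OF that]) (use ij in auto)
qed (rule push_add)

lemma \<theta>_image_subgroup:
  assumes T: "finite T" and A: "is_subgrp A" "A \<subseteq> fc V T"
  shows "subgroup (\<theta> T ` A) (ob W T)"
proof -
  interpret G: comm_group "ob W T" by (rule grp[OF T])
  show ?thesis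
  proof (rule G.subgroupI)
    show "\<theta> T ` A \<subseteq> carrier (ob W T)" using \<theta>_closed[OF T] A(2) by auto
    show "\<theta> T ` A \<noteq> {}" using is_subgrp_zero[OF A(1)] by auto
    fix u assume "u \<in> \<theta> T ` A"
    then obtain x where x: "x \<in> A" "u = \<theta> T x" by auto
    have "0 \<in> fc V T" "x \<in> fc V T" using is_subgrp_zero[OF A(1)] x A(2) by auto
    then have "inv\<^bsub>ob W T\<^esub> u = \<theta> T (0 - x)"
      using \<theta>_diff[OF T, of 0 x] \<theta>_zero[OF T] \<theta>_closed[OF T, of x] x(2) by simp
    then show "inv\<^bsub>ob W T\<^esub> u \<in> \<theta> T ` A" using is_subgrp_minus[OF A(1) x(1)] by simp
    fix v assume "v \<in> \<theta> T ` A"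
    then obtain y where y: "y \<in> A" "v = \<theta> T y" by auto
    then have "u \<otimes>\<^bsub>ob W T\<^esub> v = \<theta> T (x + y)"
      using \<theta>_add[OF T, of x y] x A(2) by (metis subsetD)
    then show "u \<otimes>\<^bsub>ob W T\<^esub> v \<in> \<theta> T ` A" using is_subgrp_add[OF A(1) x(1) y(1)] by auto
  qed
qed

text \<open>An injection from a smaller set misses some point \<open>t\<close>, so whatever it
  reaches comes from \<open>T - {t}\<close>; conversely the inclusions of the sets
  \<open>T - {t}\<close> are among the generating maps.\<close>

lemma H0_span_eq:
  assumes surj: "\<forall>S. finite S \<longrightarrow> \<theta> S ` fc V S = carrier (ob W S)" and T: "finite T"
  shows "H0_span W T = \<theta> T ` decomposables (fc V) T"
proof -
  interpret G: comm_group "ob W T" by (rule grp[OF T])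
  obtain N where N: "T \<subseteq> {..<N}" using T finite_nat_iff_bounded by blast
  interpret F: filt N "fc V" by (rule filt_fc)
  let ?gens = "\<Union>{mp W S T f ` carrier (ob W S) | S f. finite S \<and> f \<in> FI_hom S T \<and> card S < card T}"
  have sub: "subgroup (\<theta> T ` decomposables (fc V) T) (ob W T)"
    by (rule \<theta>_image_subgroup[OF T F.is_subgrp_dec[OF N] F.dec_subset[OF N]])
  have "?gens \<subseteq> \<theta> T ` decomposables (fc V) T"
  proof
    fix u assume "u \<in> ?gens"
    then obtain S f w where f: "finite S" "f \<in> FI_hom S T" "card S < card T"
      and w: "w \<in> carrier (ob W S)" "u = mp W S T f w" by blast
    obtain x where x: "x \<in> fc V S" "w = \<theta> S x" using surj f(1) w(1) by blast
    have "f ` S \<noteq> T" using f(3) card_image_le[OF f(1), of f] by auto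
    moreover have "f ` S \<subseteq> T" using f(2) by (auto simp: FI_hom_def)
    ultimately obtain t where t: "t \<in> T" "f ` S \<subseteq> T - {t}" by blast
    have "inj_on f S" using f(2) by (simp add: FI_hom_def)
    from push_fc[OF x(1) this] have "push f x \<in> fc V (T - {t})" using fc_mono[OF t(2)] by blast
    then have "push f x \<in> decomposables (fc V) T" by (rule F.dec_mem[OF N _ t(1)])
    moreover have "u = \<theta> T (push f x)" using \<theta>_mp[OF f(1) T f(2) x(1)] x(2) w(2) by simp
    ultimately show "u \<in> \<theta> T ` decomposables (fc V) T" by blast
  qed
  then have 1: "H0_span W T \<subseteq> \<theta> T ` decomposables (fc V) T"
    unfolding H0_span_def by (rule G.generate_subgroup_incl[OF _ sub])
  have "?gens \<subseteq> carrier (ob W T)"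
    using fi_module.mp_hom[OF W _ T] by (fastforce simp: hom_def)
  from G.generate_is_subgroup[OF this] have gen: "subgroup (H0_span W T) (ob W T)"
    unfolding H0_span_def .
  have "\<theta> T (\<Sum>t\<in>I. c t) \<in> H0_span W T"
    if "I \<subseteq> T" "\<And>t. t \<in> I \<Longrightarrow> c t \<in> fc V (T - {t})" for I c
    using finite_subset[OF that(1) T] that
  proof (induction I rule: finite_induct)
    case empty
    then show ?case using \<theta>_zero[OF T] subgroup.one_closed[OF gen] by simp
  next
    case (insert t I)
    have c: "c s \<in> fc V T" if "s \<in> insert t I" for s
      using insert.prems(2)[OF that] fc_mono[of "T - {s}" T] by auto
    have "\<theta> T (c t) = mp W (T - {t}) T (\<lambda>i\<in>T - {t}. i) (\<theta> (T - {t}) (c t))"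
      by (rule \<theta>_incl[OF T]) (use insert.prems in auto)
    also have "\<dots> \<in> ?gens"
    proof -
      have "card (T - {t}) < card T" using T insert.prems(1) by (intro card_Diff1_less) auto
      moreover have "\<theta> (T - {t}) (c t) \<in> carrier (ob W (T - {t}))"
        by (rule \<theta>_closed) (use T insert.prems in auto)
      ultimately show ?thesis using T incl_FI_hom[of "T - {t}" T] by blast
    qed
    finally have 2: "\<theta> T (c t) \<in> H0_span W T" unfolding H0_span_def by (rule generate.incl)
    have "(\<Sum>t\<in>I. c t) \<in> fc V T" by (rule is_subgrp_sum[OF is_subgrp_fc]) (use c in auto)
    then have "\<theta> T (\<Sum>t\<in>insert t I. c t) = \<theta> T (c t) \<otimes>\<^bsub>ob W T\<^esub> \<theta> T (\<Sum>t\<in>I. c t)"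
      using \<theta>_add[OF T, of "c t"] c insert.hyps by simp
    then show ?case using subgroup.m_closed[OF gen 2] insert by auto
  qed
  then have "\<theta> T ` decomposables (fc V) T \<subseteq> H0_span W T"
    by (auto elim!: decE)
  with 1 show ?thesis by blast
qed

lemma H0_span_subgroup:
  assumes surj: "\<forall>S. finite S \<longrightarrow> \<theta> S ` fc V S = carrier (ob W S)" and T: "finite T"
  shows "subgroup (H0_span W T) (ob W T)"
proof -
  obtain N where N: "T \<subseteq> {..<N}" using T finite_nat_iff_bounded by blast
  interpret F: filt N "fc V" by (rule filt_fc)
  show ?thesis
    unfolding H0_span_eq[OF surj T]
    by (rule \<theta>_image_subgroup[OF T F.is_subgrp_dec[OF N] F.dec_subset[OF N]])
qed

lemma mem_H0_span_iff:
  assumes surj: "\<forall>S. finite S \<longrightarrow> \<theta> S ` fc V S = carrier (ob W S)" and T: "finite T" and x: "x \<in> fc V T"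
  shows "\<theta> T x \<in> H0_span W T \<longleftrightarrow> x \<in> zdec (fker V W \<theta>) (fc V) T"
proof -
  obtain N where N: "T \<subseteq> {..<N}" using T finite_nat_iff_bounded by blast
  interpret F: filt N "fc V" by (rule filt_fc)
  note decomposables = F.dec_subset[OF N]
  have "\<theta> T x \<in> H0_span W T \<longleftrightarrow> (\<exists>y\<in>decomposables (fc V) T. x - y \<in> fker V W \<theta> T)"
    unfolding H0_span_eq[OF surj T] using \<theta>_eq_iff[OF T x] decomposables by blast
  also have "\<dots> \<longleftrightarrow> x \<in> zdec (fker V W \<theta>) (fc V) T"
  proof
    assume "\<exists>y\<in>decomposables (fc V) T. x - y \<in> fker V W \<theta> T"
    then obtain y where "x - y \<in> fker V W \<theta> T" "y \<in> decomposables (fc V) T" by blast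
    then have "(x - y) + y \<in> zdec (fker V W \<theta>) (fc V) T" by (rule zdecI[of _ "fker V W \<theta>"])
    then show "x \<in> zdec (fker V W \<theta>) (fc V) T" by simp
  next
    assume "x \<in> zdec (fker V W \<theta>) (fc V) T"
    then obtain r y where "x = r + y" "r \<in> fker V W \<theta> T" "y \<in> decomposables (fc V) T" by (auto simp: zdec_def)
    then show "\<exists>y\<in>decomposables (fc V) T. x - y \<in> fker V W \<theta> T" by (intro bexI[of _ y]) simp_all
  qed
  finally show ?thesis .
qed

end

section \<open>Invariance under relabelling of finite sets\<close>

definition push_closed :: "(nat set \<Rightarrow> ((nat set \<times> 'a \<times> (nat \<Rightarrow> nat)) \<Rightarrow>\<^sub>0 int) set) \<Rightarrow> bool" where
  "push_closed F \<longleftrightarrow> (\<forall>T h x. finite T \<longrightarrow> inj_on h T \<longrightarrow> x \<in> F T \<longrightarrow> push h x \<in> F (h ` T))"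

lemma push_closed_fc: "push_closed (fc V)"
  by (simp add: push_closed_def push_fc)

lemma (in fi_map) push_closed_fker: "push_closed (fker V W \<theta>)"
  by (simp add: push_closed_def fker_push)

lemma zdec_push:
  assumes F: "\<And>N. filt N F" "push_closed F" and R: "push_closed R" and T: "finite T" and h: "inj_on h T"
    and x: "x \<in> zdec R F T"
  shows "push h x \<in> zdec R F (h ` T)"
proof -
  obtain r c where r: "r \<in> R T" and c: "\<And>t. t \<in> T \<Longrightarrow> c t \<in> F (T - {t})"
    and x: "x = r + (\<Sum>t\<in>T. c t)" using x by (elim zdecE) blast
  obtain N where N: "h ` T \<subseteq> {..<N}" using T finite_nat_iff_bounded by blast
  have "push h (c t) \<in> decomposables F (h ` T)" if t: "t \<in> T" for t
  proof (rule filt.dec_mem[OF F(1) N])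
    have "push h (c t) \<in> F (h ` (T - {t}))"
      using F(2) c[OF t] T h unfolding push_closed_def by (meson Diff_subset finite_Diff inj_on_subset)
    also have "h ` (T - {t}) = h ` T - {h t}" using h t by (auto simp: inj_on_def)
    finally show "push h (c t) \<in> F (h ` T - {h t})" .
  qed (use t in simp)
  then have "(\<Sum>t\<in>T. push h (c t)) \<in> decomposables F (h ` T)"
    by (intro is_subgrp_sum[OF filt.is_subgrp_dec[OF F(1) N]])
  moreover have "push h r \<in> R (h ` T)" using R r T h by (simp add: push_closed_def)
  ultimately show ?thesis unfolding x push_add push_sum by (intro zdecI[of _ R])
qed

lemma push_closed_zdec: "(\<And>N. filt N F) \<Longrightarrow> push_closed F \<Longrightarrow> push_closed R \<Longrightarrow> push_closed (zdec R F)"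
  by (simp add: push_closed_def[of "zdec R F"] zdec_push)

lemma push_closed_Int: "push_closed F \<Longrightarrow> push_closed G \<Longrightarrow> push_closed (\<lambda>T. F T \<inter> G T)"
  by (simp add: push_closed_def)

text \<open>The degree hypotheses concern only the sets \<open>{1..n}\<close>; moving an element
  along a bijection and back extends their consequences to every finite set of the same
  size.\<close>

lemma push_closed_transport:
  assumes F: "push_closed F" "F T \<subseteq> fc V T" and G: "push_closed G"
    and T: "finite T" "finite T'" "card T = card T'" and le: "F T' \<subseteq> G T'"
  shows "F T \<subseteq> G T"
proof
  fix x assume x: "x \<in> F T"
  obtain h where h: "bij_betw h T T'" using finite_same_card_bij[OF T] by blast
  define g where "g = the_inv_into T h"
  have hT: "inj_on h T" "h ` T = T'" and g: "\<And>i. i \<in> T \<Longrightarrow> g (h i) = i"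
    using h by (auto simp: bij_betw_def g_def the_inv_into_f_f)
  then have gT: "inj_on g T'" "g ` T' = T" by (auto simp: inj_on_def image_iff)
  have "push h x \<in> F T'" using F(1) x hT T(1) unfolding push_closed_def by blast
  then have "push h x \<in> G T'" using le by blast
  then have "push g (push h x) \<in> G T" using G gT T(2) unfolding push_closed_def by blast
  moreover have "push g (push h x) = x" using push_inverse[of x V T g h] x F(2) g by blast
  ultimately show "x \<in> G T" by simp
qed

text \<open>The counit at \<open>V\<close>. Its values on basis elements are prescribed so that it
  is natural in \<open>V\<close>, as \<open>ev_lift\<close> needs.\<close>

definition ev :: "'a fi_functor \<Rightarrow> ((nat set \<times> 'a \<times> (nat \<Rightarrow> nat)) \<Rightarrow>\<^sub>0 int, 'a) fi_nat_trans" where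
  "ev V = (SOME \<theta>. \<theta> \<in> fi_hom (free_cover V) V \<and>
    (\<forall>T S w f. finite T \<longrightarrow> (S, w, f) \<in> fc_basis V T \<longrightarrow> \<theta> T (frag_of (S, w, f)) = mp V S T f w))"

lemma
  assumes V: "fi_module V"
  shows ev_fi_hom: "ev V \<in> fi_hom (free_cover V) V"
    and ev_frag_of: "\<lbrakk>finite T; (S, w, f) \<in> fc_basis V T\<rbrakk> \<Longrightarrow> ev V T (frag_of (S, w, f)) = mp V S T f w"
proof -
  have "\<exists>\<theta>. \<theta> \<in> fi_hom (free_cover V) V \<and>
    (\<forall>T S w f. finite T \<longrightarrow> (S, w, f) \<in> fc_basis V T \<longrightarrow> \<theta> T (frag_of (S, w, f)) = mp V S T f w)"
    using free_cover_universal[OF V, of V "\<lambda>S w. w"] by metis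
  from someI_ex[OF this, folded ev_def]
  show "ev V \<in> fi_hom (free_cover V) V"
    "\<lbrakk>finite T; (S, w, f) \<in> fc_basis V T\<rbrakk> \<Longrightarrow> ev V T (frag_of (S, w, f)) = mp V S T f w"
    by blast+
qed

lemma gen_fc: "finite T \<Longrightarrow> w \<in> carrier (ob V T) \<Longrightarrow> frag_of (T, w, \<lambda>i\<in>T. i) \<in> fc V T"
  by (simp add: fc_basis_def FI_hom_id)

lemma ev_gen:
  assumes "fi_module V" "finite T" "w \<in> carrier (ob V T)"
  shows "ev V T (frag_of (T, w, \<lambda>i\<in>T. i)) = w"
  using ev_frag_of[OF assms(1,2), of T w "\<lambda>i\<in>T. i"] gen_fc[OF assms(2,3)]
    fi_module.mp_id[OF assms] by simp

lemma fi_map_ev: "fi_module V \<Longrightarrow> fi_map V V (ev V)"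
  by (simp add: fi_map_def ev_fi_hom)

lemma ev_surj:
  assumes V: "fi_module V" and T: "finite T"
  shows "ev V T ` fc V T = carrier (ob V T)"
proof -
  interpret fi_map V V "ev V" by (rule fi_map_ev[OF V])
  show ?thesis
  proof
    show "ev V T ` fc V T \<subseteq> carrier (ob V T)" using \<theta>_closed[OF T] by blast
    show "carrier (ob V T) \<subseteq> ev V T ` fc V T"
    proof
      fix w assume w: "w \<in> carrier (ob V T)"
      show "w \<in> ev V T ` fc V T"
        using imageI[OF gen_fc[OF T w], of "ev V T"] by (simp only: ev_gen[OF V T w])
    qed
  qed
qed

lemma ev_onto: "fi_module V \<Longrightarrow> \<forall>S. finite S \<longrightarrow> ev V S ` fc V S = carrier (ob V S)"
  using ev_surj by blast

lemma fi_map_comp: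
  assumes "fi_module V" "fi_module W" "\<eta> \<in> fi_hom V W"
  shows "fi_map V W (\<lambda>T x. \<eta> T (ev V T x))"
  using fi_hom_comp[OF ev_fi_hom[OF assms(1)] assms(3)] assms(2) by (simp add: fi_map_def)

subsection \<open>Projective FI-modules\<close>

text \<open>Projectivity is tested only against modules carried by \<open>'a\<close>, while the free
  cover lives on another type; the counit is therefore split on a transported copy \<open>E\<close>
  of the cover.\<close>

lemma projective_section:
  fixes P :: "'a::infinite fi_functor"
  assumes P: "fi_projective P"
  obtains s where "s \<in> fi_hom P (free_cover P)"
    "\<And>T x. \<lbrakk>finite T; x \<in> carrier (ob P T)\<rbrakk> \<Longrightarrow> ev P T (s T x) = x"
proof -
  have Pm: "fi_module P" using P by (simp add: fi_projective_def)
  obtain Z and j :: "((nat set \<times> 'a \<times> (nat \<Rightarrow> nat)) \<Rightarrow>\<^sub>0 int) \<Rightarrow> 'a"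
    where Z: "\<And>T. finite T \<Longrightarrow> carrier (ob (free_cover P) T) \<subseteq> Z" "inj_on j Z"
    using free_cover_embeds[of P] by blast
  obtain E :: "'a fi_functor" and \<alpha> \<beta> where E: "fi_module E"
    and \<alpha>: "\<alpha> \<in> fi_hom (free_cover P) E" and \<beta>: "\<beta> \<in> fi_hom E (free_cover P)"
    and \<beta>\<alpha>: "\<And>T x. \<lbrakk>finite T; x \<in> carrier (ob (free_cover P) T)\<rbrakk> \<Longrightarrow> \<beta> T (\<alpha> T x) = x"
    using transport_fi_module[OF fi_module_free_cover[of P] Z] by metis
  let ?\<pi> = "\<lambda>T x. ev P T (\<beta> T x)"
  have \<pi>: "?\<pi> \<in> fi_hom E P" by (rule fi_hom_comp[OF \<beta> ev_fi_hom[OF Pm]])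
  have "?\<pi> T ` carrier (ob E T) = carrier (ob P T)" if T: "finite T" for T
  proof
    show "?\<pi> T ` carrier (ob E T) \<subseteq> carrier (ob P T)"
      using \<pi> T by (auto simp: fi_hom_def hom_def)
    show "carrier (ob P T) \<subseteq> ?\<pi> T ` carrier (ob E T)"
    proof
      fix w assume "w \<in> carrier (ob P T)"
      then obtain x where x: "x \<in> fc P T" "w = ev P T x" using ev_surj[OF Pm T] by blast
      then have "\<alpha> T x \<in> carrier (ob E T)" using \<alpha> T by (auto simp: fi_hom_def hom_def fc_carrier)
      moreover have "?\<pi> T (\<alpha> T x) = w" using \<beta>\<alpha>[OF T] x by (simp add: fc_carrier)
      ultimately show "w \<in> ?\<pi> T ` carrier (ob E T)" by blast
    qed
  qed
  then have surj: "fi_surj E P ?\<pi>" by (simp add: fi_surj_def)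
  have "(\<lambda>T x. x) \<in> fi_hom P P" by (auto simp: fi_hom_def hom_def)
  with P E Pm \<pi> surj
  have "\<exists>\<psi>\<in>fi_hom P E. \<forall>T. finite T \<longrightarrow> (\<forall>x\<in>carrier (ob P T). ?\<pi> T (\<psi> T x) = x)"
    unfolding fi_projective_def by blast
  then obtain \<psi> where \<psi>: "\<psi> \<in> fi_hom P E" "\<And>T x. \<lbrakk>finite T; x \<in> carrier (ob P T)\<rbrakk> \<Longrightarrow> ?\<pi> T (\<psi> T x) = x"
    by blast
  show thesis by (rule that[OF fi_hom_comp[OF \<psi>(1) \<beta>]]) (use \<psi>(2) in simp)
qed

text \<open>The counit followed by its section is an idempotent of the free cover with the same
  kernel as the counit, so \<open>koszul_van_retract\<close> reduces the claim to the free
  family.\<close>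

lemma koszul_van_projective:
  fixes P :: "'a::infinite fi_functor"
  assumes P: "fi_projective P" and T: "finite T" and p: "0 < p"
  shows "koszul_van (fc P) (fker P P (ev P)) p T"
proof -
  have Pm: "fi_module P" using P by (simp add: fi_projective_def)
  interpret E: fi_map P P "ev P" by (rule fi_map_ev[OF Pm])
  obtain s where s: "s \<in> fi_hom P (free_cover P)"
    and es: "\<And>T x. \<lbrakk>finite T; x \<in> carrier (ob P T)\<rbrakk> \<Longrightarrow> ev P T (s T x) = x"
    using projective_section[OF P] by blast
  obtain N where N: "T \<subseteq> {..<N}" using T finite_nat_iff_bounded by blast
  have fin: "finite S" if "S \<subseteq> T" for S using that T by (rule finite_subset)
  interpret S: fi_map P "free_cover P" "\<lambda>T x. s T (ev P T x)"
    using fi_hom_comp[OF ev_fi_hom[OF Pm] s] fi_module_free_cover by (simp add: fi_map_def)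
  have one: "\<one>\<^bsub>ob (free_cover P) S\<^esub> = 0" and mult: "x \<otimes>\<^bsub>ob (free_cover P) S\<^esub> y = x + y" for S x y
    by (simp_all add: free_cover_def)
  show ?thesis
  proof (rule koszul_van_retract[OF E.fam_fker N, where \<sigma> = "\<lambda>T x. s T (ev P T x)"])
    have "fc P = (\<lambda>T. {x. Poly_Mapping.keys x \<subseteq> {b \<in> fc_basis P UNIV. snd (snd b) ` fst b \<subseteq> T}})"
      by (rule ext) (subst fc_basis_supp[symmetric], simp add: fc_def)
    then show "koszul_van (fc P) (\<lambda>_. {0}) p T" using koszul_van_free[OF T p] by simp
  next
    fix S x assume S: "S \<subseteq> T" and x: "x \<in> fc P S"
    show "s S (ev P S x) \<in> fc P S" using S.\<theta>_closed[OF fin[OF S] x] by (simp add: fc_carrier)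
    show "s S (ev P S (x + y)) = s S (ev P S x) + s S (ev P S y)" if "y \<in> fc P S" for y
      using S.\<theta>_add[OF fin[OF S] x that] by (simp add: mult)
    have "ev P S x = ev P S (s S (ev P S x))"
      using es[OF fin[OF S] E.\<theta>_closed[OF fin[OF S] x]] by simp
    then show "x - s S (ev P S x) \<in> fker P P (ev P) S"
      using E.\<theta>_eq_iff[OF fin[OF S] x] S.\<theta>_closed[OF fin[OF S] x] by (simp add: fc_carrier)
  next
    fix S S' x assume S: "S' \<subseteq> S" "S \<subseteq> T" and x: "x \<in> fc P S'"
    have "s S' (ev P S' x) \<in> fc P S'"
      using S.\<theta>_closed[OF fin[OF subset_trans[OF S]] x] by (simp add: fc_carrier)
    then show "s S (ev P S x) = s S' (ev P S' x)"
      using S.\<theta>_incl[OF fin[OF S(2)] S(1) x] push_id[of _ P S' "\<lambda>i\<in>S'. i"]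
      by (simp add: mp_free_cover)
  next
    fix S x assume S: "S \<subseteq> T" and x: "x \<in> fker P P (ev P) S"
    then have x': "x \<in> fc P S" "ev P S x = ev P S 0" using E.\<theta>_zero[OF fin[OF S]] by (auto simp: fker_def)
    show "s S (ev P S x) = 0" unfolding x'(2) S.\<theta>_zero[OF fin[OF S]] one ..
  qed
qed

subsection \<open>Passing to syzygies\<close>

text \<open>The map induced by \<open>\<delta>\<close> on free covers. Its formula does not involve
  \<open>T\<close>, so it is one additive map compatible with all inclusions, as
  \<open>koszul_van_pullback\<close> requires.\<close>

definition lift :: "(nat set \<Rightarrow> 'a \<Rightarrow> 'b) \<Rightarrow> ((nat set \<times> 'a \<times> (nat \<Rightarrow> nat)) \<Rightarrow>\<^sub>0 int)
    \<Rightarrow> ((nat set \<times> 'b \<times> (nat \<Rightarrow> nat)) \<Rightarrow>\<^sub>0 int)" where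
  "lift \<delta> = frag_extend (\<lambda>(S, w, f). frag_of (S, \<delta> S w, f))"

lemma lift_add: "lift \<delta> (x + y) = lift \<delta> x + lift \<delta> y"
  by (simp add: lift_def frag_extend_add)

lemma lift_sum: "lift \<delta> (sum f I) = (\<Sum>i\<in>I. lift \<delta> (f i))"
  by (induction I rule: infinite_finite_induct) (auto simp: lift_add, simp_all add: lift_def)

lemma lift_fc:
  assumes \<delta>: "\<delta> \<in> fi_hom V W" and x: "x \<in> fc V T"
  shows "lift \<delta> x \<in> fc W T"
  using x
proof (induction x rule: fc_induct)
  case (one b)
  then show ?case using \<delta> by (cases b) (auto simp: lift_def fc_basis_def fi_hom_def hom_def)
qed (auto simp: lift_def frag_extend_diff intro: is_subgrp_zero[OF is_subgrp_fc] is_subgrp_diff[OF is_subgrp_fc])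

lemma ev_lift:
  assumes V: "fi_module V" and W: "fi_module W" and \<delta>: "\<delta> \<in> fi_hom V W" and T: "finite T"
    and x: "x \<in> fc V T"
  shows "ev W T (lift \<delta> x) = \<delta> T (ev V T x)"
proof -
  interpret EW: fi_map W W "ev W" by (rule fi_map_ev[OF W])
  interpret D: fi_map V W "\<lambda>T x. \<delta> T (ev V T x)" by (rule fi_map_comp[OF V W \<delta>])
  show ?thesis
    using x
  proof (induction x rule: fc_induct)
    case zero
    show ?case using EW.\<theta>_zero[OF T] D.\<theta>_zero[OF T] by (simp add: lift_def)
  next
    case (one b)
    obtain S w f where b: "b = (S, w, f)" by (cases b)
    have S: "finite S" "w \<in> carrier (ob V S)" "f \<in> FI_hom S T" using one by (auto simp: b fc_basis_def)
    then have "\<delta> S w \<in> carrier (ob W S)" using \<delta> by (auto simp: fi_hom_def hom_def)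
    then have "(S, \<delta> S w, f) \<in> fc_basis W T" using S by (simp add: fc_basis_def)
    from ev_frag_of[OF W T this] ev_frag_of[OF V T one[unfolded b]]
    show ?case using \<delta> S T by (simp add: b lift_def fi_hom_def)
  next
    case (diff x y)
    have "lift \<delta> (x - y) = lift \<delta> x - lift \<delta> y" by (simp add: lift_def frag_extend_diff)
    then show ?case
      using diff.IH EW.\<theta>_diff[OF T lift_fc[OF \<delta> diff.hyps(1)] lift_fc[OF \<delta> diff.hyps(2)]]
        D.\<theta>_diff[OF T diff.hyps] by simp
  qed
qed

text \<open>\<open>P'' \<rightarrow> P' \<rightarrow> P \<rightarrow> B\<close> is a segment of a resolution, \<open>fc P / Z\<close> is the
  image of \<open>d\<close> and \<open>Z / R\<close> its kernel, which is also \<open>fc P' / Z'\<close>.\<close>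

locale exact_segment =
  fixes P' P :: "'a fi_functor" and B :: "'a fi_functor" and \<delta> d
  assumes P': "fi_module P'" and P: "fi_module P" and B: "fi_module B"
    and \<delta>: "\<delta> \<in> fi_hom P' P" and d: "d \<in> fi_hom P B"
    and exact: "finite T \<Longrightarrow> \<delta> T ` carrier (ob P' T) = kernel (ob P T) (ob B T) (d T)"
begin

abbreviation "R \<equiv> fker P P (ev P)"
abbreviation "Z \<equiv> fker P B (\<lambda>T x. d T (ev P T x))"
abbreviation "Z' \<equiv> fker P' P (\<lambda>T x. \<delta> T (ev P' T x))"

sublocale E: fi_map P P "ev P" by (rule fi_map_ev[OF P])
sublocale E': fi_map P' P' "ev P'" by (rule fi_map_ev[OF P'])
sublocale D: fi_map P B "\<lambda>T x. d T (ev P T x)" by (rule fi_map_comp[OF P B d])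
sublocale D': fi_map P' P "\<lambda>T x. \<delta> T (ev P' T x)" by (rule fi_map_comp[OF P' P \<delta>])

lemma R_le_Z: "finite T \<Longrightarrow> R T \<subseteq> Z T"
  using E.\<theta>_zero D.\<theta>_zero by (auto simp: fker_def)

lemma fam_ZR: "fam N Z R"
proof (intro fam.intro D.filt_fker E.filt_fker fam_axioms.intro R_le_Z)
  show "finite T" if "T \<subseteq> {..<N}" for T using that by (meson finite_lessThan finite_subset)
qed

lemma lift_Z:
  assumes T: "finite T" and x: "x \<in> fc P' T"
  shows "lift \<delta> x \<in> Z T"
proof -
  have "\<delta> T (ev P' T x) \<in> kernel (ob P T) (ob B T) (d T)"
    using exact[OF T] E'.\<theta>_closed[OF T x] by blast
  then show ?thesis using ev_lift[OF P' P \<delta> T x] lift_fc[OF \<delta> x] by (simp add: fker_def kernel_def)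
qed

lemma lift_R_iff: "finite T \<Longrightarrow> x \<in> fc P' T \<Longrightarrow> lift \<delta> x \<in> R T \<longleftrightarrow> x \<in> Z' T"
  using lift_fc[OF \<delta>] by (simp add: fker_def ev_lift[OF P' P \<delta>])

lemma lift_surj:
  assumes T: "finite T" and y: "y \<in> Z T"
  shows "\<exists>x\<in>fc P' T. y - lift \<delta> x \<in> R T"
proof -
  have yP: "y \<in> fc P T" using y by (simp add: fker_def)
  have "ev P T y \<in> kernel (ob P T) (ob B T) (d T)"
    using y E.\<theta>_closed[OF T yP] by (simp add: fker_def kernel_def)
  then obtain w where w: "w \<in> carrier (ob P' T)" "ev P T y = \<delta> T w" using exact[OF T] by blast
  let ?x = "frag_of (T, w, \<lambda>i\<in>T. i)"
  have x: "?x \<in> fc P' T" by (rule gen_fc[OF T w(1)])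
  have "ev P T y = ev P T (lift \<delta> ?x)" using ev_lift[OF P' P \<delta> T x] ev_gen[OF P' T w(1)] w(2) by simp
  then have "y - lift \<delta> ?x \<in> R T" using E.\<theta>_eq_iff[OF T yP lift_fc[OF \<delta> x]] by simp
  with x show ?thesis by blast
qed

text \<open>\<open>lift \<delta>\<close> realizes the isomorphism of \<open>fc P' / Z'\<close> with
  \<open>Z / R\<close>, so vanishing for the kernel of \<open>d\<close> passes to the presentation
  used by the next segment.\<close>

lemma koszul_van_next:
  assumes "finite T" "koszul_van Z R p T"
  shows "koszul_van (fc P') Z' p T"
proof -
  obtain N where N: "T \<subseteq> {..<N}" using assms(1) finite_nat_iff_bounded by blast
  have fin: "finite S" if "S \<subseteq> T" for S using that assms(1) by (rule finite_subset)
  show ?thesis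
    by (rule koszul_van_pullback[OF fam_ZR D'.fam_fker N lift_add[of \<delta>] _ _ _ assms(2)])
      (simp_all add: lift_Z lift_R_iff lift_surj fin)
qed

lemma H0_span_image:
  assumes T: "finite T" and s: "s \<in> H0_span P' T"
  shows "\<delta> T s \<in> H0_span P T"
proof -
  obtain c where c: "\<And>t. t \<in> T \<Longrightarrow> c t \<in> fc P' (T - {t})" "s = ev P' T (\<Sum>t\<in>T. c t)"
    using s unfolding E'.H0_span_eq[OF ev_onto[OF P'] T] by (auto elim!: decE)
  have "c t \<in> fc P' T" if "t \<in> T" for t using c(1)[OF that] fc_mono[of "T - {t}" T] by auto
  then have "(\<Sum>t\<in>T. c t) \<in> fc P' T" by (rule is_subgrp_sum[OF is_subgrp_fc])
  then have "\<delta> T s = ev P T (\<Sum>t\<in>T. lift \<delta> (c t))"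
    using ev_lift[OF P' P \<delta> T, of "\<Sum>t\<in>T. c t"] by (simp add: c(2) lift_sum)
  moreover have "(\<Sum>t\<in>T. lift \<delta> (c t)) \<in> decomposables (fc P) T" by (rule decI) (rule lift_fc[OF \<delta> c(1)])
  ultimately show ?thesis unfolding E.H0_span_eq[OF ev_onto[OF P] T] by blast
qed

text \<open>By right exactness H_0 of \<open>Z / R\<close> is H_0(P') modulo the image of H_0(P''),
  so the kernel of its map to H_0(P) is the middle homology of H_0(P'') -> H_0(P') -> H_0(P). The
  left side is the vanishing of that homology, spelled out on elements.\<close>

lemma derived_iff:
  assumes T: "finite T"
    and exact': "\<delta>' T ` carrier (ob P'' T) = kernel (ob P' T) (ob P T) (\<delta> T)"
  shows "(\<forall>x\<in>carrier (ob P' T). \<delta> T x \<in> H0_span P T \<longrightarrow>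
      (\<exists>s\<in>H0_span P' T. \<exists>y\<in>carrier (ob P'' T). x = s \<otimes>\<^bsub>ob P' T\<^esub> \<delta>' T y)) \<longleftrightarrow>
    Z T \<inter> zdec R (fc P) T \<subseteq> zdec R Z T" (is "?L \<longleftrightarrow> ?Q")
proof
  interpret G: comm_group "ob P T" by (rule E.grp[OF T])
  interpret G': comm_group "ob P' T" by (rule E'.grp[OF T])
  interpret \<delta>: group_hom "ob P' T" "ob P T" "\<delta> T"
    using \<delta> T by (simp add: group_hom_def group_hom_axioms_def fi_hom_def G.is_group G'.is_group)
  show ?Q if L: ?L
  proof
    fix z assume z: "z \<in> Z T \<inter> zdec R (fc P) T"
    then have zP: "z \<in> fc P T" by (simp add: fker_def)
    obtain x where x: "x \<in> fc P' T" "z - lift \<delta> x \<in> R T" using lift_surj[OF T] z by blast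
    note lx = lift_fc[OF \<delta> x(1)] and ex = E'.\<theta>_closed[OF T x(1)]
    have ez: "ev P T z = \<delta> T (ev P' T x)"
      using E.\<theta>_eq_iff[OF T zP lx] x(2) ev_lift[OF P' P \<delta> T x(1)] by simp
    have "ev P T z \<in> H0_span P T" using E.mem_H0_span_iff[OF ev_onto[OF P] T zP] z by simp
    then obtain s y where s: "s \<in> H0_span P' T" and y: "y \<in> carrier (ob P'' T)"
      and sy: "ev P' T x = s \<otimes>\<^bsub>ob P' T\<^esub> \<delta>' T y" using L ex ez by metis
    have "\<delta>' T y \<in> kernel (ob P' T) (ob P T) (\<delta> T)" using exact' y by blast
    then have \<delta>y: "\<delta>' T y \<in> carrier (ob P' T)" "\<delta> T (\<delta>' T y) = \<one>\<^bsub>ob P T\<^esub>" by (auto simp: kernel_def)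
    obtain c where c: "\<And>t. t \<in> T \<Longrightarrow> c t \<in> fc P' (T - {t})" "s = ev P' T (\<Sum>t\<in>T. c t)"
      using s unfolding E'.H0_span_eq[OF ev_onto[OF P'] T] by (auto elim!: decE)
    have "c t \<in> fc P' T" if "t \<in> T" for t using c(1)[OF that] fc_mono[of "T - {t}" T] by auto
    then have cT: "(\<Sum>t\<in>T. c t) \<in> fc P' T" by (rule is_subgrp_sum[OF is_subgrp_fc])
    have "ev P T z = \<delta> T s"
      using ez sy \<delta>y c(2) E'.\<theta>_closed[OF T cT] by simp
    also have "\<dots> = ev P T (lift \<delta> (\<Sum>t\<in>T. c t))" using ev_lift[OF P' P \<delta> T cT] c(2) by simp
    finally have "z - lift \<delta> (\<Sum>t\<in>T. c t) \<in> R T" using E.\<theta>_eq_iff[OF T zP lift_fc[OF \<delta> cT]] by simp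
    moreover have "lift \<delta> (\<Sum>t\<in>T. c t) \<in> decomposables Z T"
      unfolding lift_sum by (rule decI) (use lift_Z[OF _ c(1)] T in simp)
    ultimately have "(z - lift \<delta> (\<Sum>t\<in>T. c t)) + lift \<delta> (\<Sum>t\<in>T. c t) \<in> zdec R Z T"
      by (rule zdecI[of _ R])
    then show "z \<in> zdec R Z T" by simp
  qed
  show ?L if Q: ?Q
  proof (intro ballI impI)
    fix x assume x: "x \<in> carrier (ob P' T)" and \<delta>x: "\<delta> T x \<in> H0_span P T"
    let ?g = "frag_of (T, x, \<lambda>i\<in>T. i)"
    have g: "?g \<in> fc P' T" by (rule gen_fc[OF T x])
    have eg: "ev P T (lift \<delta> ?g) = \<delta> T x" using ev_lift[OF P' P \<delta> T g] ev_gen[OF P' T x] by simp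
    have "lift \<delta> ?g \<in> zdec R Z T"
      using Q lift_Z[OF T g] E.mem_H0_span_iff[OF ev_onto[OF P] T lift_fc[OF \<delta> g]] eg \<delta>x by auto
    then obtain r z where r: "r \<in> R T" and z: "\<And>t. t \<in> T \<Longrightarrow> z t \<in> Z (T - {t})"
      and rz: "lift \<delta> ?g = r + (\<Sum>t\<in>T. z t)" by (elim zdecE) blast
    \<comment> \<open>Modulo \<open>R\<close> the summands in \<open>Z\<close> come from
      \<open>P'\<close> by exactness, so the decomposition can be moved back to
      \<open>P'\<close>.\<close>
    have "\<forall>t\<in>T. \<exists>c\<in>fc P' (T - {t}). z t - lift \<delta> c \<in> R (T - {t})"
      using lift_surj[OF _ z] T by simp
    then obtain c where c: "\<And>t. t \<in> T \<Longrightarrow> c t \<in> fc P' (T - {t})"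
      "\<And>t. t \<in> T \<Longrightarrow> z t - lift \<delta> (c t) \<in> R (T - {t})" by metis
    have "c t \<in> fc P' T" if "t \<in> T" for t using c(1)[OF that] fc_mono[of "T - {t}" T] by auto
    then have cT: "(\<Sum>t\<in>T. c t) \<in> fc P' T" by (rule is_subgrp_sum[OF is_subgrp_fc])
    define s where "s = ev P' T (\<Sum>t\<in>T. c t)"
    have s: "s \<in> H0_span P' T" "s \<in> carrier (ob P' T)"
      unfolding s_def E'.H0_span_eq[OF ev_onto[OF P'] T] using E'.\<theta>_closed[OF T cT] decI[of T c] c(1)
      by auto
    have "(\<Sum>t\<in>T. z t - lift \<delta> (c t)) \<in> R T"
      using c(2) E.fker_mono[of "T - {_}" T] T by (intro is_subgrp_sum[OF E.is_subgrp_fker[OF T]]) blast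
    from is_subgrp_add[OF E.is_subgrp_fker[OF T] r this]
    have "lift \<delta> ?g - lift \<delta> (\<Sum>t\<in>T. c t) \<in> R T" by (simp add: rz sum_subtractf lift_sum algebra_simps)
    then have "\<delta> T x = \<delta> T s"
      using E.\<theta>_eq_iff[OF T lift_fc[OF \<delta> g] lift_fc[OF \<delta> cT]] eg ev_lift[OF P' P \<delta> T cT] by (simp add: s_def)
    then have "inv\<^bsub>ob P' T\<^esub> s \<otimes>\<^bsub>ob P' T\<^esub> x \<in> kernel (ob P' T) (ob P T) (\<delta> T)"
      using x s(2) by (simp add: kernel_def)
    then obtain y where y: "y \<in> carrier (ob P'' T)" "inv\<^bsub>ob P' T\<^esub> s \<otimes>\<^bsub>ob P' T\<^esub> x = \<delta>' T y"
      using exact' by (metis imageE)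
    have "x = s \<otimes>\<^bsub>ob P' T\<^esub> \<delta>' T y"
      unfolding y(2)[symmetric] using x s(2) by (simp add: G'.m_assoc[symmetric])
    with s(1) y(1) show "\<exists>s\<in>H0_span P' T. \<exists>y\<in>carrier (ob P'' T). x = s \<otimes>\<^bsub>ob P' T\<^esub> \<delta>' T y" by blast
  qed
qed

end

section \<open>Homology of a complex of quotient groups\<close>

lemma trivial_FactGroup_iff:
  assumes G: "comm_group G" and N: "subgroup N G"
  shows "trivial_group (G Mod N) \<longleftrightarrow> carrier G \<subseteq> N"
proof -
  interpret G: comm_group G by fact
  interpret Q: comm_group "G Mod N" by (rule G.abelian_FactGroup[OF N])
  have "trivial_group (G Mod N) \<longleftrightarrow> (\<forall>x\<in>carrier G. N #>\<^bsub>G\<^esub> x = N)"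
    unfolding Q.trivial_group_subset carrier_FactGroup one_FactGroup by blast
  also have "\<dots> \<longleftrightarrow> carrier G \<subseteq> N"
    using G.coset_join1[OF _ _ N] G.coset_join2[OF _ N] by blast
  finally show ?thesis .
qed

lemma coset_map:
  assumes h: "group_hom G H h" and M: "subgroup M G" and N: "subgroup N H" and le: "h ` M \<subseteq> N"
    and x: "x \<in> carrier G"
  shows "N <#>\<^bsub>H\<^esub> h ` (M #>\<^bsub>G\<^esub> x) = N #>\<^bsub>H\<^esub> h x"
proof
  interpret h: group_hom G H h by fact
  have Mc: "m \<in> carrier G" if "m \<in> M" for m using subgroup.mem_carrier[OF M that] .
  have Nc: "n \<in> carrier H" if "n \<in> N" for n using subgroup.mem_carrier[OF N that] .
  show "N <#>\<^bsub>H\<^esub> h ` (M #>\<^bsub>G\<^esub> x) \<subseteq> N #>\<^bsub>H\<^esub> h x"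
  proof
    fix y assume "y \<in> N <#>\<^bsub>H\<^esub> h ` (M #>\<^bsub>G\<^esub> x)"
    then obtain n m where n: "n \<in> N" "m \<in> M" "y = n \<otimes>\<^bsub>H\<^esub> h (m \<otimes>\<^bsub>G\<^esub> x)"
      by (auto simp: set_mult_def r_coset_def)
    have "h m \<in> N" using le n(2) by auto
    then have "n \<otimes>\<^bsub>H\<^esub> h m \<in> N" using subgroup.m_closed[OF N n(1)] by simp
    moreover have "y = (n \<otimes>\<^bsub>H\<^esub> h m) \<otimes>\<^bsub>H\<^esub> h x"
      using n Mc[OF n(2)] Nc[OF n(1)] x by (simp add: h.H.m_assoc)
    ultimately show "y \<in> N #>\<^bsub>H\<^esub> h x" by (auto simp: r_coset_def)
  qed
  show "N #>\<^bsub>H\<^esub> h x \<subseteq> N <#>\<^bsub>H\<^esub> h ` (M #>\<^bsub>G\<^esub> x)"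
  proof
    fix y assume "y \<in> N #>\<^bsub>H\<^esub> h x"
    then obtain n where n: "n \<in> N" "y = n \<otimes>\<^bsub>H\<^esub> h x" by (auto simp: r_coset_def)
    have "x \<in> M #>\<^bsub>G\<^esub> x" by (rule h.G.rcos_self[OF x M])
    then show "y \<in> N <#>\<^bsub>H\<^esub> h ` (M #>\<^bsub>G\<^esub> x)" using n by (auto simp: set_mult_def)
  qed
qed

lemma coset_map_hom:
  assumes G: "comm_group G" and H: "comm_group H" and h: "h \<in> hom G H"
    and M: "subgroup M G" and N: "subgroup N H" and le: "h ` M \<subseteq> N"
  shows "group_hom (G Mod M) (H Mod N) (\<lambda>C. N <#>\<^bsub>H\<^esub> h ` C)"
proof -
  interpret G: comm_group G by fact
  interpret H: comm_group H by fact
  have gh: "group_hom G H h" using h by (simp add: group_hom_def group_hom_axioms_def)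
  interpret h: group_hom G H h by (rule gh)
  interpret M: normal M G by (rule G.subgroup_imp_normal[OF M])
  interpret N: normal N H by (rule H.subgroup_imp_normal[OF N])
  note map = coset_map[OF gh M N le]
  have "(\<lambda>C. N <#>\<^bsub>H\<^esub> h ` C) \<in> hom (G Mod M) (H Mod N)"
  proof (rule homI)
    fix C assume "C \<in> carrier (G Mod M)"
    then obtain x where x: "x \<in> carrier G" "C = M #>\<^bsub>G\<^esub> x" by (auto simp: carrier_FactGroup)
    then show "N <#>\<^bsub>H\<^esub> h ` C \<in> carrier (H Mod N)" by (simp add: map carrier_FactGroup)
    fix C' assume "C' \<in> carrier (G Mod M)"
    then obtain y where y: "y \<in> carrier G" "C' = M #>\<^bsub>G\<^esub> y" by (auto simp: carrier_FactGroup)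
    show "N <#>\<^bsub>H\<^esub> h ` (C \<otimes>\<^bsub>G Mod M\<^esub> C')
        = (N <#>\<^bsub>H\<^esub> h ` C) \<otimes>\<^bsub>H Mod N\<^esub> (N <#>\<^bsub>H\<^esub> h ` C')"
      using x(1) y(1) by (simp add: x(2) y(2) M.rcos_sum N.rcos_sum map)
  qed
  then show ?thesis
    using M.factorgroup_is_group N.factorgroup_is_group
    by (simp add: group_hom_def group_hom_axioms_def)
qed

lemma trivial_middle_homology_iff:
  assumes G2: "comm_group G2" and G1: "comm_group G1" and G0: "comm_group G0"
    and a: "a \<in> hom G2 G1" and b: "b \<in> hom G1 G0"
    and M2: "subgroup M2 G2" and M1: "subgroup M1 G1" and M0: "subgroup M0 G0"
    and aM: "a ` M2 \<subseteq> M1" and bM: "b ` M1 \<subseteq> M0"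
    and ba: "\<And>y. y \<in> carrier G2 \<Longrightarrow> b (a y) = \<one>\<^bsub>G0\<^esub>"
  defines "\<alpha> \<equiv> \<lambda>C. M1 <#>\<^bsub>G1\<^esub> a ` C" and "\<beta> \<equiv> \<lambda>C. M0 <#>\<^bsub>G0\<^esub> b ` C"
  shows "trivial_group ((G1 Mod M1)\<lparr>carrier := kernel (G1 Mod M1) (G0 Mod M0) \<beta>\<rparr>
      Mod (\<alpha> ` carrier (G2 Mod M2))) \<longleftrightarrow>
    (\<forall>x\<in>carrier G1. b x \<in> M0 \<longrightarrow> (\<exists>s\<in>M1. \<exists>y\<in>carrier G2. x = s \<otimes>\<^bsub>G1\<^esub> a y))"
proof -
  interpret G2: comm_group G2 by fact
  interpret G1: comm_group G1 by fact
  interpret G0: comm_group G0 by fact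
  interpret C1: comm_group "G1 Mod M1" by (rule G1.abelian_FactGroup[OF M1])
  interpret a: group_hom G2 G1 a using a by (simp add: group_hom_def group_hom_axioms_def)
  interpret b: group_hom G1 G0 b using b by (simp add: group_hom_def group_hom_axioms_def)
  interpret \<alpha>: group_hom "G2 Mod M2" "G1 Mod M1" \<alpha>
    unfolding \<alpha>_def by (rule coset_map_hom[OF G2 G1 a M2 M1 aM])
  interpret \<beta>: group_hom "G1 Mod M1" "G0 Mod M0" \<beta>
    unfolding \<beta>_def by (rule coset_map_hom[OF G1 G0 b M1 M0 bM])
  have \<alpha>: "\<alpha> (M2 #>\<^bsub>G2\<^esub> y) = M1 #>\<^bsub>G1\<^esub> a y" if "y \<in> carrier G2" for y
    unfolding \<alpha>_def by (rule coset_map[OF a.group_hom_axioms M2 M1 aM that])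
  have \<beta>: "\<beta> (M1 #>\<^bsub>G1\<^esub> x) = M0 #>\<^bsub>G0\<^esub> b x" if "x \<in> carrier G1" for x
    unfolding \<beta>_def by (rule coset_map[OF b.group_hom_axioms M1 M0 bM that])
  let ?K = "kernel (G1 Mod M1) (G0 Mod M0) \<beta>"
  let ?im = "\<alpha> ` carrier (G2 Mod M2)"
  have ker: "M1 #>\<^bsub>G1\<^esub> x \<in> ?K \<longleftrightarrow> b x \<in> M0" if x: "x \<in> carrier G1" for x
    using G0.coset_join1[OF _ _ M0, of "b x"] G0.coset_join2[OF _ M0, of "b x"] x
    by (auto simp: kernel_def \<beta> carrier_FactGroup)
  have im: "M1 #>\<^bsub>G1\<^esub> x \<in> ?im \<longleftrightarrow> (\<exists>s\<in>M1. \<exists>y\<in>carrier G2. x = s \<otimes>\<^bsub>G1\<^esub> a y)"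
    if x: "x \<in> carrier G1" for x
  proof -
    have "?im = (\<lambda>y. M1 #>\<^bsub>G1\<^esub> a y) ` carrier G2"
      unfolding carrier_FactGroup image_image by (rule image_cong) (simp_all add: \<alpha>)
    then have "M1 #>\<^bsub>G1\<^esub> x \<in> ?im \<longleftrightarrow> (\<exists>y\<in>carrier G2. M1 #>\<^bsub>G1\<^esub> a y = M1 #>\<^bsub>G1\<^esub> x)"
      by (auto simp: image_iff)
    also have "\<dots> \<longleftrightarrow> (\<exists>y\<in>carrier G2. x \<in> M1 #>\<^bsub>G1\<^esub> a y)"
      using G1.repr_independence[OF _ _ M1] G1.rcos_self[OF x M1] a.hom_closed by metis
    also have "\<dots> \<longleftrightarrow> (\<exists>s\<in>M1. \<exists>y\<in>carrier G2. x = s \<otimes>\<^bsub>G1\<^esub> a y)"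
      by (auto simp: r_coset_def)
    finally show ?thesis .
  qed
  have "?im \<subseteq> ?K"
  proof
    fix C assume "C \<in> ?im"
    then obtain y where y: "y \<in> carrier G2" "C = M1 #>\<^bsub>G1\<^esub> a y" by (auto simp: carrier_FactGroup \<alpha>)
    then show "C \<in> ?K" using ker[of "a y"] ba[of y] subgroup.one_closed[OF M0] by simp
  qed
  then have sub: "subgroup ?im ((G1 Mod M1)\<lparr>carrier := ?K\<rparr>)"
    by (rule C1.subgroup_incl[OF \<alpha>.img_is_subgroup \<beta>.subgroup_kernel])
  have "group ((G1 Mod M1)\<lparr>carrier := ?K\<rparr>)"
    by (rule C1.subgroup_imp_group[OF \<beta>.subgroup_kernel])
  then have "comm_group ((G1 Mod M1)\<lparr>carrier := ?K\<rparr>)"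
    by (rule group.group_comm_groupI) (simp add: kernel_def C1.m_comm del: mult_FactGroup)
  from trivial_FactGroup_iff[OF this sub]
  have "trivial_group ((G1 Mod M1)\<lparr>carrier := ?K\<rparr> Mod ?im) \<longleftrightarrow> ?K \<subseteq> ?im" by simp
  also have "\<dots> \<longleftrightarrow> (\<forall>x\<in>carrier G1. M1 #>\<^bsub>G1\<^esub> x \<in> ?K \<longrightarrow> M1 #>\<^bsub>G1\<^esub> x \<in> ?im)"
    by (auto simp: kernel_def carrier_FactGroup)
  also have "\<dots> \<longleftrightarrow> (\<forall>x\<in>carrier G1. b x \<in> M0 \<longrightarrow> (\<exists>s\<in>M1. \<exists>y\<in>carrier G2. x = s \<otimes>\<^bsub>G1\<^esub> a y))"
    using ker im by simp
  finally show ?thesis .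
qed

section \<open>FI-homology\<close>

text \<open>The chosen resolution does not depend on the degree, so a single one serves for all
  \<open>q\<close>.\<close>

lemma FI_homology_Suc:
  fixes W :: "'a::infinite fi_functor"
  assumes W: "fi_module W"
  obtains P \<delta> \<epsilon> where "projective_resolution W P \<delta> \<epsilon>"
    "\<And>q. FI_homology (Suc q) W =
      fi_middle_homology (H0 (P (Suc (Suc q)))) (H0 (P (Suc q))) (H0 (P q))
        (H0_map (P (Suc (Suc q))) (P (Suc q)) (\<delta> (Suc q))) (H0_map (P (Suc q)) (P q) (\<delta> q))"
proof -
  define c where "c = (SOME (P, \<delta>). \<exists>\<epsilon>. projective_resolution W P \<delta> \<epsilon>)"
  obtain P \<delta> where c: "c = (P, \<delta>)" by (cases c)
  have "\<exists>c. case c of (P, \<delta>) \<Rightarrow> \<exists>\<epsilon>. projective_resolution W P \<delta> \<epsilon>"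
    using projective_resolution_exists[OF W] by auto
  from someI_ex[OF this, folded c_def] obtain \<epsilon> where res: "projective_resolution W P \<delta> \<epsilon>"
    by (auto simp: c)
  show thesis
    by (rule that[OF res]) (simp add: FI_homology_def left_derived_def Let_def c_def[symmetric] c)
qed

text \<open>For \<open>n > k\<close> some admissible bound lies strictly below \<open>n\<close> and
  already forces triviality at \<open>n\<close>, so attainment of the infimum never comes
  up.\<close>

lemma fi_degree_le_iff:
  "fi_degree V \<le> ereal (real k) \<longleftrightarrow> (\<forall>n>k. trivial_group (ob V {1..n}))"
proof
  assume le: "fi_degree V \<le> ereal (real k)"
  show "\<forall>n>k. trivial_group (ob V {1..n})"
  proof (intro allI impI)
    fix n assume "k < n"
    then have "fi_degree V < ereal (real n)"
      using le by (metis ereal_less_eq(3) less_le_trans linorder_not_le of_nat_less_iff)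
    then show "trivial_group (ob V {1..n})"
      unfolding fi_degree_def Inf_less_iff by auto
  qed
next
  assume "\<forall>n>k. trivial_group (ob V {1..n})"
  then show "fi_degree V \<le> ereal (real k)"
    unfolding fi_degree_def by (intro Inf_lower) auto
qed

context exact_segment
begin

lemma trivial_homology_iff:
  assumes T: "finite T" and P'': "fi_module P''" and \<delta>': "\<delta>' \<in> fi_hom P'' P'"
    and exact': "\<And>T. finite T \<Longrightarrow> \<delta>' T ` carrier (ob P'' T) = kernel (ob P' T) (ob P T) (\<delta> T)"
  shows "trivial_group (ob (fi_middle_homology (H0 P'') (H0 P') (H0 P)
      (H0_map P'' P' \<delta>') (H0_map P' P \<delta>)) T) \<longleftrightarrow>
    Z T \<inter> zdec R (fc P) T \<subseteq> zdec R Z T"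
proof -
  interpret S': exact_segment P'' P' P \<delta>' \<delta>
    by (rule exact_segment.intro) (rule P'' P' P \<delta>' \<delta> exact' | assumption)+
  have "\<delta>' T \<in> hom (ob P'' T) (ob P' T)" "\<delta> T \<in> hom (ob P' T) (ob P T)"
    using \<delta>' \<delta> T by (auto simp: fi_hom_def)
  moreover have "\<delta>' T ` H0_span P'' T \<subseteq> H0_span P' T" "\<delta> T ` H0_span P' T \<subseteq> H0_span P T"
    using S'.H0_span_image[OF T] H0_span_image[OF T] by auto
  moreover have "\<delta> T (\<delta>' T y) = \<one>\<^bsub>ob P T\<^esub>" if "y \<in> carrier (ob P'' T)" for y
    using exact'[OF T] that by (auto simp: kernel_def)
  ultimately have "trivial_group ((ob P' T Mod H0_span P' T)
      \<lparr>carrier := kernel (ob P' T Mod H0_span P' T) (ob P T Mod H0_span P T)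
         (\<lambda>C. H0_span P T <#>\<^bsub>ob P T\<^esub> \<delta> T ` C)\<rparr>
      Mod ((\<lambda>C. H0_span P' T <#>\<^bsub>ob P' T\<^esub> \<delta>' T ` C) ` carrier (ob P'' T Mod H0_span P'' T))) \<longleftrightarrow>
    (\<forall>x\<in>carrier (ob P' T). \<delta> T x \<in> H0_span P T \<longrightarrow>
      (\<exists>s\<in>H0_span P' T. \<exists>y\<in>carrier (ob P'' T). x = s \<otimes>\<^bsub>ob P' T\<^esub> \<delta>' T y))"
    by (intro trivial_middle_homology_iff S'.E'.grp E'.grp E.grp T
        S'.E'.H0_span_subgroup E'.H0_span_subgroup E.H0_span_subgroup ev_onto P'' P' P)
  also have "\<dots> \<longleftrightarrow> Z T \<inter> zdec R (fc P) T \<subseteq> zdec R Z T"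
    by (rule derived_iff[OF T, of \<delta>' P'', OF exact'[OF T]])
  finally show ?thesis
    by (simp add: fi_middle_homology_def H0_def H0_map_def[abs_def])
qed

end

lemma (in fi_map) trivial_H0_iff:
  assumes surj: "\<forall>S. finite S \<longrightarrow> \<theta> S ` fc V S = carrier (ob W S)" and T: "finite T"
  shows "trivial_group (ob (H0 W) T) \<longleftrightarrow> fc V T \<subseteq> zdec (fker V W \<theta>) (fc V) T"
proof -
  have "trivial_group (ob (H0 W) T) \<longleftrightarrow> carrier (ob W T) \<subseteq> H0_span W T"
    unfolding H0_def using trivial_FactGroup_iff[OF grp[OF T] H0_span_subgroup[OF surj T]] by simp
  also have "\<dots> \<longleftrightarrow> (\<forall>x\<in>fc V T. \<theta> T x \<in> H0_span W T)"
    using surj T by (auto simp flip: surj[rule_format])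
  also have "\<dots> \<longleftrightarrow> fc V T \<subseteq> zdec (fker V W \<theta>) (fc V) T"
    using mem_H0_span_iff[OF surj T] by blast
  finally show ?thesis .
qed

theorem theoremA:
  fixes W :: "'a::infinite fi_functor" and k d :: nat
  assumes "fi_module W"
    and "fi_degree (H0 W) \<le> ereal (real k)"
    and "fi_degree (FI_homology 1 W) \<le> ereal (real d)"
  shows "\<forall>p>0. fi_degree (FI_homology p W) \<le> ereal (real p + real k + real d - 1)"
proof -
  obtain P \<delta> \<epsilon> where res: "projective_resolution W P \<delta> \<epsilon>"
    and hom: "\<And>q. FI_homology (Suc q) W =
      fi_middle_homology (H0 (P (Suc (Suc q)))) (H0 (P (Suc q))) (H0 (P q))
        (H0_map (P (Suc (Suc q))) (P (Suc q)) (\<delta> (Suc q))) (H0_map (P (Suc q)) (P q) (\<delta> q))"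
    using FI_homology_Suc[OF assms(1)] by blast
  \<comment> \<open>The augmentation is treated as a differential into \<open>W\<close>, so that
    degree 0 fits the same exact segment as the others.\<close>
  define B where "B q = (case q of 0 \<Rightarrow> W | Suc q \<Rightarrow> P q)" for q
  define D where "D q = (case q of 0 \<Rightarrow> \<epsilon> | Suc q \<Rightarrow> \<delta> q)" for q
  have proj: "fi_projective (P q)" for q using res by (simp add: projective_resolution_def)
  then have P: "fi_module (P q)" for q by (simp add: fi_projective_def)
  have B: "fi_module (B q)" for q using P assms(1) by (simp add: B_def split: nat.split)
  have \<delta>: "\<delta> q \<in> fi_hom (P (Suc q)) (P q)" and D: "D q \<in> fi_hom (P q) (B q)" for q
    using res by (simp_all add: projective_resolution_def B_def D_def split: nat.split)
  have ex: "\<delta> q T ` carrier (ob (P (Suc q)) T) = kernel (ob (P q) T) (ob (B q) T) (D q T)"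
    if "finite T" for q T
    using res that by (simp add: projective_resolution_def B_def D_def split: nat.split)
  have seg: "exact_segment (P (Suc q)) (P q) (B q) (\<delta> q) (D q)" for q
    by (rule exact_segment.intro) (rule P B \<delta> D ex | assumption)+
  \<comment> \<open>\<open>A q / R q\<close> is the projective \<open>P q\<close>,
    \<open>A q / Z q\<close> the \<open>q\<close>-th syzygy, starting with \<open>W\<close> itself,
    and \<open>Z q / R q\<close> the next syzygy.\<close>
  define A where "A q = fc (P q)" for q
  define R where "R q = fker (P q) (P q) (ev (P q))" for q
  define Z where "Z q = fker (P q) (B q) (\<lambda>T x. D q T (ev (P q) T x))" for q
  interpret M: fi_map "P 0" "B 0" "\<lambda>T x. D 0 T (ev (P 0) T x)"
    by (rule fi_map_comp[OF P B D])
  have fams: "fam N (A q) (R q)" "fam N (A q) (Z q)" "fam N (Z q) (R q)" for N q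
  proof -
    interpret S: exact_segment "P (Suc q)" "P q" "B q" "\<delta> q" "D q" by (rule seg)
    show "fam N (A q) (R q)" "fam N (A q) (Z q)" "fam N (Z q) (R q)"
      unfolding A_def R_def Z_def by (rule S.E.fam_fker S.D.fam_fker S.fam_ZR)+
  qed
  have koszul_van_R: "koszul_van (A q) (R q) p T" if "finite T" "0 < p" for q p T
    unfolding A_def R_def by (rule koszul_van_projective[OF proj that])
  have triv: "trivial_group (ob (FI_homology (Suc q) W) T) \<longleftrightarrow>
      Z q T \<inter> zdec (R q) (A q) T \<subseteq> zdec (R q) (Z q) T" if T: "finite T" for q T
  proof -
    interpret S: exact_segment "P (Suc q)" "P q" "B q" "\<delta> q" "D q" by (rule seg)
    show ?thesis
      unfolding hom A_def R_def Z_def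
      by (rule S.trivial_homology_iff[OF T P \<delta>]) (use ex[of _ "Suc q"] in \<open>simp add: B_def D_def\<close>)
  qed
  have "\<forall>S. finite S \<longrightarrow> (\<lambda>x. D 0 S (ev (P 0) S x)) ` fc (P 0) S = carrier (ob (B 0) S)"
  proof (intro allI impI)
    fix S :: "nat set" assume S: "finite S"
    have "(\<lambda>x. D 0 S (ev (P 0) S x)) ` fc (P 0) S = D 0 S ` carrier (ob (P 0) S)"
      using ev_surj[OF P S, of 0] by (simp add: image_image[symmetric])
    then show "(\<lambda>x. D 0 S (ev (P 0) S x)) ` fc (P 0) S = carrier (ob (B 0) S)"
      using res S by (simp add: projective_resolution_def fi_surj_def B_def D_def)
  qed
  from M.trivial_H0_iff[OF this]
  have triv0: "trivial_group (ob (H0 W) T) \<longleftrightarrow> A 0 T \<subseteq> zdec (Z 0) (A 0) T" if "finite T" for T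
    using that by (simp add: A_def Z_def B_def)
  have pc: "push_closed (A 0)" "push_closed (R 0)" "push_closed (Z 0)"
    unfolding A_def R_def Z_def
    by (rule push_closed_fc M.push_closed_fker fi_map.push_closed_fker[OF fi_map_ev[OF P]])+
  have filt: "filt N (A 0)" "filt N (Z 0)" for N
    using fams(2)[of N 0] by (auto simp: fam_def)
  \<comment> \<open>Degree at most \<open>k\<close> means vanishing from size \<open>k + 1\<close>
    on, hence \<open>Suc k\<close>.\<close>
  have van0: "koszul_van (A 0) (Z 0) 0 T" if T: "T \<subseteq> {..<N}" and kT: "Suc k \<le> card T" for N T
  proof -
    have fT: "finite T" using T by (meson finite_lessThan finite_subset)
    have "A 0 {1..card T} \<subseteq> zdec (Z 0) (A 0) {1..card T}"
      using assms(2) kT triv0[of "{1..card T}"] by (simp add: fi_degree_le_iff)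
    then have "A 0 T \<subseteq> zdec (Z 0) (A 0) T"
      by (rule push_closed_transport[OF pc(1) _ push_closed_zdec[OF filt(1) pc(1,3)] fT, rotated -1])
        (auto simp: A_def)
    then show ?thesis by (simp add: fam.koszul_van_0_iff[OF fams(2) T])
  qed
  have van1: "koszul_van (A 0) (Z 0) 1 T" if T: "T \<subseteq> {..<N}" and dT: "int d < int (card T)" for N T
  proof (rule koszul_van_1_if[OF fams T koszul_van_R])
    show fT: "finite T" using T by (meson finite_lessThan finite_subset)
    have "Z 0 {1..card T} \<inter> zdec (R 0) (A 0) {1..card T} \<subseteq> zdec (R 0) (Z 0) {1..card T}"
      using assms(3) dT triv[of "{1..card T}" 0] by (simp add: fi_degree_le_iff)
    then show "Z 0 T \<inter> zdec (R 0) (A 0) T \<subseteq> zdec (R 0) (Z 0) T"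
      by (rule push_closed_transport[OF push_closed_Int[OF pc(3) push_closed_zdec[OF filt(1) pc(1,2)]]
            _ push_closed_zdec[OF filt(2) pc(3,2)] fT, rotated -1])
        (auto simp: Z_def fker_def)
  qed simp
  have sym: "sym_fam N (A 0) (Z 0) (\<lambda>i j. push (id(i := j)))" for N
    unfolding A_def Z_def by (rule M.sym_fam_fker)
  show ?thesis
  proof (intro allI impI)
    fix p :: nat assume "0 < p"
    then obtain m where m: "p = Suc m" by (cases p) auto
    have "trivial_group (ob (FI_homology p W) {1..n})" if n: "m + k + d < n" for n
    proof -
      have N: "{1..n} \<subseteq> {..<Suc n}" by auto
      \<comment> \<open>With degree \<open>Suc m\<close> and \<open>Suc k\<close> for
        \<open>k\<close>, the bound of \<open>koszul_van_regularity\<close> becomes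
        \<open>m + k + d\<close>.\<close>
      have "koszul_van (A 0) (Z 0) (Suc m) {1..n}"
        by (rule koszul_van_regularity[where k = "Suc k" and d = "int d", OF sym van0 van1 _ N]) (use n in auto)
      \<comment> \<open>Each step trades one Koszul degree for one syzygy, down to degree 1 of the
        \<open>m\<close>-th syzygy.\<close>
      then have "koszul_van (A q) (Z q) (Suc (m - q)) {1..n}" if "q \<le> m" for q
        using that
      proof (induction q)
        case (Suc q)
        interpret S: exact_segment "P (Suc q)" "P q" "B q" "\<delta> q" "D q" by (rule seg)
        have "Suc (m - q) = Suc (Suc (m - Suc q))" using Suc.prems by simp
        then have "koszul_van (A q) (Z q) (Suc (Suc (m - Suc q))) {1..n}" using Suc by simp
        then have "koszul_van (Z q) (R q) (Suc (m - Suc q)) {1..n}"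
          by (rule koszul_van_shift[OF fams N koszul_van_R, rotated -1]) auto
        then have "koszul_van (fc (P (Suc q))) (fker (P (Suc q)) (P q) (\<lambda>T x. \<delta> q T (ev (P (Suc q)) T x))) (Suc (m - Suc q)) {1..n}"
          unfolding Z_def R_def by (rule S.koszul_van_next[rotated]) simp
        then show ?case by (simp add: A_def Z_def B_def D_def)
      qed simp
      from this[of m] have "koszul_van (A m) (Z m) 1 {1..n}" by simp
      from koszul_van_1_only_if[OF fams N this] show ?thesis by (simp add: m triv)
    qed
    then have "fi_degree (FI_homology p W) \<le> ereal (real (m + k + d))"
      unfolding fi_degree_le_iff by blast
    then show "fi_degree (FI_homology p W) \<le> ereal (real p + real k + real d - 1)"
      by (simp add: m add.assoc)
  qed
qed

end
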